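(* For every constant $\alpha<\frac{4}{7}$ there is a constant $d_0$ such that the following holds. Let $p=\frac{d}{n}$ where $d_0\le d\le n^{1/4}$ ($d$ may depend on $n$). Then with high probability $$\chi_g(G_{n,p})\ \ge\ \frac{\alpha d}{\ln d}.$$ For every constant $\alpha>12$ there is a constant $d_0$ such that, for $p=\frac dn$ with $d_0\le d\le n^{1/4}$, with high probability $$\chi_g(G_{n,p})\ \le\ \frac{\alpha d}{\ln d}.$$
   Context: Coloring game: given a graph $G$ and a positive integer $k$, two players A and B alternately (A moves first) choose an uncolored vertex and assign it a color from $\{1,\dots,k\}$ so that the partial coloring stays proper (adjacent vertices get different colors). A wins if eventually all vertices are colored; B wins if at some point some uncolored vertex has all $k$ colors appearing among its neighbors. The game chromatic number $\chi_g(G)$ is the least $k$ for which A has a winning strategy. $G_{n,p}$ is the binomial random graph on vertex set $[n]=\{1,\dots,n\}$ with each edge present independently with probability $p$. "With high probability" (w.h.p.) means with probability tending to $1$ as $n\to\infty$. *)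

theory Defs
  imports Complex_Main
begin

definition nbr_colours :: "nat set set \<Rightarrow> (nat \<rightharpoonup> nat) \<Rightarrow> nat \<Rightarrow> nat set" where
  "nbr_colours E col v = {c. \<exists>u. {u, v} \<in> E \<and> col u = Some c}"

(* some uncoloured vertex sees all k colours among its neighbours: B has won *)
definition blocked :: "nat set \<Rightarrow> nat set set \<Rightarrow> nat \<Rightarrow> (nat \<rightharpoonup> nat) \<Rightarrow> bool" where
  "blocked V E k col \<longleftrightarrow> (\<exists>v\<in>V. v \<notin> dom col \<and> {1..k} \<subseteq> nbr_colours E col v)"

definition legal_move :: "nat set \<Rightarrow> nat set set \<Rightarrow> nat \<Rightarrow> (nat \<rightharpoonup> nat) \<Rightarrow> nat \<Rightarrow> nat \<Rightarrow> bool" where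
  "legal_move V E k col v c \<longleftrightarrow> v \<in> V \<and> v \<notin> dom col \<and> c \<in> {1..k} \<and> c \<notin> nbr_colours E col v"

inductive A_wins :: "nat set \<Rightarrow> nat set set \<Rightarrow> nat \<Rightarrow> bool \<Rightarrow> (nat \<rightharpoonup> nat) \<Rightarrow> bool"
  for V E k where
  all_coloured: "V \<subseteq> dom col \<Longrightarrow> A_wins V E k t col"
| A_move: "\<not> blocked V E k col \<Longrightarrow> legal_move V E k col v c \<Longrightarrow> A_wins V E k False (col(v \<mapsto> c))
            \<Longrightarrow> A_wins V E k True col"
| B_move: "\<not> blocked V E k col \<Longrightarrow> \<not> V \<subseteq> dom col
            \<Longrightarrow> (\<forall>v c. legal_move V E k col v c \<longrightarrow> A_wins V E k True (col(v \<mapsto> c)))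
            \<Longrightarrow> A_wins V E k False col"

definition game_chromatic :: "nat set \<Rightarrow> nat set set \<Rightarrow> nat" where
  "game_chromatic V E = (LEAST k. k > 0 \<and> A_wins V E k True Map.empty)"

definition all_pairs :: "nat \<Rightarrow> nat set set" where
  "all_pairs n = {{i, j} | i j. i \<in> {1..n} \<and> j \<in> {1..n} \<and> i \<noteq> j}"

definition Gnp_prob :: "nat \<Rightarrow> real \<Rightarrow> (nat set set \<Rightarrow> bool) \<Rightarrow> real" where
  "Gnp_prob n p P = (\<Sum>E\<in>{E. E \<subseteq> all_pairs n \<and> P E}.
       p ^ card E * (1 - p) ^ (card (all_pairs n) - card E))"

end

theory Submission
  imports Defs "HOL-Library.FuncSet" "HOL-Library.Disjoint_Sets" "HOL-Real_Asymp.Real_Asymp" "HOL-Analysis.Convex"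
begin

text \<open>Lower bound. Player B always colours the least uncoloured vertex with a uniformly random available
  colour. Against a fixed winning strategy of A the probabilities of the resulting colourings add up
  to 1, and the colour of a B-vertex has probability at most one over the number of colours that are
  absent from its already coloured neighbours. To first order only the final colouring, the set of
  B-vertices and a bounded number of time stamps on the A-vertices matter, so the sum of these
  probabilities over all \<open>O(k)\<^sup>n\<close> such labelled colourings bounds the indicator of a win of A. Since the
  B-vertices are coloured in increasing order, every edge influences at most one factor and the
  expectation factorises; it is exponentially small for \<open>k < (4/7) d / ln d\<close>.

  Upper bound. With \<open>12 d / ln d\<close> colours only few vertices can ever have few available colours,
  whatever the colouring, so A starts colouring those as soon as they appear. The vertices that
  nevertheless lose many further colours, closed under ``many neighbours shared with the set'', form a
  set so small that it is locally sparse: it can be listed such that every vertex shares few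
  neighbours with earlier ones. Every vertex outside then points to its first neighbour in the list, and
  A answers a move at a vertex by following these pointers until it reaches a vertex that was visited
  before, which it colours. New dangerous vertices are appended at the end, which changes no pointer.\<close>

section \<open>Expectations over random edge sets\<close>

text \<open>Lower bound, exponents as multiples of \<open>n ln d\<close> to first order, with
  \<open>k = c d / ln d\<close>: labelled colourings give \<open>1\<close>, properness gives
  \<open>- 1 / (2 c)\<close>, and the first \<open>r n\<close> moves of B give
  \<open>- r + r^2 / c\<close>, because the factor of a B-vertex starts near \<open>1 / k\<close>
  and grows with the number of coloured vertices. It reaches 1 near \<open>r = c / 2\<close>, where
  the product is cut off. The sum \<open>1 - 1 / (2 c) - c / 4\<close> is negative for
  \<open>c < 2 - sqrt 2\<close>, just above \<open>4 / 7\<close>; properness alone would stop at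
  \<open>1 / 2\<close>. Upper bound: against a fixed colouring a vertex typically keeps at least
  about \<open>D = d^(1 - 1 / c)\<close> colours, \<open>c = 12\<close>, and a union bound over
  colourings leaves about \<open>n ln d / D\<close> exceptions. The moment bound gives local
  sparsity for sets of size \<open>z\<close> only if \<open>z d^2\<close> is well below
  \<open>n D\<close>, which fails for the exceptions. Hence two levels of danger: the exceptions
  only limit the number of moves between restarts, and about \<open>n (ln d)^2 / D^2\<close>
  vertices have many neighbours among those moves. Sparsity then needs \<open>D^3\<close> well above
  \<open>(d ln d)^2\<close>.\<close>

definition expect :: "'e set \<Rightarrow> real \<Rightarrow> ('e set \<Rightarrow> real) \<Rightarrow> real" where
  "expect Q p F = (\<Sum>E\<in>Pow Q. p ^ card E * (1 - p) ^ card (Q - E) * F E)"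

lemma sum_Pow_Un:
  fixes H :: "'e set \<Rightarrow> real"
  assumes "Q1 \<inter> Q2 = {}" "finite Q1" "finite Q2"
  shows "(\<Sum>E\<in>Pow (Q1 \<union> Q2). H E) = (\<Sum>A\<in>Pow Q1. \<Sum>B\<in>Pow Q2. H (A \<union> B))"
proof -
  have "(\<Sum>A\<in>Pow Q1. \<Sum>B\<in>Pow Q2. H (A \<union> B)) = (\<Sum>(A,B)\<in>Pow Q1 \<times> Pow Q2. H (A \<union> B))"
    by (simp add: sum.cartesian_product)
  also have "\<dots> = (\<Sum>E\<in>Pow (Q1 \<union> Q2). H E)"
    by (rule sum.reindex_bij_witness[where i = "\<lambda>E. (E \<inter> Q1, E \<inter> Q2)" and j = "\<lambda>(A,B). A \<union> B"])
       (use assms in auto)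
  finally show ?thesis by simp
qed

text \<open>Independence of the edges in disjoint sets; every later independence argument reduces to
  this product rule.\<close>

lemma expect_Un:
  assumes "Q1 \<inter> Q2 = {}" "finite Q1" "finite Q2"
  shows "expect (Q1 \<union> Q2) p (\<lambda>E. F (E \<inter> Q1) * G (E \<inter> Q2)) =
         expect Q1 p F * expect Q2 p G"
proof -
  have "expect (Q1 \<union> Q2) p (\<lambda>E. F (E \<inter> Q1) * G (E \<inter> Q2)) =
     (\<Sum>A\<in>Pow Q1. \<Sum>B\<in>Pow Q2. (p ^ card A * (1 - p) ^ card (Q1 - A) * F A) *
        (p ^ card B * (1 - p) ^ card (Q2 - B) * G B))"
    unfolding expect_def sum_Pow_Un[OF assms]
  proof (intro sum.cong refl)
    fix A B assume AB: "A \<in> Pow Q1" "B \<in> Pow Q2"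
    have f: "finite A" "finite B" using AB assms finite_subset by auto
    have 1: "card (A \<union> B) = card A + card B"
      using AB assms f by (intro card_Un_disjoint) auto
    have "Q1 \<union> Q2 - (A \<union> B) = (Q1 - A) \<union> (Q2 - B)" using AB assms by auto
    hence 2: "card (Q1 \<union> Q2 - (A \<union> B)) = card (Q1 - A) + card (Q2 - B)"
      using AB assms f by (simp, intro card_Un_disjoint) auto
    have 3: "(A \<union> B) \<inter> Q1 = A" "(A \<union> B) \<inter> Q2 = B" using AB assms by auto
    show "p ^ card (A \<union> B) * (1 - p) ^ card (Q1 \<union> Q2 - (A \<union> B)) *
       (F ((A \<union> B) \<inter> Q1) * G ((A \<union> B) \<inter> Q2)) =
       p ^ card A * (1 - p) ^ card (Q1 - A) * F A * (p ^ card B * (1 - p) ^ card (Q2 - B) * G B)"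
      unfolding 1 2 3 by (simp add: power_add)
  qed
  thus ?thesis unfolding expect_def by (simp add: sum_product)
qed

text \<open>The generating function of a binomial number of edges: \<open>x = 1\<close> gives total
  mass 1, \<open>x = 0\<close> the probability that no edge is present, and larger \<open>x\<close>
  the exponential moments.\<close>

lemma expect_power_card:
  assumes "finite Q"
  shows "expect Q p (\<lambda>S. x ^ card S) = (1 + p * (x - 1)) ^ card Q"
  using assms
proof (induction Q)
  case (insert e Q)
  have s: "expect {e} p (\<lambda>S. x ^ card S) = 1 + p * (x - 1)"
    by (simp add: expect_def Pow_insert algebra_simps)
  have "expect ({e} \<union> Q) p (\<lambda>S. x ^ card (S \<inter> {e}) * x ^ card (S \<inter> Q)) =
     (1 + p * (x - 1)) ^ card (insert e Q)"
    using insert by (subst expect_Un[where F = "\<lambda>S. x ^ card S" and G = "\<lambda>S. x ^ card S"]) (auto simp: s)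
  moreover have "expect ({e} \<union> Q) p (\<lambda>S. x ^ card (S \<inter> {e}) * x ^ card (S \<inter> Q)) =
     expect (insert e Q) p (\<lambda>S. x ^ card S)"
    unfolding expect_def
  proof (intro sum.cong refl arg_cong2[where f = "(*)"])
    fix S assume S: "S \<in> Pow (insert e Q)"
    hence "S = (S \<inter> {e}) \<union> (S \<inter> Q)" by auto
    moreover have "card ((S \<inter> {e}) \<union> (S \<inter> Q)) = card (S \<inter> {e}) + card (S \<inter> Q)"
      using insert by (intro card_Un_disjoint) auto
    ultimately show "x ^ card (S \<inter> {e}) * x ^ card (S \<inter> Q) = x ^ card S"
      by (metis power_add)
  qed auto
  ultimately show ?case by simp
qed (simp add: expect_def)

lemma expect_const [simp]: "finite Q \<Longrightarrow> expect Q p (\<lambda>_. c) = c"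
  using expect_power_card[of Q p 1] by (simp add: expect_def flip: sum_distrib_right)

lemma expect_mono:
  assumes "0 \<le> p" "p \<le> 1" "\<And>E. E \<subseteq> Q \<Longrightarrow> F E \<le> G E"
  shows "expect Q p F \<le> expect Q p G"
  unfolding expect_def using assms by (intro sum_mono mult_left_mono) auto

lemma expect_nonneg:
  assumes "0 \<le> p" "p \<le> 1" "\<And>E. E \<subseteq> Q \<Longrightarrow> 0 \<le> F E"
  shows "0 \<le> expect Q p F"
  unfolding expect_def using assms by (intro sum_nonneg) auto

lemma expect_cong:
  "(\<And>E. E \<subseteq> Q \<Longrightarrow> F E = G E) \<Longrightarrow> expect Q p F = expect Q p G"
  unfolding expect_def by (intro sum.cong) auto

lemma expect_cmult: "expect Q p (\<lambda>E. c * F E) = c * expect Q p F"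
  unfolding expect_def sum_distrib_left by (intro sum.cong) auto

lemma expect_add: "expect Q p (\<lambda>E. F E + G E) = expect Q p F + expect Q p G"
  unfolding expect_def by (simp add: algebra_simps sum.distrib)

lemma expect_sum: "expect Q p (\<lambda>E. \<Sum>i\<in>I. F i E) = (\<Sum>i\<in>I. expect Q p (F i))"
  unfolding expect_def sum_distrib_left by (rule sum.swap)

lemma expect_restrict:
  assumes "B \<subseteq> Q" "finite Q"
  shows "expect Q p (\<lambda>E. F (E \<inter> B)) = expect B p F"
proof -
  have "expect (B \<union> (Q - B)) p (\<lambda>E. F (E \<inter> B) * 1) = expect B p F * expect (Q - B) p (\<lambda>_. 1)"
    using assms finite_subset
    by (subst expect_Un[where G = "\<lambda>_. 1", symmetric]) auto
  moreover have "B \<union> (Q - B) = Q" using assms by auto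
  ultimately show ?thesis using assms by simp
qed

lemma expect_prod:
  assumes "finite I" "finite Q" "\<And>i. i \<in> I \<Longrightarrow> B i \<subseteq> Q" "disjoint_family_on B I"
  shows "expect Q p (\<lambda>E. \<Prod>i\<in>I. F i (E \<inter> B i)) = (\<Prod>i\<in>I. expect (B i) p (F i))"
  using assms(1,3,4)
proof (induction I)
  case (insert j I)
  define U where "U = (\<Union>i\<in>I. B i)"
  have UQ: "U \<subseteq> Q" using insert.prems by (auto simp: U_def)
  have fin: "finite (B j)" "finite U"
    using insert.prems(1)[of j] UQ assms(2) by (auto dest: finite_subset)
  have disj: "B j \<inter> U = {}"
    using insert.prems(2) insert.hyps by (auto simp: U_def disjoint_family_on_def)
  have sub: "B j \<union> U \<subseteq> Q" using insert.prems UQ by auto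
  define G where "G = (\<lambda>S. \<Prod>i\<in>I. F i (S \<inter> B i))"
  have r: "(\<Prod>i\<in>insert j I. F i (E \<inter> B i)) = F j (E \<inter> (B j \<union> U) \<inter> B j) * G (E \<inter> (B j \<union> U) \<inter> U)" for E
  proof -
    have "E \<inter> (B j \<union> U) \<inter> B j = E \<inter> B j" by auto
    moreover have "E \<inter> (B j \<union> U) \<inter> U \<inter> B i = E \<inter> B i" if "i \<in> I" for i using that by (auto simp: U_def)
    ultimately show ?thesis using insert.hyps by (simp add: G_def)
  qed
  have "expect Q p (\<lambda>E. \<Prod>i\<in>insert j I. F i (E \<inter> B i)) =
        expect (B j \<union> U) p (\<lambda>E. F j (E \<inter> B j) * G (E \<inter> U))"
    unfolding r
    by (rule expect_restrict[OF sub assms(2), where F = "\<lambda>E. F j (E \<inter> B j) * G (E \<inter> U)"])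
  also have "\<dots> = expect (B j) p (F j) * expect U p G"
    by (rule expect_Un[OF disj fin])
  also have "expect U p G = expect Q p (\<lambda>E. G (E \<inter> U))"
    by (rule expect_restrict[OF UQ assms(2), symmetric])
  also have "(\<lambda>E. G (E \<inter> U)) = (\<lambda>E. \<Prod>i\<in>I. F i (E \<inter> B i))"
  proof (rule ext)
    fix E
    have "E \<inter> U \<inter> B i = E \<inter> B i" if "i \<in> I" for i using that by (auto simp: U_def)
    thus "G (E \<inter> U) = (\<Prod>i\<in>I. F i (E \<inter> B i))" by (simp add: G_def)
  qed
  also have "expect Q p \<dots> = (\<Prod>i\<in>I. expect (B i) p (F i))"
    using insert.prems by (intro insert.IH) (auto simp: disjoint_family_on_def)
  finally show ?case using insert.hyps by simp
qed (use assms(2) in simp)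

lemma expect_avoid:
  assumes "finite B"
  shows "expect B p (\<lambda>S. if S = {} then s else 1) = 1 - (1 - s) * (1 - p) ^ card B"
proof -
  \<comment> \<open>\<open>0 ^ card S\<close> is the indicator of \<open>S = {}\<close>, because
    \<open>0 ^ 0 = 1\<close>.\<close>
  have "expect B p (\<lambda>S. if S = {} then s else 1) = expect B p (\<lambda>S. 1 + (s - 1) * 0 ^ card S)"
    using assms by (intro expect_cong) (auto dest: finite_subset)
  also have "\<dots> = 1 + (s - 1) * (1 - p) ^ card B"
    using assms by (simp add: expect_add expect_cmult expect_power_card)
  finally show ?thesis by (simp add: algebra_simps)
qed

section \<open>Events of the random graph: Markov's inequality, union bounds, convergence to
  1\<close>

lemma all_pairs_eq: "all_pairs n = {e. e \<subseteq> {1..n} \<and> card e = 2}"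
proof (intro set_eqI iffI)
  fix e assume "e \<in> all_pairs n"
  thus "e \<in> {e. e \<subseteq> {1..n} \<and> card e = 2}" by (auto simp: all_pairs_def card_2_iff)
next
  fix e assume e: "e \<in> {e. e \<subseteq> {1..n} \<and> card e = 2}"
  then obtain i j where "e = {i, j}" "i \<noteq> j" by (auto simp: card_2_iff)
  thus "e \<in> all_pairs n" using e unfolding all_pairs_def by blast
qed

lemma finite_all_pairs [simp, intro]: "finite (all_pairs n)"
  unfolding all_pairs_eq by (rule finite_subset[of _ "Pow {1..n}"]) auto

lemma Gnp_prob_eq_expect:
  "Gnp_prob n p P = expect (all_pairs n) p (\<lambda>E. of_bool (P E))"
proof -
  have eq: "{E. E \<subseteq> all_pairs n \<and> P E} = {E \<in> Pow (all_pairs n). P E}" by auto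
  have "Gnp_prob n p P = (\<Sum>E\<in>Pow (all_pairs n). if P E then
      p ^ card E * (1 - p) ^ (card (all_pairs n) - card E) else 0)"
    unfolding Gnp_prob_def eq by (rule sum.inter_filter) auto
  also have "\<dots> = expect (all_pairs n) p (\<lambda>E. of_bool (P E))"
    unfolding expect_def
    by (intro sum.cong) (auto simp: card_Diff_subset finite_subset[OF _ finite_all_pairs])
  finally show ?thesis .
qed

lemma Gnp_prob_markov:
  assumes "0 \<le> p" "p \<le> 1" "\<And>E. E \<subseteq> all_pairs n \<Longrightarrow> P E \<Longrightarrow> 1 \<le> Z E"
    "\<And>E. E \<subseteq> all_pairs n \<Longrightarrow> 0 \<le> Z E"
  shows "Gnp_prob n p P \<le> expect (all_pairs n) p Z"
  unfolding Gnp_prob_eq_expect using assms by (intro expect_mono) auto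

lemma Gnp_prob_nonneg: "0 \<le> p \<Longrightarrow> p \<le> 1 \<Longrightarrow> 0 \<le> Gnp_prob n p P"
  unfolding Gnp_prob_eq_expect by (rule expect_nonneg) auto

lemma Gnp_prob_mono:
  assumes "0 \<le> p" "p \<le> 1" "\<And>E. E \<subseteq> all_pairs n \<Longrightarrow> P E \<Longrightarrow> P' E"
  shows "Gnp_prob n p P \<le> Gnp_prob n p P'"
  unfolding Gnp_prob_eq_expect using assms by (intro expect_mono) auto

lemma Gnp_prob_Bex_le:
  assumes "0 \<le> p" "p \<le> 1" "finite I"
  shows "Gnp_prob n p (\<lambda>E. \<exists>i\<in>I. P i E) \<le> (\<Sum>i\<in>I. Gnp_prob n p (P i))"
  unfolding Gnp_prob_eq_expect expect_sum[symmetric]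
proof (rule expect_mono[OF assms(1,2)])
  fix E
  show "of_bool (\<exists>i\<in>I. P i E) \<le> (\<Sum>i\<in>I. of_bool (P i E) :: real)"
  proof (cases "\<exists>i\<in>I. P i E")
    case True
    then obtain i where i: "i \<in> I" "P i E" by auto
    have "of_bool (P i E) \<le> (\<Sum>i\<in>I. of_bool (P i E) :: real)"
      by (rule member_le_sum) (use i assms in auto)
    thus ?thesis using i by simp
  qed (auto intro: sum_nonneg)
qed

lemma Gnp_prob_disj_le:
  assumes "0 \<le> p" "p \<le> 1"
  shows "Gnp_prob n p (\<lambda>E. P E \<or> P' E) \<le> Gnp_prob n p P + Gnp_prob n p P'"
  unfolding Gnp_prob_eq_expect expect_add[symmetric] using assms by (intro expect_mono) auto

lemma Gnp_prob_not: "Gnp_prob n p (\<lambda>E. \<not> P E) = 1 - Gnp_prob n p P"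
proof -
  have "expect (all_pairs n) p (\<lambda>E. of_bool (P E) + of_bool (\<not> P E)) = 1"
    using expect_cong[of "all_pairs n" "\<lambda>E. of_bool (P E) + of_bool (\<not> P E)" "\<lambda>_. 1" p] by simp
  thus ?thesis unfolding Gnp_prob_eq_expect expect_add by linarith
qed

text \<open>The probability is squeezed between \<open>1 - eps n\<close> and 1. \<open>Bad n\<close>
  only has to contain the complement of \<open>P n\<close>, so it may be a more convenient union of
  events.\<close>

lemma Gnp_prob_tendsto_1:
  assumes p: "\<forall>\<^sub>F n in sequentially. 0 \<le> p n \<and> p n \<le> 1"
    and imp: "\<forall>\<^sub>F n in sequentially. \<forall>E. E \<subseteq> all_pairs n \<longrightarrow> \<not> P n E \<longrightarrow> Bad n E"
    and bd: "\<forall>\<^sub>F n in sequentially. Gnp_prob n (p n) (Bad n) \<le> eps n"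
    and eps: "eps \<longlonglongrightarrow> 0"
  shows "(\<lambda>n. Gnp_prob n (p n) (P n)) \<longlonglongrightarrow> 1"
proof (rule tendsto_sandwich)
  show "\<forall>\<^sub>F n in sequentially. 1 - eps n \<le> Gnp_prob n (p n) (P n)"
    using p imp bd
  proof eventually_elim
    case (elim n)
    have "Gnp_prob n (p n) (\<lambda>E. \<not> P n E) \<le> Gnp_prob n (p n) (Bad n)"
      using elim by (intro Gnp_prob_mono) auto
    thus ?case using elim Gnp_prob_not[of n "p n" "P n"] by linarith
  qed
  show "\<forall>\<^sub>F n in sequentially. Gnp_prob n (p n) (P n) \<le> 1"
    using p
  proof eventually_elim
    case (elim n)
    thus ?case using Gnp_prob_not[of n "p n" "P n"] Gnp_prob_nonneg[of "p n" n "\<lambda>E. \<not> P n E"] by linarith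
  qed
  show "(\<lambda>n. 1 - eps n) \<longlonglongrightarrow> 1" using tendsto_diff[OF tendsto_const eps, of 1] by simp
qed auto

section \<open>The lower bound: weights of plays\<close>

text \<open>A labelling \<open>g\<close> stores for every vertex its colour and a stamp: 0 for a vertex coloured by B, and
  \<open>l \<ge> 1\<close> for a vertex coloured by A in one of its moves number \<open>(l - 1) q + 1, \<dots>, l q\<close>.\<close>

definition B_set :: "nat set \<Rightarrow> (nat \<Rightarrow> nat \<times> nat) \<Rightarrow> nat set" where
  "B_set V g = {v \<in> V. snd (g v) = 0}"

definition B_rank :: "nat set \<Rightarrow> (nat \<Rightarrow> nat \<times> nat) \<Rightarrow> nat \<Rightarrow> nat" where
  "B_rank V g v = card {w \<in> B_set V g. w < v}"

text \<open>A superset, read off the labelling alone, of the vertices coloured before the B-vertex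
  \<open>v\<close>. At B's move of rank \<open>r\<close>, counted from 0, A has made
  \<open>r + 1\<close> moves, with stamps at most \<open>r div q + 1\<close>. Rounding up to the end
  of a block costs fewer than \<open>q\<close> extra vertices.\<close>

definition earlier :: "nat set \<Rightarrow> nat \<Rightarrow> (nat \<Rightarrow> nat \<times> nat) \<Rightarrow> nat \<Rightarrow> nat set" where
  "earlier V q g v = {u \<in> B_set V g. u < v} \<union>
     {u \<in> V. 1 \<le> snd (g u) \<and> snd (g u) \<le> B_rank V g v div q + 1}"

text \<open>Leaving out the colour of \<open>v\<close> makes this set depend only on pairs with
  differently coloured ends, hence independent of properness.\<close>

definition missing :: "nat set \<Rightarrow> nat set set \<Rightarrow> nat \<Rightarrow> nat \<Rightarrow> (nat \<Rightarrow> nat \<times> nat) \<Rightarrow> nat \<Rightarrow> nat set" where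
  "missing V E k q g v =
     {i \<in> {1..k} - {fst (g v)}. \<forall>u \<in> earlier V q g v. fst (g u) = i \<longrightarrow> {u, v} \<notin> E}"

text \<open>Bounds the probability that B, choosing uniformly among the available colours, gives
  \<open>v\<close> its colour; the summand 1 counts that colour itself.\<close>

abbreviation pick_bound :: "nat set \<Rightarrow> nat set set \<Rightarrow> nat \<Rightarrow> nat \<Rightarrow> (nat \<Rightarrow> nat \<times> nat) \<Rightarrow> nat \<Rightarrow> real" where
  "pick_bound V E k q g v \<equiv> 1 / (1 + real (card (missing V E k q g v)))"

text \<open>The cardinality conditions hold for every finished play, since A moves first and a block
  consists of \<open>q\<close> moves. They are what limits \<open>earlier\<close>.\<close>

definition histories :: "nat set \<Rightarrow> nat \<Rightarrow> nat \<Rightarrow> nat \<Rightarrow> (nat \<Rightarrow> nat \<times> nat) set" where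
  "histories V k L q = {g \<in> V \<rightarrow>\<^sub>E {1..k} \<times> {0..L}. card (B_set V g) = card V div 2 \<and>
     (\<forall>l. card {u \<in> V. 1 \<le> snd (g u) \<and> snd (g u) \<le> l} \<le> l * q)}"

definition proper :: "nat set \<Rightarrow> nat set set \<Rightarrow> (nat \<Rightarrow> nat \<times> nat) \<Rightarrow> bool" where
  "proper V E g \<longleftrightarrow> (\<forall>u\<in>V. \<forall>v\<in>V. {u, v} \<in> E \<longrightarrow> fst (g u) \<noteq> fst (g v))"

text \<open>Invariant of an unfinished play, with A to move iff \<open>t\<close>, where
  \<open>\<rho>\<close> holds the stamps given so far. The stamp bound is the stamp of A's latest
  move. The last clause is what B's rule of taking the least uncoloured vertex maintains.\<close>

definition compatible :: "nat set \<Rightarrow> nat set set \<Rightarrow> nat \<Rightarrow> nat \<Rightarrow> bool \<Rightarrow> (nat \<rightharpoonup> nat) \<Rightarrow> (nat \<Rightarrow> nat) \<Rightarrow> bool" where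
  "compatible V E k q t col \<rho> \<longleftrightarrow>
     dom col \<subseteq> V \<and> ran col \<subseteq> {1..k} \<and>
     (\<forall>u\<in>dom col. \<forall>v\<in>dom col. {u, v} \<in> E \<longrightarrow> col u \<noteq> col v) \<and>
     card {u \<in> dom col. 1 \<le> \<rho> u} = card {u \<in> dom col. \<rho> u = 0} + (if t then 0 else 1) \<and>
     (\<forall>u\<in>dom col. \<rho> u \<le> (card {u \<in> dom col. 1 \<le> \<rho> u} - 1) div q + 1) \<and>
     (\<forall>l. card {u \<in> dom col. 1 \<le> \<rho> u \<and> \<rho> u \<le> l} \<le> l * q) \<and>
     (\<forall>w\<in>dom col. \<rho> w = 0 \<longrightarrow> (\<forall>u\<in>V - dom col. w < u))"

definition extends :: "(nat \<Rightarrow> nat \<times> nat) \<Rightarrow> (nat \<rightharpoonup> nat) \<Rightarrow> (nat \<Rightarrow> nat) \<Rightarrow> bool" where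
  "extends g col \<rho> \<longleftrightarrow> (\<forall>v\<in>dom col. g v = (the (col v), \<rho> v))"

lemma finite_histories [simp, intro]: "finite V \<Longrightarrow> finite (histories V k L q)"
  by (rule finite_subset[of _ "V \<rightarrow>\<^sub>E {1..k} \<times> {0..L}"]) (auto simp: histories_def intro!: finite_PiE)

lemma finite_missing [simp, intro]: "finite (missing V E k q g v)"
  by (simp add: missing_def)

context
  fixes V :: "nat set" and E :: "nat set set" and k q L :: nat
  assumes finV: "finite V" and loopless: "\<And>v. {v} \<notin> E" and q: "q > 0" and L: "card V + 1 \<le> 2 * (L * q)"
begin

lemma compatible_count:
  assumes "compatible V E k q t col \<rho>"
  shows "card (dom col) = 2 * card {u \<in> dom col. \<rho> u = 0} + (if t then 0 else 1)"
proof -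
  have f: "finite (dom col)" using assms finV finite_subset[of "dom col" V] by (simp add: compatible_def)
  have "dom col = {u \<in> dom col. 1 \<le> \<rho> u} \<union> {u \<in> dom col. \<rho> u = 0}" by auto
  also have "card \<dots> = card {u \<in> dom col. 1 \<le> \<rho> u} + card {u \<in> dom col. \<rho> u = 0}"
    using f by (intro card_Un_disjoint) auto
  finally show ?thesis using assms by (simp add: compatible_def)
qed

lemma compatible_finished:
  assumes c: "compatible V E k q t col \<rho>" and fin: "V \<subseteq> dom col"
  shows "\<exists>g\<in>histories V k L q. proper V E g \<and> extends g col \<rho>"
proof -
  have dom: "dom col = V" using assms by (auto simp: compatible_def)
  define g where "g = (\<lambda>v\<in>V. (the (col v), \<rho> v))"
  define a where "a = card {u \<in> V. 1 \<le> \<rho> u}"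
  have gV: "g v = (the (col v), \<rho> v)" if "v \<in> V" for v using that by (simp add: g_def)
  have colV: "the (col v) \<in> {1..k}" if "v \<in> V" for v
    using c that dom by (auto simp: compatible_def ran_def)
  have a: "a = card {u \<in> V. \<rho> u = 0} + (if t then 0 else 1)" using c dom by (simp add: compatible_def a_def)
  have cV: "card V = 2 * card {u \<in> V. \<rho> u = 0} + (if t then 0 else 1)"
    using compatible_count[OF c] dom by simp
  have roleL: "\<rho> v \<le> L" if "v \<in> V" for v
  proof (cases "\<rho> v = 0")
    case False
    have "v \<in> {u \<in> V. 1 \<le> \<rho> u}" using that False by auto
    hence a0: "a > 0" using finV by (auto simp: a_def card_gt_0_iff)
    \<comment> \<open>A makes at most half of \<open>card V + 1\<close> moves, which is what the
      assumption on \<open>L\<close> provides for.\<close>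
    have "a - 1 < L * q" using a0 a cV L by (auto split: if_splits)
    hence "(a - 1) div q < L" by (simp add: less_mult_imp_div_less)
    moreover have "\<rho> v \<le> (a - 1) div q + 1" using c that unfolding compatible_def a_def dom by blast
    ultimately show ?thesis by linarith
  qed simp
  have "B_set V g = {u \<in> V. \<rho> u = 0}" by (auto simp: B_set_def gV)
  hence "card (B_set V g) = card V div 2" using cV by auto
  moreover have "{u \<in> V. 1 \<le> snd (g u) \<and> snd (g u) \<le> l} = {u \<in> dom col. 1 \<le> \<rho> u \<and> \<rho> u \<le> l}" for l
    unfolding dom by (auto simp: gV)
  moreover have "g \<in> V \<rightarrow>\<^sub>E {1..k} \<times> {0..L}" using colV roleL by (auto simp: g_def)
  ultimately have "g \<in> histories V k L q" using c by (auto simp: histories_def compatible_def)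
  moreover have "proper V E g"
    unfolding proper_def
  proof (intro ballI impI)
    fix u v assume uv: "u \<in> V" "v \<in> V" "{u, v} \<in> E"
    hence "col u \<noteq> col v" using c dom by (auto simp: compatible_def)
    thus "fst (g u) \<noteq> fst (g v)" using uv dom by (auto simp: gV)
  qed
  moreover have "extends g col \<rho>" using dom by (auto simp: extends_def gV)
  ultimately show ?thesis by blast
qed

lemma legal_move_proper:
  assumes "\<forall>u\<in>dom col. \<forall>v\<in>dom col. {u, v} \<in> E \<longrightarrow> col u \<noteq> col v" "legal_move V E k col x c"
  shows "\<forall>u\<in>dom (col(x \<mapsto> c)). \<forall>v\<in>dom (col(x \<mapsto> c)). {u, v} \<in> E \<longrightarrow> (col(x \<mapsto> c)) u \<noteq> (col(x \<mapsto> c)) v"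
proof (intro ballI impI)
  fix u v assume uv: "u \<in> dom (col(x \<mapsto> c))" "v \<in> dom (col(x \<mapsto> c))" "{u, v} \<in> E"
  have neq: "u \<noteq> v" using uv(3) loopless[of u] by auto
  have new: "col w \<noteq> Some c" if "{w, x} \<in> E" for w
    using assms(2) that by (auto simp: legal_move_def nbr_colours_def)
  show "(col(x \<mapsto> c)) u \<noteq> (col(x \<mapsto> c)) v"
    using uv neq assms(1) new[of u] new[of v] by (auto simp: insert_commute)
qed

lemma compatible_A_move:
  assumes c: "compatible V E k q True col \<rho>" and m: "legal_move V E k col v i"
  shows "compatible V E k q False (col(v \<mapsto> i)) (\<rho>(v := card {u \<in> dom col. 1 \<le> \<rho> u} div q + 1))"
proof -
  let ?c = "col(v \<mapsto> i)"
  define a where "a = card {u \<in> dom col. 1 \<le> \<rho> u}"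
  let ?r = "\<rho>(v := a div q + 1)"
  have f: "finite (dom col)" using c finV finite_subset[of "dom col" V] by (simp add: compatible_def)
  have v: "v \<in> V" "v \<notin> dom col" "i \<in> {1..k}" using m by (auto simp: legal_move_def)
  have A: "{u \<in> dom ?c. 1 \<le> ?r u} = insert v {u \<in> dom col. 1 \<le> \<rho> u}" using v by auto
  have cA: "card {u \<in> dom ?c. 1 \<le> ?r u} = a + 1" 
  proof -
    have "card (insert v {u \<in> dom col. 1 \<le> \<rho> u}) = Suc a"
      unfolding a_def using f v by (intro card_insert_disjoint) auto
    thus ?thesis unfolding A by simp
  qed
  have B: "{u \<in> dom ?c. ?r u = 0} = {u \<in> dom col. \<rho> u = 0}" using v by auto
  have old: "\<rho> u \<le> a div q + 1" if "u \<in> dom col" for u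
  proof -
    have "\<rho> u \<le> (a - 1) div q + 1" using c that unfolding compatible_def a_def by blast
    also have "\<dots> \<le> a div q + 1" by (simp add: div_le_mono)
    finally show ?thesis .
  qed
  have L': "card {u \<in> dom ?c. 1 \<le> ?r u \<and> ?r u \<le> l} \<le> l * q" for l
  proof (cases "a div q + 1 \<le> l")
    case True
    have "card {u \<in> dom ?c. 1 \<le> ?r u \<and> ?r u \<le> l} \<le> card {u \<in> dom ?c. 1 \<le> ?r u}"
      using f by (intro card_mono) auto
    also have "\<dots> = a + 1" by (rule cA)
    \<comment> \<open>Blocks fill up in order, so the current one still has room for move number
      \<open>a + 1\<close>.\<close>
    also have "\<dots> \<le> (a div q + 1) * q" using q by (metis Suc_eq_plus1 Suc_leI dividend_less_times_div mult.commute mult_Suc_right add.commute)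
    also have "\<dots> \<le> l * q" using True by (rule mult_le_mono1)
    finally show ?thesis .
  next
    case False
    hence "{u \<in> dom ?c. 1 \<le> ?r u \<and> ?r u \<le> l} = {u \<in> dom col. 1 \<le> \<rho> u \<and> \<rho> u \<le> l}"
      using v by auto
    thus ?thesis using c by (simp add: compatible_def)
  qed
  show ?thesis
    unfolding compatible_def a_def[symmetric] cA B
  proof (intro conjI)
    show "dom ?c \<subseteq> V" "ran ?c \<subseteq> {1..k}" using c v by (auto simp: compatible_def)
    show "\<forall>u\<in>dom ?c. \<forall>w\<in>dom ?c. {u, w} \<in> E \<longrightarrow> ?c u \<noteq> ?c w"
      using c by (intro legal_move_proper m) (simp add: compatible_def)
    show "a + 1 = card {u \<in> dom col. \<rho> u = 0} + (if False then 0 else 1)"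
      using c by (simp add: compatible_def a_def)
    show "\<forall>u\<in>dom ?c. ?r u \<le> (a + 1 - 1) div q + 1" using old by auto
    show "\<forall>l. card {u \<in> dom ?c. 1 \<le> ?r u \<and> ?r u \<le> l} \<le> l * q" using L' by blast
    show "\<forall>w\<in>dom ?c. ?r w = 0 \<longrightarrow> (\<forall>u\<in>V - dom ?c. w < u)"
      using c v by (auto simp: compatible_def)
  qed
qed

lemma compatible_B_move:
  assumes c: "compatible V E k q False col \<rho>" and m: "legal_move V E k col v i"
    and v_min: "\<And>u. u \<in> V - dom col \<Longrightarrow> v \<le> u"
  shows "compatible V E k q True (col(v \<mapsto> i)) (\<rho>(v := 0))"
proof -
  let ?c = "col(v \<mapsto> i)"
  let ?r = "\<rho>(v := 0)"
  have f: "finite (dom col)" using c finV finite_subset[of "dom col" V] by (simp add: compatible_def)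
  have v: "v \<in> V" "v \<notin> dom col" "i \<in> {1..k}" using m by (auto simp: legal_move_def)
  have A: "{u \<in> dom ?c. 1 \<le> ?r u} = {u \<in> dom col. 1 \<le> \<rho> u}" using v by auto
  have B: "{u \<in> dom ?c. ?r u = 0} = insert v {u \<in> dom col. \<rho> u = 0}" using v by auto
  have cB: "card {u \<in> dom ?c. ?r u = 0} = card {u \<in> dom col. \<rho> u = 0} + 1"
    unfolding B using f v by (subst card_insert_disjoint) auto
  have Al: "{u \<in> dom ?c. 1 \<le> ?r u \<and> ?r u \<le> l} = {u \<in> dom col. 1 \<le> \<rho> u \<and> \<rho> u \<le> l}" for l
    using v by auto
  show ?thesis
    unfolding compatible_def cB A Al
  proof (intro conjI)
    show "dom ?c \<subseteq> V" "ran ?c \<subseteq> {1..k}" using c v by (auto simp: compatible_def)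
    show "\<forall>u\<in>dom ?c. \<forall>w\<in>dom ?c. {u, w} \<in> E \<longrightarrow> ?c u \<noteq> ?c w"
      using c by (intro legal_move_proper m) (simp add: compatible_def)
    show "\<forall>w\<in>dom ?c. ?r w = 0 \<longrightarrow> (\<forall>u\<in>V - dom ?c. w < u)"
      using c v v_min by (auto simp: compatible_def order.strict_iff_order)
  qed (use c in \<open>auto simp: compatible_def\<close>)
qed

text \<open>Every coloured vertex lies in \<open>earlier\<close>: the B-vertices because B proceeds
  in increasing order, the A-vertices by the stamp bound. Hence a colour absent from the neighbours
  in \<open>earlier\<close> was legal for B, and the chosen colour \<open>i\<close> is one more
  legal colour.\<close>

lemma missing_subset_legal:
  assumes c: "compatible V E k q False col \<rho>" and m: "legal_move V E k col v i"
    and v_min: "\<And>u. u \<in> V - dom col \<Longrightarrow> v \<le> u"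
    and g: "extends g (col(v \<mapsto> i)) (\<rho>(v := 0))"
  shows "insert i (missing V E k q g v) \<subseteq> {i. legal_move V E k col v i}"
    and "i \<notin> missing V E k q g v"
proof -
  have v: "v \<in> V" "v \<notin> dom col" "i \<in> {1..k}" using m by (auto simp: legal_move_def)
  have gu: "g u = (the (col u), \<rho> u)" if "u \<in> dom col" for u
    using g that v by (auto simp: extends_def)
  have gv: "g v = (i, 0)" using g by (auto simp: extends_def)
  show "i \<notin> missing V E k q g v" by (simp add: missing_def gv)
  have domV: "dom col \<subseteq> V" using c by (simp add: compatible_def)
  have before: "u \<in> dom col" if "u \<in> V" "u < v" for u using v_min[of u] that by force
  have less: "u < v" if "u \<in> dom col" "\<rho> u = 0" for u
    using c v that unfolding compatible_def by blast
  have "{w \<in> B_set V g. w < v} = {u \<in> dom col. \<rho> u = 0}"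
  proof (intro set_eqI iffI)
    fix w assume "w \<in> {w \<in> B_set V g. w < v}"
    hence w: "w \<in> V" "w < v" "snd (g w) = 0" by (auto simp: B_set_def)
    thus "w \<in> {u \<in> dom col. \<rho> u = 0}" using before[OF w(1,2)] gu[of w] by simp
  next
    fix w assume "w \<in> {u \<in> dom col. \<rho> u = 0}"
    hence w: "w \<in> dom col" "\<rho> w = 0" by auto
    thus "w \<in> {w \<in> B_set V g. w < v}" using less[OF w] gu[OF w(1)] domV by (auto simp: B_set_def)
  qed
  \<comment> \<open>It is B's turn, so A is exactly one move ahead.\<close>
  hence rank: "card {u \<in> dom col. 1 \<le> \<rho> u} = B_rank V g v + 1"
    using c by (simp add: B_rank_def compatible_def)
  have early: "u \<in> earlier V q g v" if u: "u \<in> dom col" for u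
  proof (cases "\<rho> u = 0")
    case True
    hence "u < v" using less u by blast
    thus ?thesis using True gu[OF u] u domV by (auto simp: earlier_def B_set_def)
  next
    case False
    have "\<rho> u \<le> (card {u \<in> dom col. 1 \<le> \<rho> u} - 1) div q + 1"
      using c u unfolding compatible_def by blast
    thus ?thesis unfolding rank using False gu[OF u] u domV by (auto simp: earlier_def)
  qed
  show "insert i (missing V E k q g v) \<subseteq> {i. legal_move V E k col v i}"
  proof
    fix j assume j: "j \<in> insert i (missing V E k q g v)"
    show "j \<in> {i. legal_move V E k col v i}"
    proof (cases "j = i")
      case False
      hence jm: "j \<in> missing V E k q g v" using j by simp
      have "j \<notin> nbr_colours E col v"
      proof
        assume "j \<in> nbr_colours E col v"
        then obtain u where u: "{u, v} \<in> E" "col u = Some j" by (auto simp: nbr_colours_def)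
        hence "u \<in> dom col" by auto
        thus False using jm early[of u] gu[of u] u by (auto simp: missing_def)
      qed
      thus ?thesis using jm v by (auto simp: legal_move_def missing_def)
    qed (use m in simp)
  qed
qed

text \<open>The derivation of \<open>A_wins\<close> is a winning strategy, and the induction follows
  it. From the given position the plays against a random B have probabilities with sum 1, dominated
  by these weights. A move of A keeps the family of labellings; a move of B joins the families
  belonging to its legal colours.\<close>

lemma A_wins_imp_histories:
  assumes "A_wins V E k t col" "compatible V E k q t col \<rho>"
  shows "\<exists>G \<subseteq> histories V k L q. (\<forall>g\<in>G. proper V E g \<and> extends g col \<rho>) \<and>
     1 \<le> (\<Sum>g\<in>G. \<Prod>v\<in>B_set V g - dom col. pick_bound V E k q g v)"
  using assms
proof (induction arbitrary: \<rho> rule: A_wins.induct)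
  case (all_coloured col t)
  obtain g where g: "g \<in> histories V k L q" "proper V E g" "extends g col \<rho>"
    using compatible_finished[OF all_coloured.prems all_coloured.hyps] by blast
  have "B_set V g - dom col = {}" using all_coloured.hyps by (auto simp: B_set_def)
  hence "(\<Prod>v\<in>B_set V g - dom col. pick_bound V E k q g v) = 1"
    by (simp only: prod.empty)
  thus ?case using g by (intro exI[of _ "{g}"]) simp
next
  case (A_move col v c)
  define r where "r = card {u \<in> dom col. 1 \<le> \<rho> u} div q + 1"
  obtain G where G: "G \<subseteq> histories V k L q"
     "\<And>g. g \<in> G \<Longrightarrow> proper V E g \<and> extends g (col(v \<mapsto> c)) (\<rho>(v := r))"
     "1 \<le> (\<Sum>g\<in>G. \<Prod>v\<in>B_set V g - dom (col(v \<mapsto> c)). pick_bound V E k q g v)"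
    using A_move.IH[OF compatible_A_move[OF A_move.prems A_move.hyps(2)]] unfolding r_def by blast
  have vn: "v \<notin> dom col" using A_move.hyps(2) by (simp add: legal_move_def)
  have ext: "extends g col \<rho>" if "g \<in> G" for g
    using G(2)[OF that] vn by (auto simp: extends_def split: if_splits)
  have eq: "B_set V g - dom col = B_set V g - dom (col(v \<mapsto> c))" if "g \<in> G" for g
  proof -
    have "snd (g v) \<noteq> 0" using G(2)[OF that] by (auto simp: extends_def r_def)
    thus ?thesis by (auto simp: B_set_def)
  qed
  have "(\<Sum>g\<in>G. \<Prod>v\<in>B_set V g - dom col. pick_bound V E k q g v) =
        (\<Sum>g\<in>G. \<Prod>v\<in>B_set V g - dom (col(v \<mapsto> c)). pick_bound V E k q g v)"
    by (intro sum.cong refl) (simp only: eq)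
  hence "1 \<le> (\<Sum>g\<in>G. \<Prod>v\<in>B_set V g - dom col. pick_bound V E k q g v)"
    using G(3) by (simp only:)
  thus ?case using G(1,2) ext by (intro exI[of _ G]) blast
next
  case (B_move col)
  define v where "v = Min (V - dom col)"
  have ne: "V - dom col \<noteq> {}" "finite (V - dom col)" using B_move.hyps finV by auto
  have v: "v \<in> V" "v \<notin> dom col" using Min_in[OF ne(2,1)] by (auto simp: v_def)
  have v_min: "v \<le> u" if "u \<in> V - dom col" for u using Min_le[OF ne(2) that] by (simp add: v_def)
  define Av where "Av = {i. legal_move V E k col v i}"
  have finAv: "finite Av" by (rule finite_subset[of _ "{1..k}"]) (auto simp: Av_def legal_move_def)
  have Avne: "Av \<noteq> {}"
    using B_move.hyps(1) v by (auto simp: Av_def blocked_def legal_move_def)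
  have "\<forall>i\<in>Av. \<exists>G \<subseteq> histories V k L q. (\<forall>g\<in>G. proper V E g \<and> extends g (col(v \<mapsto> i)) (\<rho>(v := 0))) \<and>
     1 \<le> (\<Sum>g\<in>G. \<Prod>v\<in>B_set V g - dom (col(v \<mapsto> i)). pick_bound V E k q g v)"
  proof
    fix i assume "i \<in> Av"
    hence m: "legal_move V E k col v i" by (simp add: Av_def)
    from B_move.IH m compatible_B_move[OF B_move.prems m v_min]
    show "\<exists>G \<subseteq> histories V k L q. (\<forall>g\<in>G. proper V E g \<and> extends g (col(v \<mapsto> i)) (\<rho>(v := 0))) \<and>
     1 \<le> (\<Sum>g\<in>G. \<Prod>v\<in>B_set V g - dom (col(v \<mapsto> i)). pick_bound V E k q g v)"
      by blast
  qed
  from bchoice[OF this] obtain H where H0: "\<forall>i\<in>Av. H i \<subseteq> histories V k L q \<and>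
     (\<forall>g\<in>H i. proper V E g \<and> extends g (col(v \<mapsto> i)) (\<rho>(v := 0))) \<and>
     1 \<le> (\<Sum>g\<in>H i. \<Prod>v\<in>B_set V g - dom (col(v \<mapsto> i)). pick_bound V E k q g v)"
    by blast
  have H: "\<And>i. i \<in> Av \<Longrightarrow> H i \<subseteq> histories V k L q"
     "\<And>i g. i \<in> Av \<Longrightarrow> g \<in> H i \<Longrightarrow> proper V E g \<and> extends g (col(v \<mapsto> i)) (\<rho>(v := 0))"
     "\<And>i. i \<in> Av \<Longrightarrow> 1 \<le> (\<Sum>g\<in>H i. \<Prod>v\<in>B_set V g - dom (col(v \<mapsto> i)). pick_bound V E k q g v)"
    using H0 by blast+
  let ?m = "\<lambda>g v. pick_bound V E k q g v"
  have finH: "finite (H i)" if "i \<in> Av" for i using H(1)[OF that] finV finite_subset by blast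
  have gv: "g v = (i, 0)" if "i \<in> Av" "g \<in> H i" for i g using H(2)[OF that] by (auto simp: extends_def)
  \<comment> \<open>The colour recorded at \<open>v\<close> tells the families apart, so no
    labelling is counted twice.\<close>
  have disj: "H i \<inter> H j = {}" if "i \<in> Av" "j \<in> Av" "i \<noteq> j" for i j
  proof -
    have False if "g \<in> H i" "g \<in> H j" for g
      using gv[of i g] gv[of j g] that \<open>i \<in> Av\<close> \<open>j \<in> Av\<close> \<open>i \<noteq> j\<close> by simp
    thus ?thesis by blast
  qed
  have step: "?m g v * (\<Prod>w\<in>B_set V g - dom (col(v \<mapsto> i)). ?m g w) = (\<Prod>w\<in>B_set V g - dom col. ?m g w)"
    if "i \<in> Av" "g \<in> H i" for i g
  proof -
    have mem: "v \<in> B_set V g - dom col" using gv[OF that] v by (auto simp: B_set_def)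
    have rem: "B_set V g - dom (col(v \<mapsto> i)) = (B_set V g - dom col) - {v}" by auto
    have "finite (B_set V g - dom col)" using finV by (auto simp: B_set_def)
    from prod.remove[OF this mem, of "?m g"] show ?thesis by (simp only: rem)
  qed
  have mle: "1 / real (card Av) \<le> ?m g v" if "i \<in> Av" "g \<in> H i" for i g
  proof -
    have m: "legal_move V E k col v i" using that by (simp add: Av_def)
    note s = missing_subset_legal[OF B_move.prems m v_min conjunct2[OF H(2)[OF that]]]
    have "card (insert i (missing V E k q g v)) \<le> card Av"
      using s(1) finAv by (intro card_mono) (auto simp: Av_def)
    hence "1 + card (missing V E k q g v) \<le> card Av" using s(2) by simp
    hence "1 + real (card (missing V E k q g v)) \<le> real (card Av)" by linarith
    thus ?thesis by (intro divide_left_mono) auto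
  qed
  define G where "G = (\<Union>i\<in>Av. H i)"
  \<comment> \<open>Uniform choice: each of the \<open>card Av\<close> continuations has total
    weight at least 1 and is entered with probability \<open>1 / card Av\<close>.\<close>
  have "1 = (\<Sum>i\<in>Av. 1 / real (card Av))" using Avne finAv by simp
  also have "\<dots> \<le> (\<Sum>i\<in>Av. \<Sum>g\<in>H i. \<Prod>w\<in>B_set V g - dom col. ?m g w)"
  proof (rule sum_mono)
    fix i assume i: "i \<in> Av"
    have "1 / real (card Av) * 1 \<le> 1 / real (card Av) * (\<Sum>g\<in>H i. \<Prod>w\<in>B_set V g - dom (col(v \<mapsto> i)). ?m g w)"
      using H(3)[OF i] by (intro mult_left_mono) auto
    also have "\<dots> = (\<Sum>g\<in>H i. 1 / real (card Av) * (\<Prod>w\<in>B_set V g - dom (col(v \<mapsto> i)). ?m g w))"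
      by (rule sum_distrib_left)
    also have "\<dots> \<le> (\<Sum>g\<in>H i. ?m g v * (\<Prod>w\<in>B_set V g - dom (col(v \<mapsto> i)). ?m g w))"
      using mle[OF i] by (intro sum_mono mult_right_mono prod_nonneg) auto
    also have "\<dots> = (\<Sum>g\<in>H i. \<Prod>w\<in>B_set V g - dom col. ?m g w)"
      using step[OF i] by (intro sum.cong) auto
    finally show "1 / real (card Av) \<le> (\<Sum>g\<in>H i. \<Prod>w\<in>B_set V g - dom col. ?m g w)" by simp
  qed
  also have "\<dots> = (\<Sum>g\<in>G. \<Prod>w\<in>B_set V g - dom col. ?m g w)"
    unfolding G_def using finAv finH disj by (intro sum.UNION_disjoint[symmetric]) auto
  finally have "1 \<le> (\<Sum>g\<in>G. \<Prod>w\<in>B_set V g - dom col. ?m g w)" .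
  moreover have "G \<subseteq> histories V k L q" using H(1) by (auto simp: G_def)
  moreover have "proper V E g \<and> extends g col \<rho>" if gG: "g \<in> G" for g
  proof -
    obtain i where i: "i \<in> Av" "g \<in> H i" using gG by (auto simp: G_def)
    have "extends g col \<rho>" using H(2)[OF i] v by (auto simp: extends_def split: if_splits)
    thus ?thesis using H(2)[OF i] by blast
  qed
  ultimately show ?case by (intro exI[of _ G]) auto
qed

text \<open>The sum runs over a set that does not depend on \<open>E\<close>. Thus A's strategy,
  which may depend on the graph in any way, has disappeared and expectations can be taken term by
  term.\<close>

theorem A_wins_weight:
  assumes "A_wins V E k True Map.empty"
  shows "1 \<le> (\<Sum>g\<in>histories V k L q. of_bool (proper V E g) *
           (\<Prod>v\<in>B_set V g. pick_bound V E k q g v))"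
proof -
  have "compatible V E k q True Map.empty (\<lambda>_. 0)" by (simp add: compatible_def)
  from A_wins_imp_histories[OF assms this] obtain G where G: "G \<subseteq> histories V k L q"
     "\<forall>g\<in>G. proper V E g"
     "1 \<le> (\<Sum>g\<in>G. \<Prod>v\<in>B_set V g. pick_bound V E k q g v)" by auto
  note G(3)
  also have "(\<Sum>g\<in>G. \<Prod>v\<in>B_set V g. pick_bound V E k q g v) =
     (\<Sum>g\<in>G. of_bool (proper V E g) * (\<Prod>v\<in>B_set V g. pick_bound V E k q g v))"
    using G(2) by (intro sum.cong) auto
  also have "\<dots> \<le> (\<Sum>g\<in>histories V k L q. of_bool (proper V E g) *
           (\<Prod>v\<in>B_set V g. pick_bound V E k q g v))"
    using G(1) finV by (intro sum_mono2) (auto intro!: prod_nonneg)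
  finally show ?thesis .
qed

end

section \<open>The game chromatic number is attained\<close>

lemma A_wins_many_colours:
  assumes "finite V" "\<And>u v. {u, v} \<in> E \<Longrightarrow> u \<in> V" "card V < k" "dom col \<subseteq> V"
  shows "A_wins V E k t col"
  using assms(4)
proof (induction "card (V - dom col)" arbitrary: col t rule: less_induct)
  case less
  have free: "\<exists>c. legal_move V E k col v c" if v: "v \<in> V" "v \<notin> dom col" for col v
  proof -
    have "nbr_colours E col v \<subseteq> (\<lambda>u. the (col u)) ` V"
      using assms(2) by (force simp: nbr_colours_def)
    hence "card (nbr_colours E col v) \<le> card V"
      using assms(1) by (meson card_image_le card_mono finite_imageI le_trans)
    moreover have "finite (nbr_colours E col v)"
      using \<open>nbr_colours E col v \<subseteq> _\<close> assms(1) finite_subset by blast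
    ultimately have "\<not> {1..k} \<subseteq> nbr_colours E col v"
      using assms(3) card_mono[of "nbr_colours E col v" "{1..k}"] by auto
    thus ?thesis using v by (auto simp: legal_move_def)
  qed
  hence nb: "\<not> blocked V E k col" unfolding blocked_def legal_move_def by blast
  show ?case
  proof (cases "V \<subseteq> dom col")
    case True
    thus ?thesis by (rule A_wins.all_coloured)
  next
    case False
    have IH: "A_wins V E k t' (col(v \<mapsto> c))" if "legal_move V E k col v c" for v c t'
    proof (rule less.hyps)
      have "V - dom (col(v \<mapsto> c)) \<subset> V - dom col" using that by (auto simp: legal_move_def)
      thus "card (V - dom (col(v \<mapsto> c))) < card (V - dom col)" using assms(1) by (intro psubset_card_mono) auto
      show "dom (col(v \<mapsto> c)) \<subseteq> V" using that less.prems by (auto simp: legal_move_def)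
    qed
    show ?thesis
    proof (cases t)
      case True
      obtain v c where "legal_move V E k col v c" using free False by blast
      thus ?thesis using True A_wins.A_move[OF nb] IH by simp
    next
      case False': False
      show ?thesis using False' A_wins.B_move[OF nb False] IH by simp
    qed
  qed
qed

text \<open>\<open>LEAST\<close> is meaningful because \<open>n + 1\<close> colours always suffice
  for A.\<close>

lemma game_chromatic_props:
  assumes "E \<subseteq> all_pairs n"
  shows "game_chromatic {1..n} E > 0" "A_wins {1..n} E (game_chromatic {1..n} E) True Map.empty"
proof -
  have "n + 1 > 0 \<and> A_wins {1..n} E (n + 1) True Map.empty"
    using assms by (auto intro!: A_wins_many_colours simp: all_pairs_eq)
  from LeastI[where P = "\<lambda>k. k > 0 \<and> A_wins {1..n} E k True Map.empty", OF this]
  show "game_chromatic {1..n} E > 0" "A_wins {1..n} E (game_chromatic {1..n} E) True Map.empty"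
    unfolding game_chromatic_def by auto
qed

section \<open>The expected weight\<close>

lemma exp_minus_le_inverse: "0 < x \<Longrightarrow> exp (- x) \<le> 1 / (x::real)"
proof -
  assume x: "0 < x"
  have "x \<le> exp x" using exp_ge_add_one_self[of x] by linarith
  thus ?thesis using x by (simp add: exp_minus field_simps)
qed

text \<open>Jensen's inequality, from the tangent of \<open>exp (- x)\<close> at \<open>m\<close>.
  In the applications \<open>x i\<close> is proportional to the size of a colour class: the expected
  number of missing colours is smallest when all classes have the same size.\<close>

lemma sum_exp_minus_ge:
  fixes x :: "'a \<Rightarrow> real"
  assumes "finite I" "(\<Sum>i\<in>I. x i) \<le> real (card I) * m"
  shows "real (card I) * exp (- m) \<le> (\<Sum>i\<in>I. exp (- x i))"
proof -
  have "exp (- m) * (1 - (x i - m)) \<le> exp (- x i)" for i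
  proof -
    have "exp (- m) * (1 + (m - x i)) \<le> exp (- m) * exp (m - x i)"
      by (intro mult_left_mono exp_ge_add_one_self) auto
    also have "\<dots> = exp (- x i)" by (simp flip: exp_add)
    finally show ?thesis by (simp add: algebra_simps)
  qed
  hence "(\<Sum>i\<in>I. exp (- m) * (1 - (x i - m))) \<le> (\<Sum>i\<in>I. exp (- x i))" by (intro sum_mono)
  moreover have "(\<Sum>i\<in>I. exp (- m) * (1 - (x i - m))) =
      exp (- m) * (real (card I) + (real (card I) * m - (\<Sum>i\<in>I. x i)))"
    unfolding sum_distrib_left[symmetric] by (simp add: sum_subtractf sum.distrib)
  moreover have "exp (- m) * real (card I) \<le> exp (- m) * (real (card I) + (real (card I) * m - (\<Sum>i\<in>I. x i)))"
    using assms by (intro mult_left_mono) auto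
  ultimately have "exp (- m) * real (card I) \<le> (\<Sum>i\<in>I. exp (- x i))" by linarith
  thus ?thesis by (simp add: mult.commute)
qed

text \<open>The number of avoided sets is a sum of independent indicators whose mean is the sum on
  the right; this moment yields its lower tail.\<close>

lemma expect_half_power_avoided:
  assumes "finite I" "finite Q" "\<And>i. i \<in> I \<Longrightarrow> B i \<subseteq> Q" "disjoint_family_on B I" "0 \<le> p" "p \<le> 1"
  shows "expect Q p (\<lambda>E. (1/2) ^ card {i \<in> I. E \<inter> B i = {}}) \<le>
         exp (- (\<Sum>i\<in>I. (1 - p) ^ card (B i)) / 2)"
proof -
  have "(1/2) ^ card {i \<in> I. E \<inter> B i = {}} = (\<Prod>i\<in>I. if E \<inter> B i = {} then 1/2 else (1::real))" for E
    using assms(1) by (subst prod.inter_filter[symmetric]) auto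
  hence "expect Q p (\<lambda>E. (1/2) ^ card {i \<in> I. E \<inter> B i = {}}) =
        expect Q p (\<lambda>E. \<Prod>i\<in>I. (\<lambda>S. if S = {} then 1/2 else 1) (E \<inter> B i))" by simp
  also have "\<dots> = (\<Prod>i\<in>I. expect (B i) p (\<lambda>S. if S = {} then 1/2 else 1))"
    by (rule expect_prod[OF assms(1-4)])
  also have "\<dots> = (\<Prod>i\<in>I. 1 - (1 - p) ^ card (B i) / 2)"
    using assms(2,3) finite_subset by (intro prod.cong refl, subst expect_avoid) auto
  also have "\<dots> \<le> (\<Prod>i\<in>I. exp (- ((1 - p) ^ card (B i) / 2)))"
  proof (intro prod_mono conjI)
    fix i assume "i \<in> I"
    have "(1 - p) ^ card (B i) \<le> 1" using assms by (intro power_le_one) auto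
    thus "0 \<le> 1 - (1 - p) ^ card (B i) / 2" by simp
    show "1 - (1 - p) ^ card (B i) / 2 \<le> exp (- ((1 - p) ^ card (B i) / 2))"
      using exp_ge_add_one_self[of "- ((1 - p) ^ card (B i) / 2)"] by simp
  qed
  also have "\<dots> = exp (- (\<Sum>i\<in>I. (1 - p) ^ card (B i)) / 2)"
    using assms(1) by (simp add: sum_negf sum_divide_distrib flip: exp_sum)
  finally show ?thesis .
qed

text \<open>Let \<open>X\<close> be the number of avoided sets. Where \<open>X\<close> is at least
  \<open>\<mu> / 4\<close> the integrand is at most \<open>4 / \<mu>\<close>; the other part is
  bounded through the moment of \<open>(1/2) ^ X\<close> by \<open>exp (- \<mu> / 4)\<close>, which
  is again at most \<open>4 / \<mu>\<close>.\<close>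

lemma expect_inverse_avoided:
  assumes "finite I" "finite Q" "\<And>i. i \<in> I \<Longrightarrow> B i \<subseteq> Q" "disjoint_family_on B I" "0 \<le> p" "p \<le> 1"
    and mu: "0 < \<mu>" "\<mu> \<le> (\<Sum>i\<in>I. (1 - p) ^ card (B i))"
  shows "expect Q p (\<lambda>E. 1 / (1 + real (card {i \<in> I. E \<inter> B i = {}}))) \<le> 8 / \<mu>"
proof -
  let ?X = "\<lambda>E. card {i \<in> I. E \<inter> B i = {}}"
  have "expect Q p (\<lambda>E. 1 / (1 + real (?X E))) \<le> expect Q p (\<lambda>E. 4 / \<mu> + exp (\<mu> / 4) * (1/2) ^ ?X E)"
  proof (rule expect_mono[OF assms(5,6)])
    fix E
    show "1 / (1 + real (?X E)) \<le> 4 / \<mu> + exp (\<mu> / 4) * (1/2) ^ ?X E"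
    proof (cases "\<mu> / 4 \<le> real (?X E)")
      case True
      hence "\<mu> / 4 \<le> 1 + real (?X E)" by linarith
      hence "1 / (1 + real (?X E)) \<le> 1 / (\<mu> / 4)" using mu by (intro divide_left_mono) auto
      also have "\<dots> = 4 / \<mu>" by simp
      finally have "1 / (1 + real (?X E)) \<le> 4 / \<mu>" .
      moreover have "0 \<le> exp (\<mu> / 4) * (1/2) ^ ?X E" by simp
      ultimately show ?thesis by linarith
    next
      case False
      \<comment> \<open>If \<open>X < \<mu> / 4\<close>, then \<open>(1/2) ^ X\<close> is at least
        \<open>exp (- X)\<close> and so at least \<open>exp (- \<mu> / 4)\<close>; the second
        summand alone is then at least 1.\<close>
      have "exp (- 1) \<le> (1/2::real)" using exp_ge_add_one_self[of 1] by (simp add: exp_minus field_simps)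
      hence "exp (- 1) ^ ?X E \<le> (1/2::real) ^ ?X E" by (intro power_mono) auto
      moreover have "exp (- 1) ^ ?X E = exp (- real (?X E))" by (simp flip: exp_of_nat_mult)
      moreover have "exp (- (\<mu> / 4)) \<le> exp (- real (?X E))" using False by simp
      ultimately have "exp (- (\<mu> / 4)) \<le> (1/2) ^ ?X E" by linarith
      hence "exp (\<mu> / 4) * exp (- (\<mu> / 4)) \<le> exp (\<mu> / 4) * (1/2) ^ ?X E" by (intro mult_left_mono) auto
      hence "1 \<le> exp (\<mu> / 4) * (1/2) ^ ?X E" by (simp flip: exp_add)
      moreover have "1 / (1 + real (?X E)) \<le> 1" by simp
      moreover have "0 \<le> 4 / \<mu>" using mu by simp
      ultimately show ?thesis by linarith
    qed
  qed
  also have "\<dots> = 4 / \<mu> + exp (\<mu> / 4) * expect Q p (\<lambda>E. (1/2) ^ ?X E)"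
    using assms(2) by (simp add: expect_add expect_cmult)
  also have "expect Q p (\<lambda>E. (1/2) ^ ?X E) \<le> exp (- (\<mu> / 2))"
  proof -
    have "expect Q p (\<lambda>E. (1/2) ^ ?X E) \<le> exp (- (\<Sum>i\<in>I. (1 - p) ^ card (B i)) / 2)"
      by (rule expect_half_power_avoided) (use assms in auto)
    also have "\<dots> \<le> exp (- (\<mu> / 2))" using mu(2) by simp
    finally show ?thesis .
  qed
  also have "4 / \<mu> + exp (\<mu> / 4) * exp (- (\<mu> / 2)) = 4 / \<mu> + exp (- (\<mu> / 4))" by (simp flip: exp_add)
  also have "\<dots> \<le> 4 / \<mu> + 4 / \<mu>" using exp_minus_le_inverse[of "\<mu> / 4"] mu by simp
  finally show ?thesis by simp
qed

lemma bij_betw_rank: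
  assumes "finite (W :: nat set)"
  shows "bij_betw (\<lambda>v. card {w \<in> W. w < v}) W {..<card W}"
proof -
  have lt: "card {w \<in> W. w < u} < card {w \<in> W. w < v}" if "u \<in> W" "u < v" for u v
    using that assms by (intro psubset_card_mono) auto
  have inj: "inj_on (\<lambda>v. card {w \<in> W. w < v}) W"
  proof (rule inj_onI)
    fix u v assume uv: "u \<in> W" "v \<in> W" "card {w \<in> W. w < u} = card {w \<in> W. w < v}"
    thus "u = v" using lt[of u v] lt[of v u] by (cases u v rule: linorder_cases) auto
  qed
  moreover have "(\<lambda>v. card {w \<in> W. w < v}) ` W \<subseteq> {..<card W}"
    using assms by (auto intro!: psubset_card_mono)
  ultimately show ?thesis
    using assms unfolding bij_betw_def by (metis card_image card_lessThan card_subset_eq finite_lessThan)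
qed

text \<open>This is \<open>8 / \<mu>\<close> for the mean number \<open>\<mu>\<close> of missing
  colours when \<open>2 r + q\<close> vertices are spread evenly over \<open>k - 1\<close>
  colours.\<close>

abbreviation pick_factor :: "real \<Rightarrow> nat \<Rightarrow> nat \<Rightarrow> nat \<Rightarrow> real" where
  "pick_factor p k q r \<equiv> 8 / real (k - 1) * exp (- ln (1 - p) * real (2 * r + q) / real (k - 1))"

section \<open>Expected weight of a single labelling\<close>

context
  fixes n k q L :: nat and p :: real and g :: "nat \<Rightarrow> nat \<times> nat"
  assumes g: "g \<in> histories {1..n} k L q" and p: "0 \<le> p" "p < 1"
begin

definition vertex_pairs :: "nat \<Rightarrow> nat set set" where
  "vertex_pairs v = (\<lambda>u. {u, v}) ` {u \<in> earlier {1..n} q g v. fst (g u) \<noteq> fst (g v)}"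

definition colour_pairs :: "nat \<Rightarrow> nat \<Rightarrow> nat set set" where
  "colour_pairs v i = (\<lambda>u. {u, v}) ` {u \<in> earlier {1..n} q g v. fst (g u) = i}"

definition mono_pairs :: "nat set set" where
  "mono_pairs = {e \<in> all_pairs n. \<exists>u v. e = {u, v} \<and> fst (g u) = fst (g v)}"

lemma g_colour: "u \<in> {1..n} \<Longrightarrow> fst (g u) \<in> {1..k}"
  using g by (auto simp: histories_def PiE_def Pi_def mem_Times_iff)

lemma earlier_subset: "v \<in> B_set {1..n} g \<Longrightarrow> earlier {1..n} q g v \<subseteq> {1..n} - {v}"
  by (auto simp: earlier_def B_set_def)

lemma vertex_pairs_subset: "v \<in> B_set {1..n} g \<Longrightarrow> vertex_pairs v \<subseteq> all_pairs n"
  using earlier_subset[of v] by (auto simp: vertex_pairs_def all_pairs_eq B_set_def card_2_iff)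

lemma card_earlier:
  assumes v: "v \<in> B_set {1..n} g" and q: "q > 0"
  shows "card (earlier {1..n} q g v) \<le> 2 * B_rank {1..n} g v + q"
proof -
  let ?r = "B_rank {1..n} g v"
  have "card (earlier {1..n} q g v) \<le> card {u \<in> B_set {1..n} g. u < v} +
      card {u \<in> {1..n}. 1 \<le> snd (g u) \<and> snd (g u) \<le> ?r div q + 1}"
    unfolding earlier_def by (rule card_Un_le)
  also have "card {u \<in> B_set {1..n} g. u < v} = ?r" by (simp add: B_rank_def)
  also have "card {u \<in> {1..n}. 1 \<le> snd (g u) \<and> snd (g u) \<le> ?r div q + 1} \<le> (?r div q + 1) * q"
    using g unfolding histories_def by blast
  also have "(?r div q + 1) * q \<le> ?r + q" by (simp add: algebra_simps)
  finally show ?thesis by simp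
qed

text \<open>Each pair is charged to at most one factor: with equal colours to properness (index
  \<open>None\<close>), otherwise to a B-vertex at one end. If both ends are B-vertices, only the
  larger one has the other in \<open>earlier\<close>; this is what B's increasing order is
  for.\<close>

lemma disjoint_pairs:
  shows "disjoint_family_on (case_option mono_pairs vertex_pairs) (insert None (Some ` B_set {1..n} g))"
proof -
  let ?W = "B_set {1..n} g"
  have 1: "mono_pairs \<inter> vertex_pairs v = {}" if "v \<in> ?W" for v
    by (auto simp: mono_pairs_def vertex_pairs_def doubleton_eq_iff)
  have 2: "vertex_pairs v \<inter> vertex_pairs w = {}" if "v \<in> ?W" "w \<in> ?W" "v \<noteq> w" for v w
  proof -
    have "w < v" if "w \<in> earlier {1..n} q g v" "w \<in> ?W" for v w
      using that by (auto simp: earlier_def B_set_def)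
    thus ?thesis using that by (auto simp: vertex_pairs_def doubleton_eq_iff) (metis less_asym)
  qed
  show ?thesis
    unfolding disjoint_family_on_def using 1 2 by (auto split: option.splits simp: Int_commute)
qed

lemma missing_eq:
  "missing {1..n} E k q g v = {i \<in> {1..k} - {fst (g v)}. E \<inter> colour_pairs v i = {}}"
  by (auto simp: missing_def colour_pairs_def)

lemma missing_restrict:
  "missing {1..n} (E \<inter> vertex_pairs v) k q g v = missing {1..n} E k q g v"
  by (auto simp: missing_def vertex_pairs_def)

lemma expect_vertex:
  assumes v: "v \<in> B_set {1..n} g" and k: "k \<ge> 2" and q: "q > 0"
  shows "expect (vertex_pairs v) p (\<lambda>E. pick_bound {1..n} E k q g v) \<le>
     pick_factor p k q (B_rank {1..n} g v)"
proof -
  let ?I = "{1..k} - {fst (g v)}"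
  have gv: "fst (g v) \<in> {1..k}" using v g_colour by (auto simp: B_set_def)
  have cI: "card ?I = k - 1" using gv by simp
  have fe: "finite (earlier {1..n} q g v)" using earlier_subset[OF v] finite_subset by blast
  have fin: "finite (vertex_pairs v)" using vertex_pairs_subset[OF v] finite_subset by blast
  have cB: "card (colour_pairs v i) = card {u \<in> earlier {1..n} q g v. fst (g u) = i}" for i
    unfolding colour_pairs_def by (intro card_image) (auto simp: inj_on_def doubleton_eq_iff)
  have "(\<Sum>i\<in>?I. card (colour_pairs v i)) = card (\<Union>i\<in>?I. {u \<in> earlier {1..n} q g v. fst (g u) = i})"
    unfolding cB using fe by (intro card_UN_disjoint[symmetric]) auto
  also have "\<dots> \<le> card (earlier {1..n} q g v)" using fe by (intro card_mono) auto
  also have "\<dots> \<le> 2 * B_rank {1..n} g v + q" by (rule card_earlier[OF v q])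
  finally have sumle: "real (\<Sum>i\<in>?I. card (colour_pairs v i)) \<le> real (2 * B_rank {1..n} g v + q)" by linarith
  define \<mu> where "\<mu> = real (k - 1) * exp (- (- ln (1 - p) * real (2 * B_rank {1..n} g v + q) / real (k - 1)))"
  have lam: "0 \<le> - ln (1 - p)" using p by simp
  have "real (card ?I) * exp (- (- ln (1 - p) * real (2 * B_rank {1..n} g v + q) / real (k - 1))) \<le>
     (\<Sum>i\<in>?I. exp (- (- ln (1 - p) * real (card (colour_pairs v i)))))"
  proof (rule sum_exp_minus_ge)
    have "(\<Sum>i\<in>?I. - ln (1 - p) * real (card (colour_pairs v i))) =
        - ln (1 - p) * real (\<Sum>i\<in>?I. card (colour_pairs v i))" by (simp add: sum_distrib_left)
    also have "\<dots> \<le> - ln (1 - p) * real (2 * B_rank {1..n} g v + q)"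
      by (rule mult_left_mono[OF sumle lam])
    also have "\<dots> = real (card ?I) * (- ln (1 - p) * real (2 * B_rank {1..n} g v + q) / real (k - 1))"
      unfolding cI using k by simp
    finally show "(\<Sum>i\<in>?I. - ln (1 - p) * real (card (colour_pairs v i))) \<le>
       real (card ?I) * (- ln (1 - p) * real (2 * B_rank {1..n} g v + q) / real (k - 1))" .
  qed simp
  also have "(\<Sum>i\<in>?I. exp (- (- ln (1 - p) * real (card (colour_pairs v i))))) =
      (\<Sum>i\<in>?I. (1 - p) ^ card (colour_pairs v i))"
    using p by (intro sum.cong refl) (simp add: exp_of_nat2_mult)
  finally have mu: "\<mu> \<le> (\<Sum>i\<in>?I. (1 - p) ^ card (colour_pairs v i))" unfolding \<mu>_def cI .
  have "expect (vertex_pairs v) p (\<lambda>E. 1 / (1 + real (card {i \<in> ?I. E \<inter> colour_pairs v i = {}}))) \<le> 8 / \<mu>"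
  proof (rule expect_inverse_avoided)
    show "disjoint_family_on (colour_pairs v) ?I"
      by (auto simp: disjoint_family_on_def colour_pairs_def doubleton_eq_iff)
    show "0 < \<mu>" using k by (simp add: \<mu>_def)
  qed (use fin p mu in \<open>auto simp: colour_pairs_def vertex_pairs_def\<close>)
  also have "8 / \<mu> = pick_factor p k q (B_rank {1..n} g v)"
    unfolding \<mu>_def by (simp add: exp_minus field_simps)
  finally show ?thesis unfolding missing_eq .
qed

text \<open>Twice the number of monochromatic pairs is the sum of the squared class sizes minus
  \<open>n\<close>, and by Cauchy-Schwarz equal classes minimise it.\<close>

lemma card_mono_pairs: "(real n)\<^sup>2 / real k - real n \<le> 2 * real (card mono_pairs)" if k: "k > 0"
proof -
  define C where "C = (\<lambda>i. {u \<in> {1..n}. fst (g u) = i})"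
  have eq: "mono_pairs = (\<Union>i\<in>{1..k}. {e. e \<subseteq> C i \<and> card e = 2})"
  proof (intro set_eqI iffI)
    fix e assume "e \<in> mono_pairs"
    then obtain u v where e: "e \<subseteq> {1..n}" "card e = 2" "e = {u, v}" "fst (g u) = fst (g v)"
      by (auto simp: mono_pairs_def all_pairs_eq)
    thus "e \<in> (\<Union>i\<in>{1..k}. {e. e \<subseteq> C i \<and> card e = 2})"
      using g_colour[of u] by (auto simp: C_def intro!: bexI[of _ "fst (g u)"])
  next
    fix e assume "e \<in> (\<Union>i\<in>{1..k}. {e. e \<subseteq> C i \<and> card e = 2})"
    then obtain i where e: "e \<subseteq> C i" "card e = 2" by auto
    then obtain u v where uv: "e = {u, v}" by (auto simp: card_2_iff)
    have "e \<in> all_pairs n" using e by (auto simp: all_pairs_eq C_def)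
    moreover have "fst (g u) = fst (g v)" using e uv by (auto simp: C_def)
    ultimately show "e \<in> mono_pairs" using uv unfolding mono_pairs_def by blast
  qed
  have finC: "finite (C i)" for i by (simp add: C_def)
  have dis: "{e. e \<subseteq> C i \<and> card e = 2} \<inter> {e. e \<subseteq> C j \<and> card e = 2} = {}" if "i \<noteq> j" for i j
    using that by (auto simp: C_def card_2_iff)
  have "card mono_pairs = (\<Sum>i\<in>{1..k}. card {e. e \<subseteq> C i \<and> card e = 2})"
    unfolding eq using finC dis by (intro card_UN_disjoint) auto
  also have "\<dots> = (\<Sum>i\<in>{1..k}. card (C i) choose 2)"
    using n_subsets[OF finC] by simp
  finally have cm: "2 * real (card mono_pairs) = (\<Sum>i\<in>{1..k}. 2 * real (card (C i) choose 2))"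
    by (simp add: sum_distrib_left)
  have ch: "2 * real (m choose 2) = (real m)\<^sup>2 - real m" for m
  proof -
    have "2 * (m choose 2) = m * (m - 1)" 
    proof -
      have "even (m * (m - 1))" by (cases m) auto
      thus ?thesis unfolding choose_two by (rule dvd_mult_div_cancel)
    qed
    hence "2 * real (m choose 2) = real m * real (m - 1)" by (metis of_nat_mult of_nat_numeral)
    thus ?thesis by (cases m) (auto simp: power2_eq_square algebra_simps)
  qed
  have "{1..n} = (\<Union>i\<in>{1..k}. C i)" using g_colour by (auto simp: C_def)
  hence "n = card (\<Union>i\<in>{1..k}. C i)" by (metis card_atLeastAtMost diff_Suc_1)
  also have "\<dots> = (\<Sum>i\<in>{1..k}. card (C i))" using finC by (intro card_UN_disjoint) (auto simp: C_def)
  finally have sn: "real n = (\<Sum>i\<in>{1..k}. real (card (C i)))" by (metis of_nat_sum)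
  have "(real n)\<^sup>2 \<le> real k * (\<Sum>i\<in>{1..k}. (real (card (C i)))\<^sup>2)"
    unfolding sn using sum_squared_le_sum_of_squares[of "\<lambda>i. real (card (C i))" "{1..k}"] by (simp add: mult.commute)
  hence "(real n)\<^sup>2 / real k \<le> (\<Sum>i\<in>{1..k}. (real (card (C i)))\<^sup>2)" using k by (simp add: field_simps)
  thus ?thesis unfolding cm ch sum_subtractf sn[symmetric] by simp
qed

text \<open>\<open>pick_factor\<close> grows with the rank and eventually exceeds 1, so the factors
  from rank \<open>R\<close> on are replaced by 1. For \<open>R = 0\<close> only properness is
  exploited, and then \<open>k = 1\<close> is allowed.\<close>

lemma expect_history:
  assumes q: "q > 0" and k: "k > 0" and R: "R \<le> n div 2" "R = 0 \<or> k \<ge> 2"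
  shows "expect (all_pairs n) p (\<lambda>E. of_bool (proper {1..n} E g) *
           (\<Prod>v\<in>B_set {1..n} g. pick_bound {1..n} E k q g v)) \<le>
    exp (ln (1 - p) * ((real n)\<^sup>2 / real k - real n) / 2) *
    (\<Prod>r<R. pick_factor p k q r)"
proof -
  let ?W = "B_set {1..n} g"
  let ?B = "case_option mono_pairs vertex_pairs"
  define F where "F = case_option (\<lambda>S :: nat set set. 0 ^ card S :: real)
     (\<lambda>v S. pick_bound {1..n} S k q g v)"
  define h where "h = (\<lambda>r. if r < R then pick_factor p k q r else 1)"
  have finW: "finite ?W" by (simp add: B_set_def)
  have finM: "finite mono_pairs" by (simp add: mono_pairs_def)
  have "expect (all_pairs n) p (\<lambda>E. of_bool (proper {1..n} E g) *
           (\<Prod>v\<in>?W. pick_bound {1..n} E k q g v)) \<le>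
     expect (all_pairs n) p (\<lambda>E. \<Prod>i\<in>insert None (Some ` ?W). F i (E \<inter> ?B i))"
  proof (rule expect_mono)
    fix E assume E: "E \<subseteq> all_pairs n"
    have "of_bool (proper {1..n} E g) \<le> (0::real) ^ card (E \<inter> mono_pairs)"
    proof (cases "proper {1..n} E g")
      case True
      have "E \<inter> mono_pairs = {}"
        using True unfolding proper_def mono_pairs_def all_pairs_eq by fastforce
      thus ?thesis by simp
    qed auto
    hence "of_bool (proper {1..n} E g) *
           (\<Prod>v\<in>?W. pick_bound {1..n} E k q g v) \<le>
        0 ^ card (E \<inter> mono_pairs) * (\<Prod>v\<in>?W. pick_bound {1..n} E k q g v)"
      by (rule mult_right_mono) (auto intro!: prod_nonneg)
    moreover have "(\<Prod>i\<in>insert None (Some ` ?W). F i (E \<inter> ?B i)) =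
       0 ^ card (E \<inter> mono_pairs) * (\<Prod>v\<in>?W. pick_bound {1..n} E k q g v)"
      using finW by (simp add: F_def prod.reindex missing_restrict del: One_nat_def)
    ultimately show "of_bool (proper {1..n} E g) *
           (\<Prod>v\<in>?W. pick_bound {1..n} E k q g v) \<le>
       (\<Prod>i\<in>insert None (Some ` ?W). F i (E \<inter> ?B i))"
      by (simp only:)
  qed (use p in auto)
  also have "\<dots> = (\<Prod>i\<in>insert None (Some ` ?W). expect (?B i) p (F i))"
    using finW vertex_pairs_subset
    by (intro expect_prod disjoint_pairs) (auto simp: mono_pairs_def split: option.splits)
  also have "\<dots> = expect mono_pairs p (\<lambda>S. 0 ^ card S) *
      (\<Prod>v\<in>?W. expect (vertex_pairs v) p (\<lambda>E. pick_bound {1..n} E k q g v))"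
    using finW by (simp add: F_def prod.reindex)
  also have "expect mono_pairs p (\<lambda>S. 0 ^ card S) = (1 - p) ^ card mono_pairs"
    using finM by (simp add: expect_power_card)
  also have "\<dots> = exp (ln (1 - p) * (2 * real (card mono_pairs)) / 2)"
    using p by (simp add: exp_of_nat2_mult)
  also have "\<dots> * (\<Prod>v\<in>?W. expect (vertex_pairs v) p (\<lambda>E. pick_bound {1..n} E k q g v)) \<le>
     exp (ln (1 - p) * ((real n)\<^sup>2 / real k - real n) / 2) * (\<Prod>v\<in>?W. h (B_rank {1..n} g v))"
  proof (intro mult_mono prod_mono conjI)
    show "exp (ln (1 - p) * (2 * real (card mono_pairs)) / 2) \<le> exp (ln (1 - p) * ((real n)\<^sup>2 / real k - real n) / 2)"
    proof -
      have "ln (1 - p) * (2 * real (card mono_pairs)) \<le> ln (1 - p) * ((real n)\<^sup>2 / real k - real n)"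
        using card_mono_pairs[OF k] p by (intro mult_left_mono_neg) auto
      thus ?thesis unfolding exp_le_cancel_iff by (rule divide_right_mono) simp
    qed
    fix v assume v: "v \<in> ?W"
    have fin: "finite (vertex_pairs v)" using vertex_pairs_subset[OF v] finite_subset by blast
    show "0 \<le> expect (vertex_pairs v) p (\<lambda>E. pick_bound {1..n} E k q g v)"
      using p by (intro expect_nonneg) auto
    have "expect (vertex_pairs v) p (\<lambda>E. pick_bound {1..n} E k q g v) \<le>
        expect (vertex_pairs v) p (\<lambda>E. 1)"
      using p by (intro expect_mono) auto
    hence "expect (vertex_pairs v) p (\<lambda>E. pick_bound {1..n} E k q g v) \<le> 1"
      using fin by simp
    thus "expect (vertex_pairs v) p (\<lambda>E. pick_bound {1..n} E k q g v) \<le>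
        h (B_rank {1..n} g v)"
    proof (cases "B_rank {1..n} g v < R")
      case True
      hence "k \<ge> 2" using R(2) by auto
      from expect_vertex[OF v this q] True show ?thesis by (simp only: h_def if_True)
    qed (simp add: h_def)
  qed (use p in \<open>auto intro!: prod_nonneg expect_nonneg\<close>)
  also have "(\<Prod>v\<in>?W. h (B_rank {1..n} g v)) = (\<Prod>r<card ?W. h r)"
    unfolding B_rank_def by (rule prod.reindex_bij_betw[OF bij_betw_rank[OF finW]])
  also have "card ?W = n div 2" using g by (simp add: histories_def)
  also have "(\<Prod>r<n div 2. h r) = (\<Prod>r<R. h r)"
    using R(1) by (intro prod.mono_neutral_right) (auto simp: h_def)
  also have "\<dots> = (\<Prod>r<R. pick_factor p k q r)"
    by (simp add: h_def)
  finally show ?thesis .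
qed

end

theorem A_wins_prob_le:
  assumes p: "0 \<le> p" "p < 1" and q: "q > 0" and k: "k > 0" and R: "R \<le> n div 2" "R = 0 \<or> k \<ge> 2"
    and L: "n + 1 \<le> 2 * (L * q)"
  shows "Gnp_prob n p (\<lambda>E. A_wins {1..n} E k True Map.empty) \<le>
    real (k * (L + 1)) ^ n * exp (ln (1 - p) * ((real n)\<^sup>2 / real k - real n) / 2) *
    ((8 / real (k - 1)) ^ R * exp (- ln (1 - p) * (real R * (real R + real q)) / real (k - 1)))"
proof -
  let ?H = "histories {1..n} k L q"
  define Y where "Y = exp (ln (1 - p) * ((real n)\<^sup>2 / real k - real n) / 2) *
    ((8 / real (k - 1)) ^ R * exp (- ln (1 - p) * (real R * (real R + real q)) / real (k - 1)))"
  have "Gnp_prob n p (\<lambda>E. A_wins {1..n} E k True Map.empty) \<le>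
     expect (all_pairs n) p (\<lambda>E. \<Sum>g\<in>?H. of_bool (proper {1..n} E g) *
           (\<Prod>v\<in>B_set {1..n} g. pick_bound {1..n} E k q g v))"
  proof (rule Gnp_prob_markov)
    fix E assume E: "E \<subseteq> all_pairs n" "A_wins {1..n} E k True Map.empty"
    have "{v} \<notin> E" for v using E(1) by (auto simp: all_pairs_eq)
    thus "1 \<le> (\<Sum>g\<in>?H. of_bool (proper {1..n} E g) *
           (\<Prod>v\<in>B_set {1..n} g. pick_bound {1..n} E k q g v))"
      using L q E(2) by (intro A_wins_weight) auto
  qed (use p in \<open>auto intro!: sum_nonneg prod_nonneg\<close>)
  also have "\<dots> \<le> (\<Sum>g\<in>?H. Y)"
    unfolding expect_sum
  proof (rule sum_mono)
    fix g assume g: "g \<in> ?H"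
    have "(\<Prod>r<R. pick_factor p k q r) =
      (8 / real (k - 1)) ^ R * exp (\<Sum>r<R. - ln (1 - p) * real (2 * r + q) / real (k - 1))"
      by (simp only: prod.distrib prod_constant card_lessThan exp_sum[OF finite_lessThan])
    also have "(\<Sum>r<R. - ln (1 - p) * real (2 * r + q) / real (k - 1)) =
       - ln (1 - p) * (\<Sum>r<R. real (2 * r + q)) / real (k - 1)"
      by (simp add: sum_distrib_left sum_divide_distrib)
    also have "exp \<dots> \<le> exp (- ln (1 - p) * (real R * (real R + real q)) / real (k - 1))"
    proof -
      have "(\<Sum>r<m. real (2 * r + q)) \<le> real m * (real m + real q)" for m
        by (induction m) (auto simp: algebra_simps)
      thus ?thesis using p by (intro iffD2[OF exp_le_cancel_iff] divide_right_mono mult_left_mono) auto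
    qed
    finally have "(\<Prod>r<R. pick_factor p k q r) \<le>
      (8 / real (k - 1)) ^ R * exp (- ln (1 - p) * (real R * (real R + real q)) / real (k - 1))"
      by (simp add: mult_left_mono)
    hence "exp (ln (1 - p) * ((real n)\<^sup>2 / real k - real n) / 2) *
      (\<Prod>r<R. pick_factor p k q r) \<le> Y"
      unfolding Y_def by (intro mult_left_mono) auto
    with expect_history[OF g p q k R]
    show "expect (all_pairs n) p (\<lambda>E. of_bool (proper {1..n} E g) *
           (\<Prod>v\<in>B_set {1..n} g. pick_bound {1..n} E k q g v)) \<le> Y" by linarith
  qed
  also have "\<dots> = real (card ?H) * Y" by simp
  also have "\<dots> \<le> real (k * (L + 1)) ^ n * Y"
  proof (rule mult_right_mono)
    have "card ?H \<le> card ({1..n} \<rightarrow>\<^sub>E {1..k} \<times> {0..L})"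
      by (intro card_mono finite_PiE) (auto simp: histories_def)
    also have "\<dots> = (k * (L + 1)) ^ n" by (simp add: card_PiE card_cartesian_product)
    finally show "real (card ?H) \<le> real (k * (L + 1)) ^ n" by (metis of_nat_le_iff of_nat_power)
    show "0 \<le> Y" by (simp add: Y_def)
  qed
  finally show ?thesis unfolding Y_def by (simp add: mult.assoc)
qed

section \<open>The lower bound: numerical estimates\<close>

text \<open>Up to \<open>(2/5) d / ln d\<close> colours the expected number of proper labelled
  colourings is already negligible, which also disposes of small \<open>k\<close>. Above that the
  moves of B are needed, and \<open>k\<close> is large enough to replace \<open>k - 1\<close> by
  \<open>k\<close>.\<close>

lemma A_wins_prob_le_exp:
  fixes d :: real
  assumes n: "n \<ge> 1000" and d: "ln d \<ge> 10000" "d / ln d \<ge> 2600" "d / real n \<le> 1/2000" "d \<ge> 1"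
    and k: "k > 0" "real k < (4/7) * d / ln d"
  shows "Gnp_prob n (d / real n) (\<lambda>E. A_wins {1..n} E k True Map.empty) \<le> exp (- real n)"
proof -
  define p where "p = d / real n"
  define lam where "lam = - ln (1 - p)"
  \<comment> \<open>A hundred blocks cost a factor \<open>101 ^ n\<close>, of lower order than
    \<open>k ^ n\<close>, while the overhang \<open>q\<close> of a block stays below one percent of
    \<open>n\<close>.\<close>
  define q where "q = n div 100"
  have p: "0 \<le> p" "p < 1" "p \<le> 1/2000" using d n by (auto simp: p_def)
  have pn: "p * real n = d" using n by (simp add: p_def)
  have lp: "p \<le> lam" using ln_add_one_self_le_self2[of "-p"] p by (simp add: lam_def)
  have lp2: "lam \<le> (1001/1000) * p"
  proof -
    have "lam \<le> p + 2 * p\<^sup>2" using ln_one_minus_pos_lower_bound[of p] p by (simp add: lam_def)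
    also have "2 * p\<^sup>2 \<le> 2 * (p * (1/2000))" unfolding power2_eq_square using p by (intro mult_left_mono) auto
    finally show ?thesis by simp
  qed
  have lnd: "ln d > 0" using d by linarith
  have kd: "real k \<le> d"
  proof -
    have "(4/7) * d / ln d \<le> d / 1" using d lnd by (intro frac_le) auto
    thus ?thesis using k by simp
  qed
  have lnk: "ln (real k) \<le> ln d" using kd k by simp
  have "d \<le> real n * (1/2000)" using d(3) n by (simp add: field_simps)
  hence dn: "d \<le> real n" by linarith
  have kn: "real k \<le> real n" using kd dn by linarith
  have q: "q > 0" "n + 1 \<le> 2 * (100 * q)" "real q \<le> real n / 100" using n by (auto simp: q_def)
  have base: "lam * ((real n)\<^sup>2 / real k - real n) / 2 \<ge> real n * (d / real k / 2) - real n / 2"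
  proof -
    have nn: "0 \<le> (real n)\<^sup>2 / real k - real n"
      using kn k by (simp add: power2_eq_square field_simps mult_right_mono)
    have "p * ((real n)\<^sup>2 / real k - real n) \<le> lam * ((real n)\<^sup>2 / real k - real n)"
      by (rule mult_right_mono[OF lp nn])
    moreover have "p * ((real n)\<^sup>2 / real k - real n) = real n * (d / real k) - d"
      using n by (simp add: p_def power2_eq_square field_simps)
    ultimately have "real n * (d / real k) - d \<le> lam * ((real n)\<^sup>2 / real k - real n)" by linarith
    hence "(real n * (d / real k) - real n) / 2 \<le> lam * ((real n)\<^sup>2 / real k - real n) / 2"
      using dn by (intro divide_right_mono) auto
    thus ?thesis by (simp add: diff_divide_distrib)
  qed
  have dk: "d / real k \<ge> (7/4) * ln d" using k lnd d by (simp add: field_simps)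
  have ln101: "ln (101::real) \<le> 100" using ln_le_minus_one[of 101] by simp
  have W: "Gnp_prob n p (\<lambda>E. A_wins {1..n} E k True Map.empty) \<le> exp (real n * ln (101 * real k) -
      lam * ((real n)\<^sup>2 / real k - real n) / 2 + real R * ln (8 / real (k - 1)) + lam * (real R * (real R + real q)) / real (k - 1))"
    if R: "R \<le> n div 2" "R = 0 \<or> k \<ge> 2" for R
  proof -
    have "Gnp_prob n p (\<lambda>E. A_wins {1..n} E k True Map.empty) \<le>
      real (k * (100 + 1)) ^ n * exp (ln (1 - p) * ((real n)\<^sup>2 / real k - real n) / 2) *
      ((8 / real (k - 1)) ^ R * exp (- ln (1 - p) * (real R * (real R + real q)) / real (k - 1)))"
      by (rule A_wins_prob_le[OF p(1,2) q(1) k(1) R q(2)])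
    also have "real (k * (100 + 1)) ^ n = exp (real n * ln (101 * real k))"
      using k by (simp add: exp_of_nat_mult mult.commute)
    also have "(8 / real (k - 1)) ^ R = exp (real R * ln (8 / real (k - 1)))"
    proof (cases "R = 0")
      case False
      hence "8 / real (k - 1) > 0" using R by simp
      thus ?thesis by (simp only: exp_of_nat_mult exp_ln)
    qed simp
    also have "exp (real n * ln (101 * real k)) * exp (ln (1 - p) * ((real n)\<^sup>2 / real k - real n) / 2) *
      (exp (real R * ln (8 / real (k - 1))) * exp (- ln (1 - p) * (real R * (real R + real q)) / real (k - 1))) =
      exp (real n * ln (101 * real k) -
      lam * ((real n)\<^sup>2 / real k - real n) / 2 + real R * ln (8 / real (k - 1)) + lam * (real R * (real R + real q)) / real (k - 1))"
    proof -
      have "exp a * exp b * (exp c * exp e) = exp (a + b + c + e)" for a b c e :: real by (simp add: exp_add)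
      moreover have "x + (- lam) * X / 2 = x - lam * X / 2" for x X by simp
      moreover have "ln (1 - p) = - lam" by (simp add: lam_def)
      ultimately show ?thesis by (simp only: minus_minus)
    qed
    finally show ?thesis .
  qed
  have ln101k: "ln (101 * real k) = ln 101 + ln (real k)" using k by (simp add: ln_mult)
  show ?thesis
  proof (cases "real k \<le> (2/5) * d / ln d")
    case True
    have "d / real k \<ge> (5/2) * ln d" using True k lnd by (simp add: field_simps)
    hence "ln (101 * real k) - d / real k / 2 + 1/2 \<le> -1"
      unfolding ln101k using ln101 lnk d(1) by argo
    hence "real n * (ln (101 * real k) - d / real k / 2 + 1/2) \<le> real n * (-1)" by (intro mult_left_mono) auto
    hence "real n * ln (101 * real k) - lam * ((real n)\<^sup>2 / real k - real n) / 2 \<le> - real n"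
      using base by (simp add: algebra_simps)
    hence "exp (real n * ln (101 * real k) - lam * ((real n)\<^sup>2 / real k - real n) / 2) \<le> exp (- real n)" by simp
    moreover have "Gnp_prob n p (\<lambda>E. A_wins {1..n} E k True Map.empty) \<le>
        exp (real n * ln (101 * real k) - lam * ((real n)\<^sup>2 / real k - real n) / 2)"
      using W[of 0] by simp
    ultimately show ?thesis unfolding p_def[symmetric] by linarith
  next
    case False
    have k1001: "real k \<ge> 1002"
    proof -
      have "(2/5) * (d / ln d) \<ge> (2/5) * 2600" using d(2) by (intro mult_left_mono) auto
      thus ?thesis using False by simp
    qed
    hence k2: "k \<ge> 2" by linarith
    \<comment> \<open>For \<open>(4/7) d / ln d\<close> colours \<open>pick_factor\<close> becomes
      about 1 near rank \<open>2 n / 7\<close>.\<close>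
    define R where "R = (2 * n) div 7"
    have R2: "R \<le> n div 2" by (simp add: R_def)
    have Rle: "real R \<le> (2/7) * real n"
    proof -
      have "7 * R \<le> 2 * n" by (simp add: R_def)
      hence "7 * real R \<le> 2 * real n" by linarith
      thus ?thesis by simp
    qed
    have Rge: "real R \<ge> (2/7) * real n - 1"
    proof -
      have "2 * n \<le> 7 * R + 6" unfolding R_def by presburger
      hence "2 * real n \<le> 7 * real R + 6" by linarith
      thus ?thesis by simp
    qed
    have km: "real (k - 1) = real k - 1" using k by simp
    have lnkm: "ln (real k) - ln 2 \<le> ln (real k - 1)"
    proof -
      have "ln (real k / 2) \<le> ln (real k - 1)" using k1001 by simp
      thus ?thesis using k by (simp add: ln_div)
    qed
    have ln8: "ln (8::real) \<le> 7" using ln_le_minus_one[of 8] by simp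
    have ln2: "ln (2::real) \<le> 1" using ln_le_minus_one[of 2] by simp
    have ln8': "ln 8 \<le> ln (real k - 1)" using k1001 by simp
    have A: "real R * ln (8 / real (k - 1)) \<le> real n * ((2/7) * (8 - ln (real k)) + 1)"
    proof -
      have l8: "ln (8 / real (k - 1)) = ln 8 - ln (real k - 1)" unfolding km using k1001 by (simp add: ln_div)
      have "real R * ln (8 / real (k - 1)) = - (real R * (ln (real k - 1) - ln 8))"
        unfolding l8 by (simp add: right_diff_distrib)
      also have "\<dots> \<le> - (((2/7) * real n - 1) * (ln (real k - 1) - ln 8))"
        using Rge ln8' by (intro le_imp_neg_le mult_right_mono) auto
      also have "\<dots> = (2/7) * real n * (ln 8 - ln (real k - 1)) + (ln (real k - 1) - ln 8)"
        by (simp add: algebra_simps)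
      also have "ln (real k - 1) - ln 8 \<le> real n * 1"
      proof -
        have "ln (real k - 1) \<le> real k" using ln_le_minus_one[of "real k - 1"] k1001 by linarith
        moreover have "0 \<le> ln (8::real)" by simp
        ultimately show ?thesis using kn by linarith
      qed
      also have "(2/7) * real n * (ln 8 - ln (real k - 1)) \<le> (2/7) * real n * (8 - ln (real k))"
        using lnkm ln8 ln2 by (intro mult_left_mono) auto
      finally show ?thesis by (simp only: distrib_left mult_1_right mult_ac)
    qed
    have B: "lam * (real R * (real R + real q)) / real (k - 1) \<le> real n * ((847/10000) * (d / real k))"
    proof -
      have RR: "real R * (real R + real q) \<le> ((2/7) * real n) * ((2/7) * real n + real n / 100)"
        using Rle q(3) by (intro mult_mono add_mono) auto
      have "lam * (real R * (real R + real q)) \<le> ((1001/1000) * p) * (((2/7) * real n) * ((2/7) * real n + real n / 100))"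
        by (rule mult_mono[OF lp2 RR]) (use p in auto)
      also have "\<dots> = (1001/1000) * (p * real n) * ((2/7) * ((2/7) + 1/100)) * real n" by (simp add: algebra_simps)
      also have "\<dots> = (1001/1000) * d * ((2/7) * ((2/7) + 1/100)) * real n" by (simp only: pn)
      finally have "lam * (real R * (real R + real q)) / real (k - 1) \<le>
          ((1001/1000) * d * ((2/7) * ((2/7) + 1/100)) * real n) / real (k - 1)"
        using k2 by (intro divide_right_mono) auto
      also have "\<dots> \<le> ((1001/1000) * d * ((2/7) * ((2/7) + 1/100)) * real n) / (real k / (1001/1000))"
        unfolding km using k1001 d by (intro divide_left_mono) auto
      also have "\<dots> = real n * (((1001/1000) * (1001/1000) * ((2/7) * ((2/7) + 1/100))) * (d / real k))"
      proof -
        have "a * x * e * N / (y / a) = N * ((a * a * e) * (x / y))" for a x e N y :: real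
          by (simp add: field_simps)
        thus ?thesis .
      qed
      \<comment> \<open>The constant being rounded up is about \<open>0.08466\<close>.\<close>
      also have "\<dots> \<le> real n * ((847/10000) * (d / real k))"
        using d by (intro mult_left_mono mult_right_mono) auto
      finally show ?thesis .
    qed
    have "ln (101 * real k) - d / real k / 2 + 1/2 + ((2/7) * (8 - ln (real k)) + 1) + (847/10000) * (d / real k) \<le> -1"
    proof -
      \<comment> \<open>The margin \<open>(4153/10000) (7/4) - 5/7\<close> is only about
        \<open>0.0125\<close>; this is why \<open>ln d\<close> is taken as large as 10000, enough to
        absorb the crude bound 100 for \<open>ln 101\<close>.\<close>
      have "(4153/10000) * (d / real k) \<ge> (4153/10000) * ((7/4) * ln d)" using dk by (intro mult_left_mono) auto
      thus ?thesis unfolding ln101k using ln101 lnk d(1) by argo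
    qed
    hence "real n * (ln (101 * real k) - d / real k / 2 + 1/2 + ((2/7) * (8 - ln (real k)) + 1) + (847/10000) * (d / real k))
        \<le> real n * (-1)" by (intro mult_left_mono) auto
    hence "real n * ln (101 * real k) - lam * ((real n)\<^sup>2 / real k - real n) / 2 + real R * ln (8 / real (k - 1)) +
       lam * (real R * (real R + real q)) / real (k - 1) \<le> - real n"
      using base A B by (simp only: distrib_left right_diff_distrib) argo
    hence "exp (real n * ln (101 * real k) - lam * ((real n)\<^sup>2 / real k - real n) / 2 + real R * ln (8 / real (k - 1)) +
       lam * (real R * (real R + real q)) / real (k - 1)) \<le> exp (- real n)" by simp
    thus ?thesis using W[OF R2] k2 unfolding p_def[symmetric] by linarith
  qed
qed

lemma chromatic_lower:
  "\<exists>d0::real. d0 \<ge> 3 \<and> (\<forall>d::nat \<Rightarrow> real. (\<forall>\<^sub>F n in sequentially. d0 \<le> d n \<and> d n \<le> real n powr (1/4)) \<longrightarrow>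
      (\<lambda>n. Gnp_prob n (d n / real n)
         (\<lambda>E. real (game_chromatic {1..n} E) \<ge> (4/7) * d n / ln (d n))) \<longlonglongrightarrow> 1)"
proof -
  let ?large = "\<lambda>d::real. d \<ge> 3 \<and> ln d \<ge> 10000 \<and> d / ln d \<ge> 2600"
  have "\<forall>\<^sub>F d in at_top. ?large d" by (intro eventually_conj) real_asymp+
  then obtain d0 where d0: "\<And>d. d \<ge> d0 \<Longrightarrow> ?large d"
    unfolding eventually_at_top_linorder by blast
  show ?thesis
  proof (intro exI[of _ d0] conjI allI impI)
    show "d0 \<ge> 3" using d0[of d0] by auto
    fix d :: "nat \<Rightarrow> real"
    assume dn: "\<forall>\<^sub>F n in sequentially. d0 \<le> d n \<and> d n \<le> real n powr (1/4)"
    have big: "\<forall>\<^sub>F n in sequentially. n \<ge> 1000 \<and> real n powr (1/4) / real n \<le> 1/2000"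
      by (intro eventually_conj eventually_ge_at_top) real_asymp
    have ev: "\<forall>\<^sub>F n in sequentially. n \<ge> 1000 \<and> d n \<ge> 3 \<and> ln (d n) \<ge> 10000 \<and> d n / ln (d n) \<ge> 2600 \<and>
        d n / real n \<le> 1/2000"
      using dn big
    proof eventually_elim
      case (elim n)
      have "d n / real n \<le> real n powr (1/4) / real n" using elim by (intro divide_right_mono) auto
      thus ?case using elim d0[of "d n"] by auto
    qed
    \<comment> \<open>The argument uses no monotonicity of the game in the number of colours, so a
      win of A is excluded for every smaller \<open>k\<close> separately; there are at most
      \<open>n\<close> of them.\<close>
    define K where "K = (\<lambda>n. {k. 0 < k \<and> real k < (4/7) * d n / ln (d n)})"
    show "(\<lambda>n. Gnp_prob n (d n / real n)
         (\<lambda>E. real (game_chromatic {1..n} E) \<ge> (4/7) * d n / ln (d n))) \<longlonglongrightarrow> 1"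
    proof (rule Gnp_prob_tendsto_1[where Bad = "\<lambda>n E. \<exists>k\<in>K n. A_wins {1..n} E k True Map.empty"
          and eps = "\<lambda>n. real n * exp (- real n)"])
      show "\<forall>\<^sub>F n in sequentially. 0 \<le> d n / real n \<and> d n / real n \<le> 1"
        using ev by eventually_elim auto
      show "\<forall>\<^sub>F n in sequentially. \<forall>E. E \<subseteq> all_pairs n \<longrightarrow>
          \<not> (4/7) * d n / ln (d n) \<le> real (game_chromatic {1..n} E) \<longrightarrow> (\<exists>k\<in>K n. A_wins {1..n} E k True Map.empty)"
      proof (intro always_eventually allI impI)
        fix n E
        assume E: "E \<subseteq> all_pairs n" "\<not> (4/7) * d n / ln (d n) \<le> real (game_chromatic {1..n} E)"
        have "game_chromatic {1..n} E \<in> K n" using game_chromatic_props(1)[OF E(1)] E(2) unfolding K_def by simp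
        thus "\<exists>k\<in>K n. A_wins {1..n} E k True Map.empty" using game_chromatic_props(2)[OF E(1)] by blast
      qed
      show "(\<lambda>n. real n * exp (- real n)) \<longlonglongrightarrow> 0" by real_asymp
      show "\<forall>\<^sub>F n in sequentially. Gnp_prob n (d n / real n) (\<lambda>E. \<exists>k\<in>K n. A_wins {1..n} E k True Map.empty) \<le>
          real n * exp (- real n)"
        using ev
      proof eventually_elim
        case (elim n)
        have "(4/7) * d n / ln (d n) \<le> d n / 1" using elim by (intro frac_le) auto
        moreover have "d n \<le> real n"
        proof -
          have "d n / real n \<le> 1" using elim by linarith
          thus ?thesis using elim by (simp add: divide_le_eq split: if_splits)
        qed
        ultimately have sub: "K n \<subseteq> {1..n}" by (auto simp: K_def)
        have fin: "finite (K n)" by (rule finite_subset[OF sub]) auto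
        have "Gnp_prob n (d n / real n) (\<lambda>E. \<exists>k\<in>K n. A_wins {1..n} E k True Map.empty) \<le>
            (\<Sum>k\<in>K n. Gnp_prob n (d n / real n) (\<lambda>E. A_wins {1..n} E k True Map.empty))"
          using elim fin by (intro Gnp_prob_Bex_le) auto
        also have "\<dots> \<le> (\<Sum>k\<in>K n. exp (- real n))"
          using elim by (intro sum_mono A_wins_prob_le_exp) (auto simp: K_def)
        also have "\<dots> = real (card (K n)) * exp (- real n)" by simp
        also have "\<dots> \<le> real n * exp (- real n)"
          using card_mono[OF _ sub] by (intro mult_right_mono) auto
        finally show ?case .
      qed
    qed
  qed
qed

section \<open>The upper bound: a strategy on locally sparse graphs\<close>

definition nbrs :: "nat set set \<Rightarrow> nat \<Rightarrow> nat set" where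
  "nbrs E v = {u. {u, v} \<in> E}"

definition avail :: "nat set set \<Rightarrow> nat \<Rightarrow> (nat \<rightharpoonup> nat) \<Rightarrow> nat \<Rightarrow> nat set" where
  "avail E k col v = {1..k} - nbr_colours E col v"

text \<open>If \<open>v\<close> is listed after the other vertices of \<open>Z\<close>, these are
  the neighbours of \<open>v\<close> that point to another vertex of \<open>Z\<close>.\<close>

definition shared_nbrs :: "nat set set \<Rightarrow> nat set \<Rightarrow> nat \<Rightarrow> nat set" where
  "shared_nbrs E Z v = {w \<in> nbrs E v. \<exists>z\<in>Z. z \<noteq> v \<and> w \<in> nbrs E z}"

definition up :: "nat set set \<Rightarrow> nat list \<Rightarrow> nat \<Rightarrow> nat option" where
  "up E xs w = find (\<lambda>x. {x, w} \<in> E) xs"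

lemma finite_avail [simp, intro]: "finite (avail E k col v)"
  by (simp add: avail_def)

lemma legal_move_iff_avail: "legal_move V E k col v c \<longleftrightarrow> v \<in> V \<and> v \<notin> dom col \<and> c \<in> avail E k col v"
  by (auto simp: legal_move_def avail_def)

lemma blocked_iff_avail: "blocked V E k col \<longleftrightarrow> (\<exists>v\<in>V. v \<notin> dom col \<and> avail E k col v = {})"
  by (auto simp: blocked_def avail_def)

lemma up_Some: "up E xs w = Some x \<Longrightarrow> x \<in> set xs \<and> {x, w} \<in> E"
  unfolding up_def find_Some_iff by auto

lemma up_append: "up E (xs @ ys) w = (case up E xs w of None \<Rightarrow> up E ys w | Some x \<Rightarrow> Some x)"
  by (induction xs) (auto simp: up_def)

lemma up_eq_None_iff: "up E xs w = None \<longleftrightarrow> (\<forall>x\<in>set xs. {x, w} \<notin> E)"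
  by (auto simp: up_def find_None_iff)

lemma nbr_colours_upd:
  assumes "u \<notin> dom col"
  shows "nbr_colours E (col(u \<mapsto> c)) v =
    (if {u, v} \<in> E then insert c (nbr_colours E col v) else nbr_colours E col v)"
  using assms by (auto simp: nbr_colours_def)

lemma card_avail_upd:
  assumes "u \<notin> dom col"
  shows "card (avail E k col v) \<le> card (avail E k (col(u \<mapsto> c)) v) + of_bool ({u, v} \<in> E)"
proof (cases "{u, v} \<in> E")
  case True
  have "avail E k col v \<subseteq> insert c (avail E k (col(u \<mapsto> c)) v)"
    using assms True by (auto simp: avail_def nbr_colours_upd)
  hence "card (avail E k col v) \<le> card (insert c (avail E k (col(u \<mapsto> c)) v))"
    by (intro card_mono) auto
  also have "\<dots> \<le> Suc (card (avail E k (col(u \<mapsto> c)) v))" by (rule card_insert_le_m1) auto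
  finally show ?thesis using True by simp
qed (use assms in \<open>simp add: avail_def nbr_colours_upd\<close>)

lemma card_avail_upd_le:
  assumes "u \<notin> dom col"
  shows "card (avail E k (col(u \<mapsto> c)) v) \<le> card (avail E k col v)"
  using assms by (intro card_mono) (auto simp: avail_def nbr_colours_upd)

lemma card_avail_loss:
  assumes "col0 \<subseteq>\<^sub>m col" "finite M" "dom col - dom col0 \<subseteq> M"
  shows "card (avail E k col0 v) \<le> card (avail E k col v) + card (nbrs E v \<inter> M)"
proof -
  have "avail E k col0 v \<subseteq> avail E k col v \<union> (\<lambda>u. the (col u)) ` (nbrs E v \<inter> M)"
  proof
    fix c assume c: "c \<in> avail E k col0 v"
    show "c \<in> avail E k col v \<union> (\<lambda>u. the (col u)) ` (nbrs E v \<inter> M)"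
    proof (cases "c \<in> avail E k col v")
      case False
      then obtain u where u: "{u, v} \<in> E" "col u = Some c"
        using c by (auto simp: avail_def nbr_colours_def)
      have "u \<notin> dom col0"
      proof
        assume "u \<in> dom col0"
        hence "col0 u = Some c" using u assms(1) by (auto simp: map_le_def)
        thus False using c u by (auto simp: avail_def nbr_colours_def)
      qed
      hence "u \<in> nbrs E v \<inter> M" using u assms(3) by (auto simp: nbrs_def)
      moreover have "c = the (col u)" using u by simp
      ultimately show ?thesis by blast
    qed auto
  qed
  hence "card (avail E k col0 v) \<le> card (avail E k col v \<union> (\<lambda>u. the (col u)) ` (nbrs E v \<inter> M))"
    using assms(2) by (intro card_mono) auto
  also have "\<dots> \<le> card (avail E k col v) + card ((\<lambda>u. the (col u)) ` (nbrs E v \<inter> M))"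
    by (rule card_Un_le)
  also have "card ((\<lambda>u. the (col u)) ` (nbrs E v \<inter> M)) \<le> card (nbrs E v \<inter> M)"
    using assms(2) by (intro card_image_le) auto
  finally show ?thesis by simp
qed

text \<open>Below \<open>\<beta>1\<close> colours a vertex attracts A's attention, below
  \<open>\<beta>2\<close> it must be listed; the gap pays for up to \<open>\<xi>\<close> neighbours
  coloured within a phase. In \<open>params\<close>, \<open>2 * b + 3\<close> covers at most
  \<open>2 * b - 1\<close> threats of a newly listed vertex, three spare units and one colour it may
  just have lost. The bound on \<open>m1\<close> counts A's moves at short or listed vertices,
  doubled for B's moves, plus the first moves of the phase and the current one.\<close>

locale sparse_game =
  fixes V :: "nat set" and E :: "nat set set" and k \<beta>1 \<beta>2 b \<xi> g1 g2 m1 :: nat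
  assumes finV: "finite V"
    and edgeD: "\<And>u v. {u, v} \<in> E \<Longrightarrow> u \<in> V \<and> v \<in> V \<and> u \<noteq> v"
    and few_dangerous: "\<And>col. dom col \<subseteq> V \<Longrightarrow> ran col \<subseteq> {1..k} \<Longrightarrow>
           card {v \<in> V. card (avail E k col v) < \<beta>1} \<le> g1"
    and few_attached: "\<And>M. M \<subseteq> V \<Longrightarrow> card M \<le> m1 \<Longrightarrow>
           card {v \<in> V. \<xi> \<le> card (nbrs E v \<inter> M)} \<le> g2"
    and locally_sparse: "\<And>Z. Z \<subseteq> V \<Longrightarrow> Z \<noteq> {} \<Longrightarrow> card Z \<le> 2 * g2 \<Longrightarrow>
           2 * card {v \<in> Z. b \<le> card (shared_nbrs E Z v)} < card Z"
    and params: "\<beta>2 + \<xi> \<le> \<beta>1" "2 * b + 3 \<le> \<beta>2" "1 \<le> b" "2 * (g1 + 2 * g2) + 3 \<le> m1" "\<beta>1 \<le> k"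
begin

section \<open>Listing and closing small vertex sets\<close>

abbreviation free_count :: "(nat \<rightharpoonup> nat) \<Rightarrow> nat \<Rightarrow> nat" where
  "free_count col v \<equiv> card (avail E k col v)"

lemma finite_sub: "A \<subseteq> V \<Longrightarrow> finite A"
  by (rule finite_subset[OF _ finV])

lemma finite_nbrs [simp, intro]: "finite (nbrs E v)"
  by (rule finite_subset[OF _ finV]) (auto simp: nbrs_def dest: edgeD)

lemma finite_shared [simp, intro]: "finite (shared_nbrs E Z v)"
  by (rule finite_subset[OF _ finite_nbrs[of v]]) (auto simp: shared_nbrs_def)

lemma shared_mono: "Z \<subseteq> Z' \<Longrightarrow> card (shared_nbrs E Z v) \<le> card (shared_nbrs E Z' v)"
  by (rule card_mono) (auto simp: shared_nbrs_def)

text \<open>Local sparsity also holds for subsets, so there is always a vertex with fewer than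
  \<open>b\<close> shared neighbours. It goes last, behind all vertices it shares with, and the rest
  is listed recursively; appending takes no pointer away from earlier vertices.\<close>

lemma peel:
  assumes "Y \<subseteq> V" "card Y \<le> 2 * g2"
  shows "\<exists>ys. distinct ys \<and> set ys = Y \<and> (\<forall>v\<in>Y. card {w \<in> nbrs E v. up E ys w \<noteq> Some v} < b)"
  using assms
proof (induction "card Y" arbitrary: Y)
  case 0
  hence "Y = {}" using finite_sub[of Y] by simp
  thus ?case by (intro exI[of _ "[]"]) auto
next
  case (Suc m)
  have finY: "finite Y" using Suc.prems by (intro finite_sub)
  have "Y \<noteq> {}" using Suc.hyps(2) by auto
  hence "2 * card {v \<in> Y. b \<le> card (shared_nbrs E Y v)} < card Y" using locally_sparse Suc by blast
  hence "{v \<in> Y. b \<le> card (shared_nbrs E Y v)} \<noteq> Y" by auto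
  then obtain v where v: "v \<in> Y" "card (shared_nbrs E Y v) < b" by fastforce
  have cY: "card (Y - {v}) = m" using Suc.hyps(2) v finY by simp
  obtain ys where ys: "distinct ys" "set ys = Y - {v}"
    "\<forall>y\<in>Y - {v}. card {w \<in> nbrs E y. up E ys w \<noteq> Some y} < b"
  proof -
    have "Y - {v} \<subseteq> V" "card (Y - {v}) \<le> 2 * g2" using Suc.prems Suc.hyps(2) cY by auto
    from Suc.hyps(1)[OF cY[symmetric] this] show ?thesis using that by blast
  qed
  show ?case
  proof (intro exI[of _ "ys @ [v]"] conjI ballI)
    show "distinct (ys @ [v])" "set (ys @ [v]) = Y" using ys v by auto
    fix y assume y: "y \<in> Y"
    show "card {w \<in> nbrs E y. up E (ys @ [v]) w \<noteq> Some y} < b"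
    proof (cases "y = v")
      case True
      have "{w \<in> nbrs E v. up E (ys @ [v]) w \<noteq> Some v} \<subseteq> shared_nbrs E Y v"
      proof
        fix w assume w: "w \<in> {w \<in> nbrs E v. up E (ys @ [v]) w \<noteq> Some v}"
        have "up E [v] w = Some v" using w by (auto simp: up_def nbrs_def insert_commute)
        then obtain z where z: "up E ys w = Some z" using w by (auto simp: up_append split: option.splits)
        from up_Some[OF z] have "z \<in> Y - {v}" "w \<in> nbrs E z" using ys by (auto simp: nbrs_def insert_commute)
        thus "w \<in> shared_nbrs E Y v" using w by (auto simp: shared_nbrs_def)
      qed
      hence "card {w \<in> nbrs E v. up E (ys @ [v]) w \<noteq> Some v} \<le> card (shared_nbrs E Y v)"
        by (intro card_mono) auto
      thus ?thesis using v True by simp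
    next
      case False
      hence y': "y \<in> Y - {v}" using y by auto
      have "{w \<in> nbrs E y. up E (ys @ [v]) w \<noteq> Some y} \<subseteq> {w \<in> nbrs E y. up E ys w \<noteq> Some y}"
        by (auto simp: up_append)
      hence "card {w \<in> nbrs E y. up E (ys @ [v]) w \<noteq> Some y} \<le> card {w \<in> nbrs E y. up E ys w \<noteq> Some y}"
        by (intro card_mono) auto
      thus ?thesis using ys(3) y' by (meson le_less_trans)
    qed
  qed
qed

text \<open>The size bound belongs to the invariant because local sparsity is assumed only up to
  size \<open>2 * g2\<close>.\<close>

definition generated :: "nat set \<Rightarrow> nat set \<Rightarrow> bool" where
  "generated D Z \<longleftrightarrow> D \<subseteq> Z \<and> Z \<subseteq> V \<and> card Z \<le> 2 * card D \<and>
     (\<forall>y\<in>Z - D. b \<le> card (shared_nbrs E Z y))"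

text \<open>This protects the future: a vertex listed later finds fewer than \<open>b\<close> of its
  neighbours already pointing to the present list.\<close>

definition closed_set :: "nat set \<Rightarrow> bool" where
  "closed_set Z \<longleftrightarrow> (\<forall>z\<in>V - Z. card (shared_nbrs E Z z) < b)"

text \<open>Take a generated superset of maximal size. If a further vertex had \<open>b\<close>
  shared neighbours, the size bound would have to be attained; then half of the set, everything
  outside the core, shares at least \<open>b\<close> neighbours, contrary to local sparsity.\<close>

lemma closure_exists:
  assumes "generated D Z" "D \<subseteq> D'" "D' \<subseteq> V" "card D' \<le> g2"
  shows "\<exists>Z'. Z \<union> D' \<subseteq> Z' \<and> generated D' Z' \<and> closed_set Z'"
proof -
  have finD': "finite D'" and finZ: "finite Z"
    using assms finV finite_subset by (auto simp: generated_def)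
  have finD: "finite D" using assms finD' finite_subset by auto
  define \<F> where "\<F> = {Z'. Z \<union> D' \<subseteq> Z' \<and> generated D' Z'}"
  have 0: "Z \<union> D' \<in> \<F>"
  proof -
    have "card (Z \<union> D') = card (Z \<union> (D' - D))"
      using assms by (intro arg_cong[where f = card]) (auto simp: generated_def)
    also have "\<dots> \<le> card Z + card (D' - D)" by (rule card_Un_le)
    also have "card (D' - D) = card D' - card D" using assms finD by (intro card_Diff_subset) auto
    also have "card Z + (card D' - card D) \<le> 2 * card D'"
      using assms card_mono[OF finD' assms(2)] by (auto simp: generated_def)
    finally have c: "card (Z \<union> D') \<le> 2 * card D'" .
    have "b \<le> card (shared_nbrs E (Z \<union> D') y)" if "y \<in> Z - D'" for y
    proof -
      have "b \<le> card (shared_nbrs E Z y)" using assms(1,2) that unfolding generated_def by blast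
      also have "\<dots> \<le> card (shared_nbrs E (Z \<union> D') y)" by (rule shared_mono) auto
      finally show ?thesis .
    qed
    thus ?thesis using c assms by (auto simp: \<F>_def generated_def)
  qed
  have fin: "finite \<F>" by (rule finite_subset[of _ "Pow V"]) (use finV in \<open>auto simp: \<F>_def generated_def\<close>)
  define m where "m = Max (card ` \<F>)"
  have "m \<in> card ` \<F>" unfolding m_def using 0 fin by (intro Max_in) auto
  then obtain Z' where Z': "Z' \<in> \<F>" "card Z' = m" by auto
  have max: "card Y \<le> card Z'" if "Y \<in> \<F>" for Y
    unfolding Z' m_def using fin that by auto
  have g: "generated D' Z'" "Z \<union> D' \<subseteq> Z'" using Z' by (auto simp: \<F>_def)
  have finZ': "finite Z'" using g finV finite_subset by (auto simp: generated_def)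
  have "closed_set Z'"
  proof (rule ccontr)
    assume "\<not> closed_set Z'"
    then obtain z where z: "z \<in> V" "z \<notin> Z'" "b \<le> card (shared_nbrs E Z' z)"
      by (auto simp: closed_set_def not_less)
    have notin: "insert z Z' \<notin> \<F>" using max[of "insert z Z'"] z finZ' by auto
    have "b \<le> card (shared_nbrs E (insert z Z') y)" if "y \<in> insert z Z' - D'" for y
    proof -
      have "b \<le> card (shared_nbrs E Z' y)" using g(1) z(3) that unfolding generated_def by blast
      also have "\<dots> \<le> card (shared_nbrs E (insert z Z') y)" by (rule shared_mono) auto
      finally show ?thesis .
    qed
    with notin have "\<not> card (insert z Z') \<le> 2 * card D'" using g z by (auto simp: \<F>_def generated_def)
    hence cZ: "card Z' = 2 * card D'" using g z finZ' by (auto simp: generated_def)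
    show False
    \<comment> \<open>For the empty set local sparsity says nothing, but there nothing is shared and
      \<open>b\<close> is positive.\<close>
    proof (cases "Z' = {}")
      case True
      thus False using z(3) params by (auto simp: shared_nbrs_def)
    next
      case False
      have "2 * card {v \<in> Z'. b \<le> card (shared_nbrs E Z' v)} < card Z'"
        using g False assms(4) by (intro locally_sparse) (auto simp: generated_def)
      moreover have "card (Z' - D') \<le> card {v \<in> Z'. b \<le> card (shared_nbrs E Z' v)}"
        using g finZ' by (intro card_mono) (auto simp: generated_def)
      moreover have "card (Z' - D') = card Z' - card D'"
        using g finD' by (intro card_Diff_subset) (auto simp: generated_def)
      ultimately show False using cZ by linarith
    qed
  qed
  thus ?thesis using g by auto
qed

text \<open>Measured against \<open>dom col0\<close> rather than \<open>dom col\<close>: within a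
  phase the set can only grow, and vertices coloured meanwhile remain in it.\<close>

definition danger :: "(nat \<rightharpoonup> nat) \<Rightarrow> (nat \<rightharpoonup> nat) \<Rightarrow> nat set" where
  "danger col0 col = {v \<in> V - dom col0. free_count col v < \<beta>2}"

text \<open>The bound \<open>2 * b\<close> has two sources: fewer than \<open>b\<close> neighbours
  point to older layers, and fewer than \<open>b\<close> to other vertices of the own layer.\<close>

definition layered :: "(nat \<rightharpoonup> nat) \<Rightarrow> (nat \<rightharpoonup> nat) \<Rightarrow> nat list \<Rightarrow> bool" where
  "layered col0 col xs \<longleftrightarrow> distinct xs \<and> generated (danger col0 col) (set xs) \<and> closed_set (set xs) \<and>
     card (danger col0 col) \<le> g2 \<and> (\<forall>v\<in>set xs. card {w \<in> nbrs E v. up E xs w \<noteq> Some v} < 2 * b)"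

text \<open>The vertices whose colouring may cost \<open>v\<close> a colour without any reaction of
  A in favour of \<open>v\<close>. They have to be paid for in advance.\<close>

definition threats :: "nat list \<Rightarrow> (nat \<rightharpoonup> nat) \<Rightarrow> nat \<Rightarrow> nat set" where
  "threats xs col v = {w \<in> nbrs E v. w \<notin> dom col \<and> up E xs w \<noteq> Some v}"

definition children :: "nat list \<Rightarrow> (nat \<rightharpoonup> nat) \<Rightarrow> nat set \<Rightarrow> nat \<Rightarrow> nat set" where
  "children xs col Act v = {u \<in> Act. u \<notin> dom col \<and> up E xs u = Some v}"

text \<open>An uncoloured listed vertex has at least three more available colours than future attacks against
  which A does not react. Being \<open>active\<close> costs it one unit, and \<open>hit\<close> is the only vertex allowed to be
  short of one further unit: the one to which A owes a reply.\<close>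

definition guarded :: "nat list \<Rightarrow> (nat \<rightharpoonup> nat) \<Rightarrow> nat set \<Rightarrow> nat option \<Rightarrow> bool" where
  "guarded xs col Act hit \<longleftrightarrow> Act \<subseteq> V \<and> set_option hit \<subseteq> set xs \<and>
     (\<forall>v\<in>set xs - dom col. card (threats xs col v) + card (children xs col Act v) + 3 \<le>
        free_count col v + of_bool (v \<in> Act) + of_bool (hit = Some v)) \<and>
     (\<forall>x\<in>Act - dom col. up E xs x \<noteq> None)"

section \<open>Activation: A's replies for a fixed list\<close>

lemma finite_threats [simp, intro]: "finite (threats xs col v)"
  by (simp add: threats_def)

text \<open>Colouring \<open>u\<close> takes at most one colour from a neighbour \<open>v\<close>.
  If \<open>u\<close> points elsewhere, it leaves \<open>threats\<close>; if it is active and points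
  to \<open>v\<close>, it leaves \<open>children\<close>; either pays for the loss. Only an inactive
  \<open>u\<close> pointing to \<open>v\<close> leaves a debt, the new \<open>hit\<close>.\<close>

lemma guarded_colour:
  assumes "guarded xs col Act hit" "\<And>v. hit = Some v \<Longrightarrow> v = u \<or> v \<in> dom col" "u \<in> V" "u \<notin> dom col"
  shows "guarded xs (col(u \<mapsto> c)) Act (if u \<in> Act then None else up E xs u)"
proof -
  have finA: "finite Act" using assms(1) by (intro finite_sub) (auto simp: guarded_def)
  let ?col = "col(u \<mapsto> c)" and ?h = "if u \<in> Act then None else up E xs u"
  have "card (threats xs ?col v) + card (children xs ?col Act v) + 3 \<le>
        free_count ?col v + of_bool (v \<in> Act) + of_bool (?h = Some v)"
    if v: "v \<in> set xs - dom ?col" for v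
  proof -
    have vu: "v \<noteq> u" and v': "v \<in> set xs - dom col" using v by auto
    have hit: "hit \<noteq> Some v" using assms(2)[of v] vu v' by auto
    have "card (threats xs col v) + card (children xs col Act v) + 3 \<le>
        free_count col v + of_bool (v \<in> Act) + of_bool (hit = Some v)"
      using assms(1) v' unfolding guarded_def by blast
    hence old: "card (threats xs col v) + card (children xs col Act v) + 3 \<le>
        free_count col v + of_bool (v \<in> Act)"
      using hit by simp
    have av: "free_count col v \<le> free_count ?col v + of_bool ({u, v} \<in> E)"
      by (rule card_avail_upd) fact
    have fa: "finite (children xs col Act v)" using finA by (simp add: children_def)
    have t1: "threats xs ?col v = threats xs col v - {u}" by (auto simp: threats_def)
    have a1: "children xs ?col Act v = children xs col Act v - {u}"
      by (auto simp: children_def)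
    have le: "card (threats xs col v - {u}) \<le> card (threats xs col v)"
      "card (children xs col Act v - {u}) \<le> card (children xs col Act v)"
      using fa by (auto intro!: card_mono)
    have d1: "card (threats xs col v - {u}) + 1 = card (threats xs col v)" if "u \<in> threats xs col v"
      using that by (metis finite_threats Suc_eq_plus1 card_Suc_Diff1)
    have d2: "card (children xs col Act v - {u}) + 1 = card (children xs col Act v)"
      if "u \<in> children xs col Act v"
      using that fa by (metis Suc_eq_plus1 card_Suc_Diff1)
    show ?thesis
    proof (cases "{u, v} \<in> E")
      case False
      thus ?thesis using old av le unfolding t1 a1 by auto
    next
      case True
      show ?thesis
      proof (cases "up E xs u = Some v")
        case False
        hence "u \<in> threats xs col v" using True assms(4) by (auto simp: threats_def nbrs_def)
        thus ?thesis using d1 old av le True unfolding t1 a1 by auto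
      next
        case up: True
        show ?thesis
        proof (cases "u \<in> Act")
          case uA: True
          hence "u \<in> children xs col Act v" using up assms(4) by (auto simp: children_def)
          thus ?thesis using d2 old av le True unfolding t1 a1 by auto
        next
          case False
          thus ?thesis using old av le up True unfolding t1 a1 by auto
        qed
      qed
    qed
  qed
  moreover have "set_option ?h \<subseteq> set xs" using up_Some[of E xs u] by (auto split: if_splits)
  moreover have "Act \<subseteq> V" "\<forall>x\<in>Act - dom ?col. up E xs x \<noteq> None"
    using assms(1) unfolding guarded_def by auto
  ultimately show ?thesis unfolding guarded_def by blast
qed

lemma guarded_unhit:
  assumes "guarded xs col Act hit" "\<And>v. hit = Some v \<Longrightarrow> v \<in> dom col"
  shows "guarded xs col Act None"
  unfolding guarded_def
proof (intro conjI ballI)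
  show "Act \<subseteq> V" using assms(1) unfolding guarded_def by blast
  show "set_option None \<subseteq> set xs" by simp
next
  fix v assume v: "v \<in> set xs - dom col"
  hence "card (threats xs col v) + card (children xs col Act v) + 3 \<le>
      free_count col v + of_bool (v \<in> Act) + of_bool (hit = Some v)"
    using assms(1) unfolding guarded_def by blast
  moreover have "hit \<noteq> Some v" using assms(2) v by auto
  ultimately show "card (threats xs col v) + card (children xs col Act v) + 3 \<le>
      free_count col v + of_bool (v \<in> Act) + of_bool (None = Some v)" by simp
next
  fix x assume "x \<in> Act - dom col"
  thus "up E xs x \<noteq> None" using assms(1) unfolding guarded_def by blast
qed

text \<open>Activation passes a debt on. The unit granted to active vertices settles the debt of
  \<open>v\<close>, while the target \<open>y\<close> of its pointer acquires a child and becomes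
  the vertex to which A owes a reply.\<close>

lemma guarded_activate:
  assumes "guarded xs col Act hit" "hit = None \<or> hit = Some v" "v \<in> V" "v \<notin> Act" "v \<notin> dom col" "up E xs v = Some y"
  shows "guarded xs col (insert v Act) (Some y)"
proof -
  have finA: "finite Act" using assms(1) by (intro finite_sub) (auto simp: guarded_def)
  have y: "y \<in> set xs" "y \<noteq> v" using up_Some[OF assms(6)] edgeD by auto
  have "card (threats xs col z) + card (children xs col (insert v Act) z) + 3 \<le>
        free_count col z + of_bool (z \<in> insert v Act) + of_bool (Some y = Some z)"
    if z: "z \<in> set xs - dom col" for z
  proof -
    have old: "card (threats xs col z) + card (children xs col Act z) + 3 \<le>
        free_count col z + of_bool (z \<in> Act) + of_bool (hit = Some z)"
      using assms(1) z unfolding guarded_def by blast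
    have fa: "finite (children xs col Act z)" using finA by (simp add: children_def)
    show ?thesis
    proof (cases "z = y")
      case True
      have "children xs col (insert v Act) z \<subseteq> insert v (children xs col Act z)"
        by (auto simp: children_def)
      hence "card (children xs col (insert v Act) z) \<le> card (insert v (children xs col Act z))"
        using fa by (intro card_mono) auto
      also have "\<dots> \<le> Suc (card (children xs col Act z))" using fa by (simp add: card_insert_if)
      finally show ?thesis using old True y assms(2) by auto
    next
      case False
      hence "children xs col (insert v Act) z = children xs col Act z"
        using assms(6) by (auto simp: children_def)
      thus ?thesis using old False assms(2,4) by auto
    qed
  qed
  moreover have "insert v Act \<subseteq> V" "\<forall>x\<in>insert v Act - dom col. up E xs x \<noteq> None"
    using assms unfolding guarded_def by auto
  moreover have "set_option (Some y) \<subseteq> set xs" using y by simp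
  ultimately show ?thesis unfolding guarded_def by blast
qed

text \<open>A colours the first vertex on the walk that is already active or whose pointer is absent
  or leads to a coloured vertex, for then no debt arises. Pointers may form cycles; the walk ends
  because every step activates a new vertex.\<close>

lemma resolve_hit:
  assumes "guarded xs col Act (Some v)" "v \<notin> dom col" "set xs \<subseteq> V"
  shows "\<exists>u\<in>set xs - dom col. \<exists>Act'. \<forall>c. guarded xs (col(u \<mapsto> c)) Act' None"
  using assms
proof (induction "card (V - Act)" arbitrary: v Act rule: less_induct)
  case less
  have vV: "v \<in> set xs" "v \<in> V" using less.prems by (auto simp: guarded_def)
  have direct: "guarded xs (col(v \<mapsto> c)) Act (if v \<in> Act then None else up E xs v)" for c
    using less.prems vV by (intro guarded_colour) auto
  show ?case
  proof (cases "v \<in> Act \<or> (\<forall>y. up E xs v = Some y \<longrightarrow> y \<in> dom col)")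
    case True
    have "guarded xs (col(v \<mapsto> c)) Act None" for c
      using direct[of c] by (rule guarded_unhit) (use True in \<open>auto split: if_splits\<close>)
    thus ?thesis using vV less.prems by blast
  next
    case False
    then obtain y where y: "up E xs v = Some y" "y \<notin> dom col" "v \<notin> Act" by auto
    have g: "guarded xs col (insert v Act) (Some y)"
      using less.prems vV y by (intro guarded_activate) auto
    have "V - insert v Act \<subset> V - Act" using vV y by auto
    hence "card (V - insert v Act) < card (V - Act)" using finV by (intro psubset_card_mono) auto
    from less.hyps[OF this g y(2) less.prems(3)] show ?thesis .
  qed
qed

text \<open>Without a debt A starts the walk at a vertex \<open>u0\<close> of its own choice. In
  every case it colours \<open>u0\<close> or a listed vertex, which is what makes its moves
  countable.\<close>

lemma guarded_reply:
  assumes "guarded xs col Act hit" "set xs \<subseteq> V" "u0 \<in> V" "u0 \<notin> dom col"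
  shows "\<exists>u\<in>V - dom col. (u \<in> set xs \<or> u = u0) \<and> (\<exists>Act'. \<forall>c. guarded xs (col(u \<mapsto> c)) Act' None)"
proof (cases "\<exists>v. hit = Some v \<and> v \<notin> dom col")
  case True
  then obtain v where v: "hit = Some v" "v \<notin> dom col" by blast
  from resolve_hit[OF assms(1)[unfolded v(1)] v(2) assms(2)] show ?thesis using assms(2) by blast
next
  case False
  hence g: "guarded xs col Act None" using assms(1) by (intro guarded_unhit) auto
  have direct: "guarded xs (col(u0 \<mapsto> c)) Act (if u0 \<in> Act then None else up E xs u0)" for c
    using g assms by (intro guarded_colour) auto
  show ?thesis
  proof (cases "u0 \<in> Act \<or> (\<forall>y. up E xs u0 = Some y \<longrightarrow> y \<in> dom col)")
    case True
    have "guarded xs (col(u0 \<mapsto> c)) Act None" for c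
      using direct[of c] by (rule guarded_unhit) (use True in \<open>auto split: if_splits\<close>)
    thus ?thesis using assms by blast
  next
    case False
    then obtain y where y: "up E xs u0 = Some y" "y \<notin> dom col" "u0 \<notin> Act" by auto
    have "guarded xs col (insert u0 Act) (Some y)"
      using g assms y by (intro guarded_activate) auto
    from resolve_hit[OF this y(2) assms(2)] show ?thesis using assms(2) by blast
  qed
qed

lemma danger_mono:
  assumes "u \<notin> dom col"
  shows "danger col0 col \<subseteq> danger col0 (col(u \<mapsto> c))"
  using card_avail_upd_le[OF assms, of E k c] unfolding danger_def by (auto intro: le_less_trans)

text \<open>All neighbours of old listed vertices already have pointers, so the inequalities there
  are unchanged. A new vertex was not in danger one move before, hence has at least
  \<open>\<beta>2 - 1\<close> colours, against fewer than \<open>2 * b\<close> threats and no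
  children.\<close>

lemma layered_extend:
  assumes lay: "layered col0 col xs" and g: "guarded xs (col(u \<mapsto> c)) Act hit"
    and u: "u \<in> V" "u \<notin> dom col" and col0: "col0 \<subseteq>\<^sub>m col"
    and small: "card (danger col0 (col(u \<mapsto> c))) \<le> g2"
  shows "\<exists>xs'. layered col0 (col(u \<mapsto> c)) xs' \<and> guarded xs' (col(u \<mapsto> c)) Act hit \<and> set xs \<subseteq> set xs'"
proof -
  let ?col = "col(u \<mapsto> c)"
  have gen: "generated (danger col0 col) (set xs)" and cl: "closed_set (set xs)"
    and dist: "distinct xs" and r: "\<forall>v\<in>set xs. card {w \<in> nbrs E v. up E xs w \<noteq> Some v} < 2 * b"
    using lay by (auto simp: layered_def)
  have DV: "danger col0 ?col \<subseteq> V" by (auto simp: danger_def)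
  obtain Z' where Z': "set xs \<union> danger col0 ?col \<subseteq> Z'" "generated (danger col0 ?col) Z'" "closed_set Z'"
    using closure_exists[OF gen danger_mono[OF u(2)] DV small] by blast
  define Y where "Y = Z' - set xs"
  have YV: "Y \<subseteq> V" using Z' by (auto simp: Y_def generated_def)
  have finZ': "finite Z'" using Z' finV finite_subset by (auto simp: generated_def)
  have "card Y \<le> card Z'" using finZ' by (intro card_mono) (auto simp: Y_def)
  also have "\<dots> \<le> 2 * g2" using Z' small by (auto simp: generated_def)
  finally obtain ys where ys: "distinct ys" "set ys = Y"
    "\<forall>v\<in>Y. card {w \<in> nbrs E v. up E ys w \<noteq> Some v} < b"
    using peel[OF YV] by blast
  let ?xs = "xs @ ys"
  have set: "set ?xs = Z'" using ys Z' by (auto simp: Y_def)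
  have up_old: "up E ?xs w = up E xs w" if "up E xs w \<noteq> None" for w
    using that by (auto simp: up_append)
  have up_nbr: "up E xs w \<noteq> None" if "v \<in> set xs" "w \<in> nbrs E v" for v w
    using that by (auto simp: up_eq_None_iff nbrs_def insert_commute)
  have newY: "card {w \<in> nbrs E v. up E ?xs w \<noteq> Some v} < 2 * b" if v: "v \<in> Y" for v
  proof -
    have "{w \<in> nbrs E v. up E ?xs w \<noteq> Some v} \<subseteq>
        shared_nbrs E (set xs) v \<union> {w \<in> nbrs E v. up E ys w \<noteq> Some v}"
    proof
      fix w assume w: "w \<in> {w \<in> nbrs E v. up E ?xs w \<noteq> Some v}"
      show "w \<in> shared_nbrs E (set xs) v \<union> {w \<in> nbrs E v. up E ys w \<noteq> Some v}"
      proof (cases "up E xs w")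
        case None
        thus ?thesis using w by (auto simp: up_append)
      next
        case (Some x)
        hence "x \<in> set xs" "w \<in> nbrs E x" using up_Some[OF Some] by (auto simp: nbrs_def insert_commute)
        thus ?thesis using w v by (auto simp: shared_nbrs_def Y_def)
      qed
    qed
    hence "card {w \<in> nbrs E v. up E ?xs w \<noteq> Some v} \<le>
        card (shared_nbrs E (set xs) v \<union> {w \<in> nbrs E v. up E ys w \<noteq> Some v})"
      by (intro card_mono) auto
    also have "\<dots> \<le> card (shared_nbrs E (set xs) v) + card {w \<in> nbrs E v. up E ys w \<noteq> Some v}"
      by (rule card_Un_le)
    also have "\<dots> < b + b"
      using cl v YV ys(3) by (intro add_strict_mono) (auto simp: closed_set_def Y_def)
    finally show ?thesis by simp
  qed
  have oldset: "{w \<in> nbrs E v. up E ?xs w \<noteq> Some v} = {w \<in> nbrs E v. up E xs w \<noteq> Some v}" if "v \<in> set xs" for v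
    using up_old up_nbr[OF that] by auto
  have "layered col0 ?col ?xs"
    unfolding layered_def set
  proof (intro conjI ballI)
    show "distinct ?xs" using dist ys by (auto simp: Y_def)
    fix v assume "v \<in> Z'"
    thus "card {w \<in> nbrs E v. up E ?xs w \<noteq> Some v} < 2 * b"
      using newY oldset r by (cases "v \<in> set xs") (auto simp: Y_def)
  qed (use Z' small in auto)
  moreover have "guarded ?xs ?col Act hit"
  proof -
    \<comment> \<open>Active uncoloured vertices already have a pointer, so none of them becomes a
      child of a new vertex. The last clause of \<open>guarded\<close> exists for this.\<close>
    have actup: "up E ?xs x = up E xs x" if "x \<in> Act - dom ?col" for x
      using g that up_old by (auto simp: guarded_def)
    have ach: "children ?xs ?col Act v = children xs ?col Act v" for v
      unfolding children_def using actup by (intro Collect_cong conj_cong refl) (auto simp: up_append)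
    have "card (threats ?xs ?col v) + card (children ?xs ?col Act v) + 3 \<le>
        free_count ?col v + of_bool (v \<in> Act) + of_bool (hit = Some v)"
      if v: "v \<in> set ?xs - dom ?col" for v
    proof (cases "v \<in> set xs")
      case True
      have "threats ?xs ?col v = threats xs ?col v"
        using oldset[OF True] by (auto simp: threats_def)
      thus ?thesis using g True v unfolding ach guarded_def by auto
    next
      case False
      hence vY: "v \<in> Y" using v ys by auto
      have "children xs ?col Act v = {}"
        using False by (auto simp: children_def dest!: up_Some)
      moreover have "card (threats ?xs ?col v) \<le> card {w \<in> nbrs E v. up E ?xs w \<noteq> Some v}"
        by (intro card_mono) (auto simp: threats_def)
      moreover have "\<beta>2 \<le> free_count col v"
      proof -
        have "v \<notin> danger col0 col" using False gen by (auto simp: generated_def)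
        moreover have "v \<notin> dom col0" using v map_le_implies_dom_le[OF col0] by auto
        ultimately show ?thesis using vY YV by (auto simp: danger_def)
      qed
      moreover have "free_count col v \<le> free_count ?col v + 1"
        using card_avail_upd[OF u(2), of E k v c] by (cases "{u, v} \<in> E") auto
      ultimately show ?thesis using newY[OF vY] params unfolding ach by auto
    qed
    moreover have "Act \<subseteq> V" "\<forall>x\<in>Act - dom ?col. up E ?xs x \<noteq> None" "set_option hit \<subseteq> set ?xs"
      using g actup unfolding guarded_def by auto
    ultimately show ?thesis unfolding guarded_def by blast
  qed
  ultimately show ?thesis by (intro exI[of _ ?xs]) auto
qed

text \<open>Here \<open>col0\<close> is the colouring at the last time when every uncoloured vertex had \<open>\<beta>1\<close> available
  colours; the bookkeeping restarts from scratch at each such time. All later moves of A, collected in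
  \<open>MA\<close>, were spent on vertices that are listed or short of colours, which bounds the number of moves
  made since.\<close>

definition position :: "nat \<Rightarrow> (nat \<rightharpoonup> nat) \<Rightarrow> nat option \<Rightarrow> bool" where
  "position s col hit \<longleftrightarrow> dom col \<subseteq> V \<and> ran col \<subseteq> {1..k} \<and>
     (\<exists>col0 xs Act MA. col0 \<subseteq>\<^sub>m col \<and> (\<forall>v\<in>V - dom col0. \<beta>1 \<le> free_count col0 v) \<and>
        layered col0 col xs \<and> guarded xs col Act hit \<and> MA \<subseteq> dom col \<and>
        MA \<subseteq> {v \<in> V. free_count col v < \<beta>1} \<union> set xs \<and>
        card (dom col - dom col0) \<le> 2 * card MA + s)"

text \<open>Serves the moves of both players. \<open>MA\<close> lies in a set of size at most
  \<open>g1 + 2 * g2\<close>, so the phase has at most \<open>m1\<close> moves; by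
  \<open>few_attached\<close> at most \<open>g2\<close> vertices meet \<open>\<xi>\<close> of them,
  and only those can drop from \<open>\<beta>1\<close> below \<open>\<beta>2\<close>.\<close>

lemma position_colour:
  assumes col: "dom col \<subseteq> V" "ran col \<subseteq> {1..k}" and col0: "col0 \<subseteq>\<^sub>m col"
    and fresh: "\<forall>v\<in>V - dom col0. \<beta>1 \<le> free_count col0 v"
    and lay: "layered col0 col xs" and g: "guarded xs (col(u \<mapsto> c)) Act hit"
    and MA: "MA \<subseteq> {v \<in> V. free_count col v < \<beta>1} \<union> set xs"
    and MAd: "MA \<subseteq> dom col" and cnt: "card (dom col - dom col0) \<le> 2 * card MA + 2"
    and u: "legal_move V E k col u c"
    and MA': "MA' = MA \<or> (MA' = insert u MA \<and> (u \<in> {v \<in> V. free_count col v < \<beta>1} \<union> set xs))"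
    and cnt': "card (dom col - dom col0) + 1 \<le> 2 * card MA' + s"
  shows "position s (col(u \<mapsto> c)) hit"
proof -
  let ?col = "col(u \<mapsto> c)"
  have uV: "u \<in> V" "u \<notin> dom col" and c: "c \<in> {1..k}" using u by (auto simp: legal_move_def)
  have col0': "col0 \<subseteq>\<^sub>m ?col" using col0 uV map_le_implies_dom_le[OF col0] by (auto simp: map_le_def)
  have xsV: "set xs \<subseteq> V" using lay by (auto simp: layered_def generated_def)
  have "card MA \<le> card ({v \<in> V. free_count col v < \<beta>1} \<union> set xs)"
    using finV by (intro card_mono MA) auto
  also have "\<dots> \<le> card {v \<in> V. free_count col v < \<beta>1} + card (set xs)" by (rule card_Un_le)
  also have "\<dots> \<le> g1 + 2 * g2"
    using few_dangerous[OF col] lay by (intro add_mono) (auto simp: layered_def generated_def)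
  finally have cMA: "card MA \<le> g1 + 2 * g2" .
  have un: "u \<notin> dom col0" using uV map_le_implies_dom_le[OF col0] by auto
  have finM: "finite (dom col - dom col0)" using col by (intro finite_sub) auto
  have M: "dom ?col - dom col0 = insert u (dom col - dom col0)" using un by auto
  have cM: "card (dom ?col - dom col0) = card (dom col - dom col0) + 1" unfolding M using uV finM by simp
  have "card (dom ?col - dom col0) \<le> m1" unfolding cM using cnt cMA params(4) by (simp add: algebra_simps)
  hence att: "card {v \<in> V. \<xi> \<le> card (nbrs E v \<inter> (dom ?col - dom col0))} \<le> g2"
    using col uV by (intro few_attached) auto
  have "danger col0 ?col \<subseteq> {v \<in> V. \<xi> \<le> card (nbrs E v \<inter> (dom ?col - dom col0))}"
  proof
    fix v assume v: "v \<in> danger col0 ?col"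
    have "free_count col0 v \<le> free_count ?col v + card (nbrs E v \<inter> (dom ?col - dom col0))"
      using finM by (intro card_avail_loss col0') (simp_all add: M del: dom_fun_upd)
    thus "v \<in> {v \<in> V. \<xi> \<le> card (nbrs E v \<inter> (dom ?col - dom col0))}"
      using v fresh params by (force simp: danger_def)
  qed
  hence "card (danger col0 ?col) \<le> card {v \<in> V. \<xi> \<le> card (nbrs E v \<inter> (dom ?col - dom col0))}"
    using finV by (intro card_mono) auto
  hence "card (danger col0 ?col) \<le> g2" using att by linarith
  from layered_extend[OF lay g uV col0 this] obtain xs' where xs':
    "layered col0 ?col xs'" "guarded xs' ?col Act hit" "set xs \<subseteq> set xs'" by blast
  have "{v \<in> V. free_count col v < \<beta>1} \<subseteq> {v \<in> V. free_count ?col v < \<beta>1}"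
    using card_avail_upd_le[OF uV(2), of E k c] by (auto intro: le_less_trans)
  hence 1: "MA' \<subseteq> {v \<in> V. free_count ?col v < \<beta>1} \<union> set xs'"
    using MA MA' xs'(3) by blast
  have 2: "MA' \<subseteq> dom ?col" using MAd MA' by auto
  have 3: "ran ?col \<subseteq> {1..k}" using col c uV by auto
  have 4: "dom ?col \<subseteq> V" using col uV by auto
  have 5: "card (dom ?col - dom col0) \<le> 2 * card MA' + s" using cnt' unfolding cM .
  show ?thesis
    unfolding position_def
    by (intro conjI exI[of _ col0] exI[of _ xs'] exI[of _ Act] exI[of _ MA'] 1 2 3 4 5 col0' fresh xs'(1,2))
qed

lemma position_avail:
  assumes "position s col hit" "v \<in> V" "v \<notin> dom col"
  shows "avail E k col v \<noteq> {}"
proof -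
  obtain col0 xs Act where p: "col0 \<subseteq>\<^sub>m col" "layered col0 col xs" "guarded xs col Act hit"
    using assms(1) by (auto simp: position_def)
  have "1 \<le> free_count col v"
  proof (cases "v \<in> set xs")
    case True
    hence "card (threats xs col v) + card (children xs col Act v) + 3 \<le>
        free_count col v + of_bool (v \<in> Act) + of_bool (hit = Some v)"
      using p(3) assms by (auto simp: guarded_def)
    \<comment> \<open>Of the three spare units at most two are spent, one on \<open>Act\<close> and
      one on \<open>hit\<close>.\<close>
    moreover have "of_bool (v \<in> Act) \<le> (1::nat)" "of_bool (hit = Some v) \<le> (1::nat)" by auto
    ultimately show ?thesis by linarith
  next
    case False
    hence "v \<notin> danger col0 col" using p by (auto simp: layered_def generated_def)
    moreover have "v \<notin> dom col0" using map_le_implies_dom_le[OF p(1)] assms by auto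
    ultimately show ?thesis using assms params by (auto simp: danger_def)
  qed
  thus ?thesis by auto
qed

lemma position_not_blocked: "position s col hit \<Longrightarrow> \<not> blocked V E k col"
  using position_avail by (auto simp: blocked_iff_avail)

lemma A_reply:
  assumes pos: "position 2 col hit" and unc: "\<not> V \<subseteq> dom col"
  shows "\<exists>u c. legal_move V E k col u c \<and> position 1 (col(u \<mapsto> c)) None"
proof -
  obtain col0 xs Act MA where p: "dom col \<subseteq> V" "ran col \<subseteq> {1..k}" "col0 \<subseteq>\<^sub>m col"
      "\<forall>v\<in>V - dom col0. \<beta>1 \<le> free_count col0 v" "layered col0 col xs" "guarded xs col Act hit"
      "MA \<subseteq> {v \<in> V. free_count col v < \<beta>1} \<union> set xs" "MA \<subseteq> dom col"
      "card (dom col - dom col0) \<le> 2 * card MA + 2"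
    using pos by (auto simp: position_def)
  show ?thesis
  proof (cases "\<exists>v\<in>V - dom col. free_count col v < \<beta>1")
    case False
    \<comment> \<open>No vertex is short of colours: a new phase starts with an empty list. This
      move of A is not entered in \<open>MA\<close>; the slack 1 in \<open>position\<close> accounts
      for it.\<close>
    obtain u where u: "u \<in> V" "u \<notin> dom col" using unc by auto
    obtain c where c: "c \<in> avail E k col u" using position_avail[OF pos u] by auto
    have lm: "legal_move V E k col u c" using u c by (simp add: legal_move_iff_avail)
    have dg: "danger col col = {}" using False params by (force simp: danger_def)
    have lay: "layered col col []"
      unfolding layered_def dg using params
      by (auto simp: generated_def closed_set_def shared_nbrs_def)
    have g: "guarded [] (col(u \<mapsto> c)) {} None" by (auto simp: guarded_def)
    have fr: "\<forall>v\<in>V - dom col. \<beta>1 \<le> free_count col v" using False by (auto simp: not_less)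
    have "position 1 (col(u \<mapsto> c)) None"
      by (rule position_colour[OF p(1,2) map_le_refl fr lay g, of "{}" "{}"]) (use lm in auto)
    thus ?thesis using lm by blast
  next
    case True
    \<comment> \<open>Choosing a vertex that is short of colours guarantees that A's reply may be
      entered in \<open>MA\<close>.\<close>
    then obtain u0 where u0: "u0 \<in> V" "u0 \<notin> dom col" "free_count col u0 < \<beta>1" by auto
    have xsV: "set xs \<subseteq> V" using p(5) by (auto simp: layered_def generated_def)
    obtain u Act' where u: "u \<in> V - dom col" "u \<in> set xs \<or> u = u0"
        "\<And>c. guarded xs (col(u \<mapsto> c)) Act' None"
      using guarded_reply[OF p(6) xsV u0(1,2)] by auto
    obtain c where c: "c \<in> avail E k col u" using position_avail[OF pos, of u] u(1) by blast
    have lm: "legal_move V E k col u c" using u c by (simp add: legal_move_iff_avail)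
    have "finite MA" using p(1,8) by (intro finite_sub) auto
    moreover have "u \<notin> MA" using u(1) p(8) by blast
    ultimately have cI: "card (insert u MA) = card MA + 1" by simp
    have "position 1 (col(u \<mapsto> c)) None"
      by (rule position_colour[OF p(1-5) u(3) p(7-9) lm, of "insert u MA"])
         (use u u0 p(9) cI in auto)
    thus ?thesis using lm by blast
  qed
qed

lemma B_reply:
  assumes pos: "position 1 col None" and w: "legal_move V E k col w c"
  shows "\<exists>hit. position 2 (col(w \<mapsto> c)) hit"
proof -
  obtain col0 xs Act MA where p: "dom col \<subseteq> V" "ran col \<subseteq> {1..k}" "col0 \<subseteq>\<^sub>m col"
      "\<forall>v\<in>V - dom col0. \<beta>1 \<le> free_count col0 v" "layered col0 col xs" "guarded xs col Act None"
      "MA \<subseteq> {v \<in> V. free_count col v < \<beta>1} \<union> set xs" "MA \<subseteq> dom col"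
      "card (dom col - dom col0) \<le> 2 * card MA + 1"
    using pos by (auto simp: position_def)
  have "guarded xs (col(w \<mapsto> c)) Act (if w \<in> Act then None else up E xs w)"
    using w by (intro guarded_colour[OF p(6)]) (auto simp: legal_move_def)
  from position_colour[OF p(1-5) this p(7,8) _ w, of MA 2] show ?thesis using p(9) by auto
qed

lemma A_wins_position:
  assumes "position 2 col hit"
  shows "A_wins V E k True col"
  using assms
proof (induction "card (V - dom col)" arbitrary: col hit rule: less_induct)
  case less
  show ?case
  proof (cases "V \<subseteq> dom col")
    case True
    thus ?thesis by (rule A_wins.all_coloured)
  next
    case False
    obtain u c where u: "legal_move V E k col u c" "position 1 (col(u \<mapsto> c)) None"
      using A_reply[OF less.prems False] by auto
    have "A_wins V E k False (col(u \<mapsto> c))"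
    proof (cases "V \<subseteq> dom (col(u \<mapsto> c))")
      case True
      thus ?thesis by (rule A_wins.all_coloured)
    next
      case unf: False
      show ?thesis
      proof (rule A_wins.B_move[OF position_not_blocked[OF u(2)] unf], intro allI impI)
        fix w c' assume w: "legal_move V E k (col(u \<mapsto> c)) w c'"
        obtain hit where h: "position 2 (col(u \<mapsto> c, w \<mapsto> c')) hit" using B_reply[OF u(2) w] by auto
        have "V - dom (col(u \<mapsto> c, w \<mapsto> c')) \<subset> V - dom col"
          using u(1) by (auto simp: legal_move_def)
        hence "card (V - dom (col(u \<mapsto> c, w \<mapsto> c'))) < card (V - dom col)"
          using finV by (intro psubset_card_mono) auto
        from less.hyps[OF this h] show "A_wins V E k True (col(u \<mapsto> c, w \<mapsto> c'))" .
      qed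
    qed
    thus ?thesis using A_wins.A_move[OF position_not_blocked[OF less.prems] u(1)] by simp
  qed
qed

theorem A_wins_start: "A_wins V E k True Map.empty"
proof (rule A_wins_position)
  have full: "card (avail E k Map.empty v) = k" for v by (simp add: avail_def nbr_colours_def)
  have dg: "danger Map.empty Map.empty = {}" using params by (auto simp: danger_def full)
  have "layered Map.empty Map.empty []"
    unfolding layered_def dg using params by (auto simp: generated_def closed_set_def shared_nbrs_def)
  moreover have "guarded [] Map.empty {} None" by (auto simp: guarded_def)
  ultimately show "position 2 Map.empty None"
    unfolding position_def using params
    by (auto simp: full intro!: exI[of _ "Map.empty :: nat \<rightharpoonup> nat"] exI[of _ "[] :: nat list"] exI[of _ "{} :: nat set"])
qed

end

section \<open>Random graphs are typical\<close>

lemma sum_power_card_Pow: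
  fixes x :: real
  assumes "finite V"
  shows "(\<Sum>M\<in>Pow V. x ^ card M) = (1 + x) ^ card V"
  using prod_add[OF assms, of "\<lambda>_. x" "\<lambda>_. 1"] by (simp add: add.commute)

text \<open>The generating function of all subsets at \<open>x = m / card V\<close>, where every set
  of size at most \<open>m\<close> weighs at least \<open>x ^ m\<close>.\<close>

lemma card_small_subsets_le:
  assumes "finite V" "0 < m" "m \<le> card V"
  shows "real (card {M. M \<subseteq> V \<and> card M \<le> m}) \<le> exp (real m * (1 + ln (real (card V) / real m)))"
proof -
  let ?n = "real (card V)"
  define x where "x = real m / ?n"
  have n0: "real (card V) > 0" using assms by linarith
  have x: "0 < x" "x \<le> 1" using assms n0 by (auto simp: x_def)
  have fin: "finite {M. M \<subseteq> V \<and> card M \<le> m}" by (rule finite_subset[of _ "Pow V"]) (use assms(1) in auto)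
  have "real (card {M. M \<subseteq> V \<and> card M \<le> m}) * x ^ m = (\<Sum>M\<in>{M. M \<subseteq> V \<and> card M \<le> m}. x ^ m)" by simp
  also have "\<dots> \<le> (\<Sum>M\<in>{M. M \<subseteq> V \<and> card M \<le> m}. x ^ card M)"
    using x by (intro sum_mono power_decreasing) auto
  also have "\<dots> \<le> (\<Sum>M\<in>Pow V. x ^ card M)"
    using assms(1) x by (intro sum_mono2) auto
  also have "\<dots> = (1 + x) ^ card V" by (rule sum_power_card_Pow[OF assms(1)])
  also have "\<dots> \<le> exp x ^ card V" using x by (intro power_mono exp_ge_add_one_self) auto
  also have "\<dots> = exp (real (card V) * x)" by (rule exp_of_nat_mult[symmetric])
  also have "real (card V) * x = real m" using n0 by (simp add: x_def)
  finally have "real (card {M. M \<subseteq> V \<and> card M \<le> m}) \<le> exp (real m) / x ^ m"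
    using x by (simp add: pos_le_divide_eq)
  also have "exp (real m) / x ^ m = exp (real m) * exp (ln (?n / real m)) ^ m"
  proof -
    have "exp (ln (?n / real m)) = ?n / real m" using n0 assms by (intro exp_ln) auto
    hence "exp (ln (?n / real m)) = 1 / x" by (simp add: x_def)
    thus ?thesis by (simp add: power_one_over)
  qed
  also have "\<dots> = exp (real m * (1 + ln (?n / real m)))"
    by (simp add: distrib_left exp_add flip: exp_of_nat_mult)
  finally show ?thesis .
qed

lemma card_edge_orientations_le:
  assumes "finite E"
  shows "card {(u, v). {u, v} \<in> E} \<le> 2 * card E" "finite {(u, v). {u, v} \<in> E}"
proof -
  have two: "finite {(u, v). {u, v} = e} \<and> card {(u, v). {u, v} = e} \<le> 2" for e :: "'a set"
  proof (cases "\<exists>a b. e = {a, b}")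
    case True
    then obtain a b where e: "e = {a, b}" by auto
    have sub: "{(u, v). {u, v} = e} \<subseteq> {(a, b), (b, a)}" unfolding e by (auto simp: doubleton_eq_iff)
    have "card {(u, v). {u, v} = e} \<le> card {(a, b), (b, a)}" by (rule card_mono[OF _ sub]) simp
    also have "card {(a, b), (b, a)} \<le> 2" by (cases "a = b") auto
    finally have "card {(u, v). {u, v} = e} \<le> 2" .
    moreover have "finite {(u, v). {u, v} = e}" by (rule finite_subset[OF sub]) simp
    ultimately show ?thesis by blast
  next
    case False
    hence "{(u, v). {u, v} = e} = {}" by auto
    thus ?thesis by simp
  qed
  have eq: "{(u, v). {u, v} \<in> E} = (\<Union>e\<in>E. {(u, v). {u, v} = e})" by auto
  show "finite {(u, v). {u, v} \<in> E}" unfolding eq using assms two by blast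
  have "card {(u, v). {u, v} \<in> E} \<le> (\<Sum>e\<in>E. card {(u, v). {u, v} = e})"
    unfolding eq by (rule card_UN_le[OF assms])
  also have "\<dots> \<le> (\<Sum>e\<in>E. 2)" using two by (intro sum_mono) auto
  finally show "card {(u, v). {u, v} \<in> E} \<le> 2 * card E" by simp
qed

subsection \<open>Few vertices run out of colours\<close>

text \<open>Colour 0 stands for uncoloured. Neighbours inside \<open>T\<close> are ignored, so that
  different vertices of \<open>T\<close> depend on disjoint sets of pairs.\<close>

definition starved :: "nat \<Rightarrow> nat \<Rightarrow> nat \<Rightarrow> nat \<Rightarrow> nat set set \<Rightarrow> bool" where
  "starved n k t a E \<longleftrightarrow> (\<exists>T. T \<subseteq> {1..n} \<and> card T = t \<and> (\<exists>c \<in> {1..n} \<rightarrow>\<^sub>E {0..k}.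
     \<forall>v\<in>T. card {i \<in> {1..k}. \<forall>u\<in>{1..n} - T. c u = i \<longrightarrow> {u, v} \<notin> E} \<le> a))"

text \<open>For fixed \<open>T\<close> and \<open>c\<close> the total number of missing colours is a
  sum of independent indicators with mean at least \<open>t * \<mu>\<close>, and being starved
  pushes it to a quarter of that. The resulting tail is small enough for a union over all vertex
  sets and all colourings.\<close>

lemma starved_prob_le:
  assumes p: "0 \<le> p" "p < 1" and k: "k > 0"
    and mu: "\<mu> = real k * exp (ln (1 - p) * real n / real k)" and a: "real a \<le> \<mu> / 4"
  shows "Gnp_prob n p (starved n k t a) \<le> 2 ^ n * real (k + 1) ^ n * exp (- (real t * \<mu> / 4))"
proof -
  let ?V = "{1..n}"
  let ?I = "{T. T \<subseteq> ?V \<and> card T = t} \<times> (?V \<rightarrow>\<^sub>E {0..k})"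
  let ?X = "\<lambda>T c E v. {i \<in> {1..k}. \<forall>u\<in>?V - T. c u = i \<longrightarrow> {u, v} \<notin> E}"
  have finI: "finite ?I" by (intro finite_cartesian_product finite_PiE) auto
  have each: "Gnp_prob n p (\<lambda>E. \<forall>v\<in>T. card (?X T c E v) \<le> a) \<le> exp (- (real t * \<mu> / 4))"
    if T: "T \<subseteq> ?V" "card T = t" and c: "c \<in> ?V \<rightarrow>\<^sub>E {0..k}" for T c
  proof -
    have finT: "finite T" using T finite_subset by auto
    define B where "B = (\<lambda>(v, i). (\<lambda>u. {u, v}) ` {u \<in> ?V - T. c u = i})"
    have Xeq: "card {x \<in> T \<times> {1..k}. E \<inter> B x = {}} = (\<Sum>v\<in>T. card (?X T c E v))" for E
    proof -
      have "{x \<in> T \<times> {1..k}. E \<inter> B x = {}} = (SIGMA v:T. ?X T c E v)" by (auto simp: B_def)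
      thus ?thesis using finT by (simp add: card_SigmaI)
    qed
    have disj: "disjoint_family_on B (T \<times> {1..k})"
      unfolding disjoint_family_on_def using T by (auto simp: B_def doubleton_eq_iff)
    have sub: "B x \<subseteq> all_pairs n" if "x \<in> T \<times> {1..k}" for x
      using that T by (auto simp: B_def all_pairs_eq card_2_iff)
    have cB: "card (B (v, i)) = card {u \<in> ?V - T. c u = i}" for v i
      unfolding B_def by (simp, intro card_image) (auto simp: inj_on_def doubleton_eq_iff)
    have row: "\<mu> \<le> (\<Sum>i\<in>{1..k}. (1 - p) ^ card (B (v, i)))" for v
    proof -
      have "(\<Sum>i\<in>{1..k}. card {u \<in> ?V - T. c u = i}) = card (\<Union>i\<in>{1..k}. {u \<in> ?V - T. c u = i})"
        by (intro card_UN_disjoint[symmetric]) auto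
      also have "\<dots> \<le> card ?V" by (intro card_mono) auto
      finally have le: "real (\<Sum>i\<in>{1..k}. card (B (v, i))) \<le> real n"
        by (simp only: cB card_atLeastAtMost diff_Suc_1 of_nat_le_iff)
      have "real (card {1..k}) * exp (- (- ln (1 - p) * real n / real k)) \<le>
          (\<Sum>i\<in>{1..k}. exp (- (- ln (1 - p) * real (card (B (v, i))))))"
      proof (rule sum_exp_minus_ge)
        have "(\<Sum>i\<in>{1..k}. - ln (1 - p) * real (card (B (v, i)))) = - ln (1 - p) * real (\<Sum>i\<in>{1..k}. card (B (v, i)))"
          by (simp add: sum_distrib_left)
        also have "\<dots> \<le> - ln (1 - p) * real n" using le p by (intro mult_left_mono) auto
        also have "\<dots> = real (card {1..k}) * (- ln (1 - p) * real n / real k)" using k by simp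
        finally show "(\<Sum>i\<in>{1..k}. - ln (1 - p) * real (card (B (v, i)))) \<le>
          real (card {1..k}) * (- ln (1 - p) * real n / real k)" .
      qed simp
      also have "\<dots> = (\<Sum>i\<in>{1..k}. (1 - p) ^ card (B (v, i)))"
        using p by (intro sum.cong refl) (simp add: exp_of_nat2_mult)
      finally show ?thesis by (simp add: mu)
    qed
    have "Gnp_prob n p (\<lambda>E. \<forall>v\<in>T. card (?X T c E v) \<le> a) \<le>
        expect (all_pairs n) p (\<lambda>E. 2 ^ (a * t) * (1/2) ^ card {x \<in> T \<times> {1..k}. E \<inter> B x = {}})"
    proof (rule Gnp_prob_markov)
      fix E assume "\<forall>v\<in>T. card (?X T c E v) \<le> a"
      hence "(\<Sum>v\<in>T. card (?X T c E v)) \<le> (\<Sum>v\<in>T. a)" by (intro sum_mono) auto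
      hence le: "(\<Sum>v\<in>T. card (?X T c E v)) \<le> a * t" using T(2) by (simp add: mult.commute)
      have "1 = 2 ^ (a * t) * (1/2::real) ^ (a * t)" by (simp flip: power_mult_distrib)
      also have "\<dots> \<le> 2 ^ (a * t) * (1/2::real) ^ (\<Sum>v\<in>T. card (?X T c E v))"
        using le by (intro mult_left_mono power_decreasing) auto
      finally show "1 \<le> 2 ^ (a * t) * (1/2::real) ^ card {x \<in> T \<times> {1..k}. E \<inter> B x = {}}" unfolding Xeq .
    qed (use p in auto)
    also have "\<dots> = 2 ^ (a * t) * expect (all_pairs n) p (\<lambda>E. (1/2) ^ card {x \<in> T \<times> {1..k}. E \<inter> B x = {}})"
      by (rule expect_cmult)
    also have "\<dots> \<le> exp (real t * \<mu> / 4) * exp (- (real t * \<mu>) / 2)"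
    proof (rule mult_mono)
      have "(2::real) ^ (a * t) \<le> exp 1 ^ (a * t)" using exp_ge_add_one_self[of 1] by (intro power_mono) auto
      also have "\<dots> = exp (real a * real t)" by (simp flip: exp_of_nat_mult)
      also have "\<dots> \<le> exp (real t * \<mu> / 4)" using mult_right_mono[OF a, of "real t"] by (simp add: mult.commute)
      finally show "(2::real) ^ (a * t) \<le> exp (real t * \<mu> / 4)" .
      have "expect (all_pairs n) p (\<lambda>E. (1/2) ^ card {x \<in> T \<times> {1..k}. E \<inter> B x = {}}) \<le>
          exp (- (\<Sum>x\<in>T \<times> {1..k}. (1 - p) ^ card (B x)) / 2)"
        using finT sub disj p by (intro expect_half_power_avoided) auto
      also have "(\<Sum>x\<in>T \<times> {1..k}. (1 - p) ^ card (B x)) = (\<Sum>v\<in>T. \<Sum>i\<in>{1..k}. (1 - p) ^ card (B (v, i)))"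
        by (simp add: sum.cartesian_product)
      also have "exp (- \<dots> / 2) \<le> exp (- (real t * \<mu>) / 2)"
      proof -
        have "(\<Sum>v\<in>T. \<mu>) \<le> (\<Sum>v\<in>T. \<Sum>i\<in>{1..k}. (1 - p) ^ card (B (v, i)))" using row by (intro sum_mono)
        thus ?thesis using T(2) by simp
      qed
      finally show "expect (all_pairs n) p (\<lambda>E. (1/2) ^ card {x \<in> T \<times> {1..k}. E \<inter> B x = {}}) \<le>
         exp (- (real t * \<mu>) / 2)" .
    qed (use p in \<open>auto intro!: expect_nonneg\<close>)
    also have "\<dots> = exp (- (real t * \<mu> / 4))" by (simp flip: exp_add)
    finally show ?thesis .
  qed
  have "Gnp_prob n p (starved n k t a) \<le> Gnp_prob n p (\<lambda>E. \<exists>x\<in>?I. case x of (T, c) \<Rightarrow> \<forall>v\<in>T. card (?X T c E v) \<le> a)"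
    using p by (intro Gnp_prob_mono) (auto simp: starved_def)
  also have "\<dots> \<le> (\<Sum>x\<in>?I. Gnp_prob n p (\<lambda>E. case x of (T, c) \<Rightarrow> \<forall>v\<in>T. card (?X T c E v) \<le> a))"
    using p finI by (intro Gnp_prob_Bex_le) auto
  also have "\<dots> \<le> (\<Sum>x\<in>?I. exp (- (real t * \<mu> / 4)))"
    using each by (intro sum_mono) auto
  also have "\<dots> = real (card ?I) * exp (- (real t * \<mu> / 4))" by simp
  also have "\<dots> \<le> 2 ^ n * real (k + 1) ^ n * exp (- (real t * \<mu> / 4))"
  proof (rule mult_right_mono)
    have "card {T. T \<subseteq> ?V \<and> card T = t} \<le> card (Pow ?V)" by (intro card_mono) auto
    hence "card {T. T \<subseteq> ?V \<and> card T = t} \<le> 2 ^ n" by (simp add: card_Pow)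
    moreover have "card (?V \<rightarrow>\<^sub>E {0..k}) = (k + 1) ^ n" by (simp add: card_PiE)
    ultimately have "card ?I \<le> 2 ^ n * (k + 1) ^ n" unfolding card_cartesian_product by (metis mult_le_mono1)
    hence "real (card ?I) \<le> real (2 ^ n * (k + 1) ^ n)" by (simp only: of_nat_le_iff)
    thus "real (card ?I) \<le> 2 ^ n * real (k + 1) ^ n" by simp
  qed simp
  finally show ?thesis .
qed

subsection \<open>Few vertices are strongly attached to a small set\<close>

definition overattached :: "nat \<Rightarrow> nat \<Rightarrow> nat \<Rightarrow> nat \<Rightarrow> nat set set \<Rightarrow> bool" where
  "overattached n m s \<xi> E \<longleftrightarrow> (\<exists>M. M \<subseteq> {1..n} \<and> card M \<le> m \<and>
     (\<exists>S. S \<subseteq> {1..n} \<and> card S = s \<and> (\<forall>v\<in>S. \<xi> \<le> card (nbrs E v \<inter> M))))"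

text \<open>\<open>M\<close> and \<open>S\<close> may overlap, so an edge can be counted from both
  ends, whence \<open>\<xi> * s / 2\<close>. The rest is Markov's inequality for
  \<open>exp 1\<close> to the number of edges between \<open>M\<close> and \<open>S\<close>.\<close>

lemma overattached_prob_le:
  assumes p: "0 \<le> p" "p \<le> 1" and m: "0 < m" "m \<le> n" and s: "0 < s" "s \<le> n"
  shows "Gnp_prob n p (overattached n m s \<xi>) \<le>
    exp (real m * (1 + ln (real n / real m)) + real s * (1 + ln (real n / real s)) +
         2 * p * real m * real s - real \<xi> * real s / 2)"
proof -
  let ?V = "{1..n}"
  let ?Ms = "{M. M \<subseteq> ?V \<and> card M \<le> m}" and ?Ss = "{S. S \<subseteq> ?V \<and> card S = s}"
  let ?b = "exp (2 * p * real m * real s - real \<xi> * real s / 2)"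
  have fin: "finite ?Ms" "finite ?Ss" "finite {S. S \<subseteq> ?V \<and> card S \<le> s}" by auto
  have each: "Gnp_prob n p (\<lambda>E. \<forall>v\<in>S. \<xi> \<le> card (nbrs E v \<inter> M)) \<le> ?b"
    if M: "M \<subseteq> ?V" "card M \<le> m" and S: "S \<subseteq> ?V" "card S = s" for M S
  proof -
    have finMS: "finite M" "finite S" using M S finite_subset by auto
    define Q where "Q = {e \<in> all_pairs n. \<exists>u\<in>M. \<exists>v\<in>S. e = {u, v}}"
    have finQ: "finite Q" by (simp add: Q_def)
    have "Q \<subseteq> (\<lambda>(u, v). {u, v}) ` (M \<times> S)" by (auto simp: Q_def)
    hence "card Q \<le> card ((\<lambda>(u, v). {u, v}) ` (M \<times> S))" using finMS by (intro card_mono) auto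
    also have "\<dots> \<le> card (M \<times> S)" using finMS by (intro card_image_le) auto
    also have "\<dots> \<le> m * s" using M S by (simp add: card_cartesian_product)
    finally have cQ: "real (card Q) \<le> real m * real s" by (metis of_nat_le_iff of_nat_mult)
    have "Gnp_prob n p (\<lambda>E. \<forall>v\<in>S. \<xi> \<le> card (nbrs E v \<inter> M)) \<le>
        expect (all_pairs n) p (\<lambda>E. exp (- (real \<xi> * real s / 2)) * exp 1 ^ card (E \<inter> Q))"
    proof (rule Gnp_prob_markov)
      fix E assume E: "E \<subseteq> all_pairs n" "\<forall>v\<in>S. \<xi> \<le> card (nbrs E v \<inter> M)"
      have finE: "finite (E \<inter> Q)" using finQ by simp
      have fN: "finite (nbrs E v \<inter> M)" for v using finMS by simp
      have "s * \<xi> = (\<Sum>v\<in>S. \<xi>)" using S by simp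
      also have "\<dots> \<le> (\<Sum>v\<in>S. card (nbrs E v \<inter> M))" using E by (intro sum_mono) auto
      also have "\<dots> = card (SIGMA v:S. nbrs E v \<inter> M)" using finMS by (simp add: card_SigmaI)
      also have "\<dots> \<le> card {(u, v). {u, v} \<in> E \<inter> Q}"
      proof (rule card_mono)
        show "(SIGMA v:S. nbrs E v \<inter> M) \<subseteq> {(u, v). {u, v} \<in> E \<inter> Q}"
          using E by (auto simp: nbrs_def Q_def insert_commute)
      qed (rule card_edge_orientations_le(2)[OF finE])
      also have "\<dots> \<le> 2 * card (E \<inter> Q)" by (rule card_edge_orientations_le(1)[OF finE])
      finally have "real s * real \<xi> \<le> 2 * real (card (E \<inter> Q))" by (metis of_nat_le_iff of_nat_mult of_nat_numeral)
      hence "0 \<le> - (real \<xi> * real s / 2) + real (card (E \<inter> Q))" by (simp add: mult.commute)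
      hence "1 \<le> exp (- (real \<xi> * real s / 2) + real (card (E \<inter> Q)))" by simp
      also have "\<dots> = exp (- (real \<xi> * real s / 2)) * exp 1 ^ card (E \<inter> Q)"
        by (simp flip: exp_add exp_of_nat_mult)
      finally show "1 \<le> exp (- (real \<xi> * real s / 2)) * exp 1 ^ card (E \<inter> Q)" .
    qed (use p in auto)
    also have "\<dots> = exp (- (real \<xi> * real s / 2)) * (1 + p * (exp 1 - 1)) ^ card Q"
    proof -
      have "expect (all_pairs n) p (\<lambda>E. exp 1 ^ card (E \<inter> Q)) = expect Q p (\<lambda>E. exp 1 ^ card E)"
        by (rule expect_restrict) (auto simp: Q_def)
      thus ?thesis using finQ by (simp add: expect_cmult expect_power_card)
    qed
    also have "\<dots> \<le> exp (- (real \<xi> * real s / 2)) * exp (2 * p * real m * real s)"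
    proof (rule mult_left_mono)
      have e3: "exp 1 - 1 \<le> (2::real)" using exp_le by simp
      have e0: "0 \<le> exp 1 - (1::real)" by simp
      have "1 + p * (exp 1 - 1) \<le> 1 + 2 * p" using mult_left_mono[OF e3 p(1)] by simp
      also have "\<dots> \<le> exp (2 * p)" by (rule exp_ge_add_one_self)
      finally have "(1 + p * (exp 1 - 1)) ^ card Q \<le> exp (2 * p) ^ card Q"
        using p e0 by (intro power_mono) auto
      also have "\<dots> = exp (2 * p * real (card Q))" by (simp add: exp_of_nat2_mult)
      also have "\<dots> \<le> exp (2 * p * real m * real s)"
        using mult_left_mono[OF cQ, of "2 * p"] p by (simp add: mult.assoc)
      finally show "(1 + p * (exp 1 - 1)) ^ card Q \<le> exp (2 * p * real m * real s)" .
    qed simp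
    also have "\<dots> = ?b" by (simp flip: exp_add)
    finally show ?thesis .
  qed
  have "Gnp_prob n p (overattached n m s \<xi>) \<le>
      Gnp_prob n p (\<lambda>E. \<exists>x\<in>?Ms \<times> ?Ss. case x of (M, S) \<Rightarrow> \<forall>v\<in>S. \<xi> \<le> card (nbrs E v \<inter> M))"
    using p by (intro Gnp_prob_mono) (auto simp: overattached_def)
  also have "\<dots> \<le> (\<Sum>x\<in>?Ms \<times> ?Ss. Gnp_prob n p (\<lambda>E. case x of (M, S) \<Rightarrow> \<forall>v\<in>S. \<xi> \<le> card (nbrs E v \<inter> M)))"
    using p fin by (intro Gnp_prob_Bex_le) auto
  also have "\<dots> \<le> (\<Sum>x\<in>?Ms \<times> ?Ss. ?b)" using each by (intro sum_mono) auto
  also have "\<dots> = real (card ?Ms) * real (card ?Ss) * ?b" by (simp add: card_cartesian_product)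
  also have "\<dots> \<le> exp (real m * (1 + ln (real n / real m))) * exp (real s * (1 + ln (real n / real s))) * ?b"
  proof (intro mult_mono)
    show "real (card ?Ms) \<le> exp (real m * (1 + ln (real n / real m)))"
      using card_small_subsets_le[of ?V m] m by simp
    have "card ?Ss \<le> card {S. S \<subseteq> ?V \<and> card S \<le> s}" by (intro card_mono fin) auto
    thus "real (card ?Ss) \<le> exp (real s * (1 + ln (real n / real s)))"
      using card_small_subsets_le[of ?V s] s by simp
  qed auto
  also have "\<dots> = exp (real m * (1 + ln (real n / real m)) + real s * (1 + ln (real n / real s)) +
         2 * p * real m * real s - real \<xi> * real s / 2)" by (simp flip: exp_add add: algebra_simps)
  finally show ?thesis .
qed

subsection \<open>Small sets share few neighbours\<close>

definition entangled :: "nat \<Rightarrow> nat \<Rightarrow> nat \<Rightarrow> nat set set \<Rightarrow> bool" where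
  "entangled n z b E \<longleftrightarrow> (\<exists>Z. Z \<subseteq> {1..n} \<and> card Z = z \<and>
     z \<le> 2 * card {v \<in> Z. b \<le> card (shared_nbrs E Z v)})"

abbreviation pow_ge_two :: "real \<Rightarrow> 'a set \<Rightarrow> real" where
  "pow_ge_two x S \<equiv> if 2 \<le> card S then x ^ card S else 1"

text \<open>A vertex with at most one neighbour in the set shares nothing and gets weight 1. This
  removes the linear term in \<open>y = card B * p * x\<close>; summed over \<open>n\<close>
  vertices, the quadratic term that remains is still affordable.\<close>

lemma expect_ge_two_le:
  assumes p: "0 \<le> p" "p \<le> 1" and x: "1 \<le> x" and fin: "finite B" and small: "real (card B) * p * x \<le> 1"
  shows "expect B p (pow_ge_two x) \<le> exp ((real (card B) * p * x)\<^sup>2)"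
proof -
  let ?y = "real (card B) * p * x"
  have "expect B p (pow_ge_two x) \<le>
      expect B p (\<lambda>S. 1 + (if 2 \<le> card S then x ^ card S else 0))"
    using p x by (intro expect_mono) auto
  also have "\<dots> = 1 + expect B p (\<lambda>S. if 2 \<le> card S then x ^ card S else 0)"
    using fin by (simp add: expect_add)
  also have "expect B p (\<lambda>S. if 2 \<le> card S then x ^ card S else 0) \<le>
      (\<Sum>S\<in>Pow B. if 2 \<le> card S then (p * x) ^ card S else 0)"
    unfolding expect_def
  proof (rule sum_mono)
    fix S
    have "p ^ card S * (1 - p) ^ card (B - S) * x ^ card S \<le> p ^ card S * 1 * x ^ card S"
      using p x by (intro mult_right_mono mult_left_mono power_le_one) auto
    thus "p ^ card S * (1 - p) ^ card (B - S) * (if 2 \<le> card S then x ^ card S else 0) \<le>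
        (if 2 \<le> card S then (p * x) ^ card S else 0)" by (auto simp: power_mult_distrib)
  qed
  also have "(\<Sum>S\<in>Pow B. if 2 \<le> card S then (p * x) ^ card S else 0) =
      (\<Sum>S\<in>Pow B. (p * x) ^ card S) - (\<Sum>S\<in>Pow B. if 2 \<le> card S then 0 else (p * x) ^ card S)"
    by (simp add: sum_subtractf[symmetric] if_distrib cong: if_cong)
  also have "(\<Sum>S\<in>Pow B. (p * x) ^ card S) = (1 + p * x) ^ card B" by (rule sum_power_card_Pow[OF fin])
  also have "\<dots> \<le> exp (p * x) ^ card B" using p x by (intro power_mono exp_ge_add_one_self) auto
  also have "\<dots> = exp ?y" by (simp add: mult.assoc flip: exp_of_nat_mult)
  also have "\<dots> \<le> 1 + ?y + ?y\<^sup>2" using p x small by (intro exp_bound) auto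
  \<comment> \<open>The empty set and the singletons alone produce the first two terms of the
    exponential series.\<close>
  also have "1 + ?y \<le> (\<Sum>S\<in>Pow B. if 2 \<le> card S then 0 else (p * x) ^ card S)"
  proof -
    have "1 + ?y = (\<Sum>S\<in>insert {} ((\<lambda>e. {e}) ` B). (p * x) ^ card S)"
      using fin by (subst sum.insert) (auto simp: sum.reindex mult.assoc)
    also have "\<dots> = (\<Sum>S\<in>insert {} ((\<lambda>e. {e}) ` B). if 2 \<le> card S then 0 else (p * x) ^ card S)"
      by (intro sum.cong) auto
    also have "\<dots> \<le> (\<Sum>S\<in>Pow B. if 2 \<le> card S then 0 else (p * x) ^ card S)"
      using fin p x by (intro sum_mono2) auto
    finally show ?thesis .
  qed
  finally have "expect B p (pow_ge_two x) \<le> 1 + ?y\<^sup>2" by simp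
  also have "\<dots> \<le> exp (?y\<^sup>2)" by (rule exp_ge_add_one_self)
  finally show ?thesis .
qed

abbreviation doubly_attached :: "nat set set \<Rightarrow> nat set \<Rightarrow> nat \<Rightarrow> nat" where
  "doubly_attached E Z w \<equiv> if 2 \<le> card (nbrs E w \<inter> Z) then card (nbrs E w \<inter> Z) else 0"

text \<open>Double counting of pairs of a vertex \<open>v\<close> of \<open>Z\<close> and a
  neighbour \<open>w\<close> it shares: if \<open>w\<close> is in \<open>Z\<close>, the pair is an
  oriented edge inside \<open>Z\<close>; otherwise \<open>w\<close> has two neighbours in
  \<open>Z\<close>. The outer factor 2 is there because only half of \<open>Z\<close> need share
  \<open>b\<close> neighbours.\<close>

lemma shared_nbrs_count:
  assumes E: "E \<subseteq> all_pairs n" and Z: "Z \<subseteq> {1..n}" "card Z \<le> 2 * card {v \<in> Z. b \<le> card (shared_nbrs E Z v)}"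
  shows "card Z * b \<le> 2 * (2 * card {e \<in> E. e \<subseteq> Z} +
    (\<Sum>w\<in>{1..n} - Z. doubly_attached E Z w))"
proof -
  let ?A = "{v \<in> Z. b \<le> card (shared_nbrs E Z v)}"
  let ?W = "{w \<in> {1..n} - Z. 2 \<le> card (nbrs E w \<inter> Z)}"
  have finZ: "finite Z" using Z finite_subset by auto
  have finE: "finite {e \<in> E. e \<subseteq> Z}" using finite_subset[OF E] by auto
  have sub: "shared_nbrs E Z v \<subseteq> {1..n}" for v
    using E by (auto simp: shared_nbrs_def nbrs_def all_pairs_eq)
  have "card ?A * b = (\<Sum>v\<in>?A. b)" by simp
  also have "\<dots> \<le> (\<Sum>v\<in>?A. card (shared_nbrs E Z v))" by (intro sum_mono) auto
  also have "\<dots> \<le> (\<Sum>v\<in>Z. card (shared_nbrs E Z v))" using finZ by (intro sum_mono2) auto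
  also have "\<dots> = card (SIGMA v:Z. shared_nbrs E Z v)"
    using finZ finite_subset[OF sub] by (subst card_SigmaI) auto
  also have "\<dots> \<le> card ({(u, v). {u, v} \<in> {e \<in> E. e \<subseteq> Z}} \<union> prod.swap ` (SIGMA w:?W. nbrs E w \<inter> Z))"
  proof (rule card_mono)
    show "finite ({(u, v). {u, v} \<in> {e \<in> E. e \<subseteq> Z}} \<union> prod.swap ` (SIGMA w:?W. nbrs E w \<inter> Z))"
      using card_edge_orientations_le(2)[OF finE] finZ by auto
    show "(SIGMA v:Z. shared_nbrs E Z v) \<subseteq>
       {(u, v). {u, v} \<in> {e \<in> E. e \<subseteq> Z}} \<union> prod.swap ` (SIGMA w:?W. nbrs E w \<inter> Z)"
    proof (rule subsetI, clarify)
      fix v w assume v: "v \<in> Z" and w: "w \<in> shared_nbrs E Z v"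
        and no: "(v, w) \<notin> prod.swap ` (SIGMA w:?W. nbrs E w \<inter> Z)"
      have vw: "{v, w} \<in> E" using w by (auto simp: shared_nbrs_def nbrs_def insert_commute)
      obtain z where z: "z \<in> Z" "z \<noteq> v" "w \<in> nbrs E z" using w by (auto simp: shared_nbrs_def)
      have mem: "{v, z} \<subseteq> nbrs E w \<inter> Z" using v z vw by (auto simp: nbrs_def insert_commute)
      have "card {v, z} \<le> card (nbrs E w \<inter> Z)" using finZ by (intro card_mono mem) auto
      hence "2 \<le> card (nbrs E w \<inter> Z)" using z by simp
      moreover have "(v, w) = prod.swap (w, v)" by simp
      ultimately have "w \<in> Z" using no mem w sub by blast
      thus "{v, w} \<in> E \<and> {v, w} \<subseteq> Z" using v vw by auto
    qed
  qed
  also have "\<dots> \<le> card {(u, v). {u, v} \<in> {e \<in> E. e \<subseteq> Z}} + card (prod.swap ` (SIGMA w:?W. nbrs E w \<inter> Z))"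
    by (rule card_Un_le)
  also have "\<dots> \<le> 2 * card {e \<in> E. e \<subseteq> Z} + card (SIGMA w:?W. nbrs E w \<inter> Z)"
    using card_edge_orientations_le(1)[OF finE] finZ by (intro add_mono card_image_le) auto
  also have "card (SIGMA w:?W. nbrs E w \<inter> Z) = (\<Sum>w\<in>?W. card (nbrs E w \<inter> Z))"
    using finZ by (subst card_SigmaI) auto
  also have "\<dots> = (\<Sum>w\<in>{1..n} - Z. doubly_attached E Z w)"
    by (rule sum.inter_filter) auto
  finally have "card ?A * b \<le> 2 * card {e \<in> E. e \<subseteq> Z} +
    (\<Sum>w\<in>{1..n} - Z. doubly_attached E Z w)" .
  moreover have "card Z * b \<le> 2 * (card ?A * b)" using mult_right_mono[OF Z(2), of b] by simp
  ultimately show ?thesis by (meson le_trans mult_le_mono2)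
qed

text \<open>Exponential moment, with base \<open>x\<close>, of the bound in
  \<open>shared_nbrs_count\<close>. Edges inside \<open>Z\<close> get weight \<open>x^2\<close>
  since they count twice; the stars from the outer vertices to \<open>Z\<close> are disjoint from
  them and from each other, so the moment factorises.\<close>

lemma entangled_prob_le:
  assumes p: "0 \<le> p" "p \<le> 1" and z: "0 < z" "z \<le> n" and x: "1 \<le> x" and small: "real z * p * x \<le> 1"
  shows "Gnp_prob n p (entangled n z b) \<le>
    exp (real z * (1 + ln (real n / real z)) + p * x\<^sup>2 * (real z)\<^sup>2 + real n * (real z * p * x)\<^sup>2
      - real z * real b / 2 * ln x)"
proof -
  let ?V = "{1..n}"
  let ?Zs = "{Z. Z \<subseteq> ?V \<and> card Z = z}"
  let ?b = "exp (p * x\<^sup>2 * (real z)\<^sup>2 + real n * (real z * p * x)\<^sup>2 - real z * real b / 2 * ln x)"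
  have fin: "finite ?Zs" "finite {S. S \<subseteq> ?V \<and> card S \<le> z}" by auto
  have each: "Gnp_prob n p (\<lambda>E. z \<le> 2 * card {v \<in> Z. b \<le> card (shared_nbrs E Z v)}) \<le> ?b"
    if Z: "Z \<subseteq> ?V" "card Z = z" for Z
  proof -
    have finZ: "finite Z" using Z finite_subset by auto
    define Q where "Q = {e \<in> all_pairs n. e \<subseteq> Z}"
    define B where "B = case_option Q (\<lambda>w. (\<lambda>u. {u, w}) ` Z)"
    define F where "F = case_option (\<lambda>S :: nat set set. (x\<^sup>2) ^ card S)
       (\<lambda>(w::nat) S. if 2 \<le> card S then x ^ card S else 1)"
    let ?I = "insert None (Some ` (?V - Z))"
    have finQ: "finite Q" by (simp add: Q_def)
    have cB: "card ((\<lambda>u. {u, w}) ` Z) = z" if "w \<notin> Z" for w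
      using Z(2) that by (subst card_image) (auto simp: inj_on_def doubleton_eq_iff)
    have gN: "card (E \<inter> (\<lambda>u. {u, w}) ` Z) = card (nbrs E w \<inter> Z)" if "w \<notin> Z" for E w
    proof -
      have "E \<inter> (\<lambda>u. {u, w}) ` Z = (\<lambda>u. {u, w}) ` (nbrs E w \<inter> Z)" by (auto simp: nbrs_def)
      thus ?thesis using that by (simp add: card_image inj_on_def doubleton_eq_iff)
    qed
    have cQ: "real (card Q) \<le> (real z)\<^sup>2"
    proof -
      have "Q \<subseteq> (\<lambda>(u, v). {u, v}) ` (Z \<times> Z)" by (auto simp: Q_def all_pairs_eq card_2_iff)
      hence "card Q \<le> card ((\<lambda>(u, v). {u, v}) ` (Z \<times> Z))" using finZ by (intro card_mono) auto
      also have "\<dots> \<le> card (Z \<times> Z)" using finZ by (intro card_image_le) auto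
      also have "\<dots> = z * z" using Z by (simp add: card_cartesian_product)
      finally have "real (card Q) \<le> real (z * z)" by (simp only: of_nat_le_iff)
      thus ?thesis by (simp add: power2_eq_square)
    qed
    have disj: "disjoint_family_on B ?I"
      unfolding disjoint_family_on_def B_def by (auto simp: Q_def doubleton_eq_iff split: option.splits)
    have sub: "B i \<subseteq> all_pairs n" if "i \<in> ?I" for i
    proof (cases i)
      case None
      thus ?thesis unfolding B_def Q_def by simp
    next
      case (Some w)
      hence "w \<in> ?V - Z" using that by auto
      thus ?thesis using Some Z(1) by (auto simp: B_def all_pairs_eq card_insert_if)
    qed
    have "Gnp_prob n p (\<lambda>E. z \<le> 2 * card {v \<in> Z. b \<le> card (shared_nbrs E Z v)}) \<le>
        expect (all_pairs n) p (\<lambda>E. exp (- (real z * real b / 2 * ln x)) * (\<Prod>i\<in>?I. F i (E \<inter> B i)))"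
    proof (rule Gnp_prob_markov)
      fix E assume E: "E \<subseteq> all_pairs n" "z \<le> 2 * card {v \<in> Z. b \<le> card (shared_nbrs E Z v)}"
      let ?Y = "\<Sum>w\<in>?V - Z. doubly_attached E Z w"
      have EQ: "E \<inter> Q = {e \<in> E. e \<subseteq> Z}" using E by (auto simp: Q_def)
      have "z * b \<le> 2 * (2 * card (E \<inter> Q) + ?Y)"
        using shared_nbrs_count[OF E(1) Z(1), of b] E(2) Z(2) unfolding EQ by simp
      hence "real (z * b) \<le> real (2 * (2 * card (E \<inter> Q) + ?Y))" by (simp only: of_nat_le_iff)
      hence "real z * real b \<le> 2 * real (2 * card (E \<inter> Q) + ?Y)" by (simp only: of_nat_mult of_nat_numeral)
      moreover have "a / 2 \<le> c" if "a \<le> 2 * c" for a c :: real using that by simp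
      ultimately have "real z * real b / 2 \<le> real (2 * card (E \<inter> Q) + ?Y)" by blast
      hence "real z * real b / 2 * ln x \<le> real (2 * card (E \<inter> Q) + ?Y) * ln x"
        using x by (intro mult_right_mono) auto
      hence "1 \<le> exp (- (real z * real b / 2 * ln x)) * exp (real (2 * card (E \<inter> Q) + ?Y) * ln x)"
        by (simp flip: exp_add)
      also have "exp (real (2 * card (E \<inter> Q) + ?Y) * ln x) = x ^ (2 * card (E \<inter> Q) + ?Y)"
        using x by (simp only: exp_of_nat_mult exp_ln)
      also have "\<dots> = (x\<^sup>2) ^ card (E \<inter> Q) * (\<Prod>w\<in>?V - Z. x ^ doubly_attached E Z w)"
        by (simp add: power_add power_mult power_sum)
      also have "(\<Prod>w\<in>?V - Z. x ^ doubly_attached E Z w) =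
          (\<Prod>w\<in>?V - Z. F (Some w) (E \<inter> B (Some w)))"
        by (intro prod.cong refl) (auto simp: F_def B_def gN)
      also have "(x\<^sup>2) ^ card (E \<inter> Q) * \<dots> = (\<Prod>i\<in>?I. F i (E \<inter> B i))"
        by (simp add: prod.reindex F_def B_def)
      finally show "1 \<le> exp (- (real z * real b / 2 * ln x)) * (\<Prod>i\<in>?I. F i (E \<inter> B i))" .
    qed (use p x in \<open>auto intro!: prod_nonneg mult_nonneg_nonneg simp: F_def split: option.splits\<close>)
    also have "\<dots> = exp (- (real z * real b / 2 * ln x)) * (\<Prod>i\<in>?I. expect (B i) p (F i))"
      using disj sub by (simp only: expect_cmult) (subst expect_prod, auto)
    also have "(\<Prod>i\<in>?I. expect (B i) p (F i)) =
        expect Q p (\<lambda>S. (x\<^sup>2) ^ card S) *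
        (\<Prod>w\<in>?V - Z. expect ((\<lambda>u. {u, w}) ` Z) p (pow_ge_two x))"
      by (simp add: prod.reindex F_def B_def)
    also have "\<dots> \<le> exp (p * x\<^sup>2 * (real z)\<^sup>2) * exp (real n * (real z * p * x)\<^sup>2)"
    proof (rule mult_mono)
      have "expect Q p (\<lambda>S. (x\<^sup>2) ^ card S) = (1 + p * (x\<^sup>2 - 1)) ^ card Q"
        by (rule expect_power_card[OF finQ])
      also have "\<dots> \<le> exp (p * x\<^sup>2) ^ card Q"
      proof (rule power_mono)
        have "1 + p * (x\<^sup>2 - 1) \<le> 1 + p * x\<^sup>2" using p by (simp add: algebra_simps)
        also have "\<dots> \<le> exp (p * x\<^sup>2)" by (rule exp_ge_add_one_self)
        finally show "1 + p * (x\<^sup>2 - 1) \<le> exp (p * x\<^sup>2)" .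
        have "1 \<le> x\<^sup>2" using x by simp
        thus "0 \<le> 1 + p * (x\<^sup>2 - 1)" using p by simp
      qed
      also have "\<dots> = exp (p * x\<^sup>2 * real (card Q))" by (rule exp_of_nat2_mult[symmetric])
      also have "\<dots> \<le> exp (p * x\<^sup>2 * (real z)\<^sup>2)" using mult_left_mono[OF cQ, of "p * x\<^sup>2"] p by simp
      finally show "expect Q p (\<lambda>S. (x\<^sup>2) ^ card S) \<le> exp (p * x\<^sup>2 * (real z)\<^sup>2)" .
      have "(\<Prod>w\<in>?V - Z. expect ((\<lambda>u. {u, w}) ` Z) p (pow_ge_two x)) \<le>
          (\<Prod>w\<in>?V - Z. exp ((real z * p * x)\<^sup>2))"
      proof (intro prod_mono conjI)
        fix w assume w: "w \<in> ?V - Z"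
        show "0 \<le> expect ((\<lambda>u. {u, w}) ` Z) p (pow_ge_two x)"
          using p x by (intro expect_nonneg) auto
        show "expect ((\<lambda>u. {u, w}) ` Z) p (pow_ge_two x) \<le> exp ((real z * p * x)\<^sup>2)"
          using expect_ge_two_le[OF p x, of "(\<lambda>u. {u, w}) ` Z"] cB[of w] w finZ small by simp
      qed
      also have "\<dots> = exp (real (card (?V - Z)) * (real z * p * x)\<^sup>2)" by (simp add: exp_of_nat_mult)
      also have "\<dots> \<le> exp (real n * (real z * p * x)\<^sup>2)"
      proof -
        have "card (?V - Z) \<le> card ?V" by (intro card_mono) auto
        hence "real (card (?V - Z)) \<le> real n" by simp
        from mult_right_mono[OF this, of "(real z * p * x)\<^sup>2"] show ?thesis by simp
      qed
      finally show "(\<Prod>w\<in>?V - Z. expect ((\<lambda>u. {u, w}) ` Z) p (pow_ge_two x)) \<le>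
          exp (real n * (real z * p * x)\<^sup>2)" .
    qed (use p x in \<open>auto intro!: prod_nonneg expect_nonneg\<close>)
    also have "exp (- (real z * real b / 2 * ln x)) * (exp (p * x\<^sup>2 * (real z)\<^sup>2) * exp (real n * (real z * p * x)\<^sup>2)) = ?b"
      by (simp flip: exp_add)
    finally show ?thesis by simp
  qed
  have "Gnp_prob n p (entangled n z b) \<le>
      Gnp_prob n p (\<lambda>E. \<exists>Z\<in>?Zs. z \<le> 2 * card {v \<in> Z. b \<le> card (shared_nbrs E Z v)})"
    using p by (intro Gnp_prob_mono) (auto simp: entangled_def)
  also have "\<dots> \<le> (\<Sum>Z\<in>?Zs. Gnp_prob n p (\<lambda>E. z \<le> 2 * card {v \<in> Z. b \<le> card (shared_nbrs E Z v)}))"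
    using p fin by (intro Gnp_prob_Bex_le) auto
  also have "\<dots> \<le> (\<Sum>Z\<in>?Zs. ?b)" using each by (intro sum_mono) auto
  also have "\<dots> = real (card ?Zs) * ?b" by simp
  also have "\<dots> \<le> exp (real z * (1 + ln (real n / real z))) * ?b"
  proof (rule mult_right_mono)
    have "card ?Zs \<le> card {S. S \<subseteq> ?V \<and> card S \<le> z}" by (intro card_mono fin) auto
    thus "real (card ?Zs) \<le> exp (real z * (1 + ln (real n / real z)))"
      using card_small_subsets_le[of ?V z] z by simp
  qed simp
  also have "\<dots> = exp (real z * (1 + ln (real n / real z)) + (p * x\<^sup>2 * (real z)\<^sup>2 + real n * (real z * p * x)\<^sup>2
      - real z * real b / 2 * ln x))" by (rule exp_add[symmetric])
  finally show ?thesis by (simp only: add_diff_eq add.assoc)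
qed

section \<open>Typical graphs satisfy the hypotheses of the strategy\<close>

lemma typical_sparse_game:
  assumes E: "E \<subseteq> all_pairs n"
    and s1: "\<not> starved n k t (2 * \<beta>1) E" and s2: "\<not> overattached n m1 (g2 + 1) \<xi> E"
    and s3: "\<And>z. 0 < z \<Longrightarrow> z \<le> 2 * g2 \<Longrightarrow> \<not> entangled n z b E"
    and params: "\<beta>2 + \<xi> \<le> \<beta>1" "2 * b + 3 \<le> \<beta>2" "1 \<le> b" "2 * (2 * t + 2 * g2) + 3 \<le> m1" "\<beta>1 \<le> k" "g2 < t"
  shows "sparse_game {1..n} E k \<beta>1 \<beta>2 b \<xi> (2 * t) g2 m1"
proof
  let ?V = "{1..n}"
  show "finite ?V" by simp
  show "u \<in> ?V \<and> v \<in> ?V \<and> u \<noteq> v" if "{u, v} \<in> E" for u v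
    using that E by (auto simp: all_pairs_eq card_2_iff doubleton_eq_iff)
  show att: "card {v \<in> ?V. \<xi> \<le> card (nbrs E v \<inter> M)} \<le> g2" if M: "M \<subseteq> ?V" "card M \<le> m1" for M
  proof (rule ccontr)
    assume "\<not> ?thesis"
    hence "g2 + 1 \<le> card {v \<in> ?V. \<xi> \<le> card (nbrs E v \<inter> M)}" by simp
    then obtain S where S: "S \<subseteq> {v \<in> ?V. \<xi> \<le> card (nbrs E v \<inter> M)}" "card S = g2 + 1"
      by (meson obtain_subset_with_card_n)
    hence "overattached n m1 (g2 + 1) \<xi> E" unfolding overattached_def using M by blast
    thus False using s2 by simp
  qed
  show "2 * card {v \<in> Z. b \<le> card (shared_nbrs E Z v)} < card Z"
    if Z: "Z \<subseteq> ?V" "Z \<noteq> {}" "card Z \<le> 2 * g2" for Z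
  proof (rule ccontr)
    assume n: "\<not> ?thesis"
    have "finite Z" by (rule finite_subset[OF Z(1)]) simp
    hence "0 < card Z" using Z(2) by (simp add: card_gt_0_iff)
    hence "\<not> entangled n (card Z) b E" using s3 Z by blast
    thus False using n Z(1) unfolding entangled_def by (simp add: not_less)
  qed
  show "card {v \<in> ?V. card (avail E k col v) < \<beta>1} \<le> 2 * t"
    if col: "dom col \<subseteq> ?V" "ran col \<subseteq> {1..k}" for col
  proof (rule ccontr)
    assume "\<not> ?thesis"
    hence "2 * t + 1 \<le> card {v \<in> ?V. card (avail E k col v) < \<beta>1}" by simp
    then obtain S where S: "S \<subseteq> {v \<in> ?V. card (avail E k col v) < \<beta>1}" "card S = 2 * t + 1"
      by (meson obtain_subset_with_card_n)
    have SV: "S \<subseteq> ?V" using S by auto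
    have finS: "finite S" by (rule finite_subset[OF SV]) simp
    \<comment> \<open>At most \<open>g2\<close> vertices of \<open>S\<close> have
      \<open>\<xi>\<close> neighbours inside \<open>S\<close>, and these are discarded. For the
      others, ignoring the colours inside \<open>T\<close> restores fewer than \<open>\<xi>\<close>
      colours, which at most doubles the threshold \<open>\<beta>1\<close>.\<close>
    let ?R = "{v \<in> ?V. \<xi> \<le> card (nbrs E v \<inter> S)}"
    have "card ?R \<le> g2" using params S(2) by (intro att[OF SV]) simp
    moreover have "card S - card ?R \<le> card (S - ?R)" by (intro diff_card_le_card_Diff) simp
    ultimately have "t \<le> card (S - ?R)" using S(2) params by linarith
    then obtain T where T: "T \<subseteq> S - ?R" "card T = t" by (meson obtain_subset_with_card_n)
    have TV: "T \<subseteq> ?V" using T SV by auto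
    define c where "c = (\<lambda>u\<in>?V. case col u of None \<Rightarrow> 0 | Some i \<Rightarrow> i)"
    have cP: "c \<in> ?V \<rightarrow>\<^sub>E {0..k}"
    proof (rule PiE_I)
      fix u assume "u \<in> ?V"
      thus "c u \<in> {0..k}" using col(2) by (auto simp: c_def ran_def split: option.splits)
    qed (auto simp: c_def)
    have "card {i \<in> {1..k}. \<forall>u\<in>?V - T. c u = i \<longrightarrow> {u, v} \<notin> E} \<le> 2 * \<beta>1" if v: "v \<in> T" for v
    proof -
      have finN: "finite (nbrs E v \<inter> S)" using finS by simp
      have "{i \<in> {1..k}. \<forall>u\<in>?V - T. c u = i \<longrightarrow> {u, v} \<notin> E} \<subseteq> avail E k col v \<union> c ` (nbrs E v \<inter> S)"
      proof
        fix i assume i: "i \<in> {i \<in> {1..k}. \<forall>u\<in>?V - T. c u = i \<longrightarrow> {u, v} \<notin> E}"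
        show "i \<in> avail E k col v \<union> c ` (nbrs E v \<inter> S)"
        proof (cases "i \<in> avail E k col v")
          case False
          then obtain u where u: "{u, v} \<in> E" "col u = Some i"
            using i by (auto simp: avail_def nbr_colours_def)
          have uV: "u \<in> ?V" using u(2) col(1) by auto
          hence cu: "c u = i" using u(2) by (simp add: c_def)
          have "u \<in> T" using i u(1) uV cu by blast
          hence "u \<in> nbrs E v \<inter> S" using u(1) T by (auto simp: nbrs_def)
          thus ?thesis using cu by blast
        qed simp
      qed
      hence "card {i \<in> {1..k}. \<forall>u\<in>?V - T. c u = i \<longrightarrow> {u, v} \<notin> E} \<le> card (avail E k col v \<union> c ` (nbrs E v \<inter> S))"
        using finN by (intro card_mono) auto
      also have "\<dots> \<le> card (avail E k col v) + card (c ` (nbrs E v \<inter> S))" by (rule card_Un_le)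
      also have "\<dots> \<le> card (avail E k col v) + card (nbrs E v \<inter> S)"
        using finN by (intro add_left_mono card_image_le)
      also have "\<dots> \<le> \<beta>1 + \<xi>"
      proof -
        have "v \<in> S" "v \<notin> ?R" using v T by auto
        hence "card (avail E k col v) < \<beta>1" "card (nbrs E v \<inter> S) < \<xi>" using S SV by auto
        thus ?thesis by linarith
      qed
      also have "\<dots> \<le> 2 * \<beta>1" using params by linarith
      finally show ?thesis .
    qed
    hence "starved n k t (2 * \<beta>1) E" unfolding starved_def using TV T(2) cP by blast
    thus False using s1 by simp
  qed
qed (use params in auto)

section \<open>The upper bound: numerical estimates\<close>

text \<open>The threshold \<open>d powr (4/5)\<close> is a lower bound for the typical number of available colours. Any
  exponent below 11/12 is reached with \<open>12 d / ln d\<close> colours, and any exponent above 2/3 makes the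
  set of vertices in real danger small enough to be locally sparse.\<close>

locale upper_params =
  fixes n :: nat and d :: real
  assumes n_ge: "real n \<ge> 100000000" and d_le: "d \<le> real n powr (1/4)"
    and d_ge: "d \<ge> 3" and ln_ge: "ln d \<ge> 100"
    and D_ge: "d powr (4/5) \<ge> 1000000" and D_le: "d powr (4/5) \<le> d"
    and k_le: "2 * (12 * d / ln d + 1) \<le> d"
    and k_ge: "12 * d / ln d - 1 \<ge> 10 * d / ln d"
    and mu_ge: "10 * d / ln d * d powr (- (1/9)) \<ge> d powr (4/5)"
    and D1: "36864 * d * ln d \<le> (d powr (4/5))\<^sup>2"
    and D2: "40000 * ln d \<le> d powr (4/5)"
    and D4: "2500 * (ln d)\<^sup>2 \<le> d powr (4/5)"
    and D3: "20480000 * (ln d)\<^sup>2 * (exp 16 * d powr (1/5)) * d\<^sup>2 \<le> (d powr (4/5)) ^ 3"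
begin

definition "l = ln d"
definition "D = d powr (4/5)"
definition "p = d / real n"
definition "k = nat \<lfloor>12 * d / l\<rfloor>"
text \<open>Chosen so that \<open>t * D / 4\<close> is at least \<open>2 * n * l\<close>, against a
  cost of at most \<open>n * l\<close> for choosing the vertex set and the colouring.\<close>

definition "t = nat \<lceil>8 * real n * l / D\<rceil>"
text \<open>Choosing the moves of a phase, of order \<open>n l / D\<close>, costs order
  \<open>n l^2 / D\<close>; each overattached vertex gains order \<open>D\<close> in the exponent.
  The quotient is the order of \<open>g2\<close>.\<close>

definition "g2 = nat \<lceil>40000 * real n * l\<^sup>2 / D\<^sup>2\<rceil>"
text \<open>\<open>2 * b1\<close> stays below \<open>D / 4\<close>, the level of
  \<open>starved\<close>; the smaller fractions leave \<open>b1 - b2\<close> at least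
  \<open>D / 32\<close> and \<open>2 * b + 3\<close> at most \<open>b2\<close>.\<close>

definition "b1 = nat \<lfloor>D / 8\<rfloor>"
definition "b2 = nat \<lfloor>D / 16\<rfloor>"
definition "b = nat \<lfloor>D / 64\<rfloor>"

lemma basic: "l \<ge> 100" "D \<ge> 1000000" "D \<le> d" "D > 0" "d > 0" "real n > 0" "0 \<le> p" "p < 1" "p * real n = d" "p \<le> 1/2000"
    "d\<^sup>2 \<le> real n powr (1/2)" "real n powr (3/4) \<le> real n / d" "real n \<ge> d\<^sup>2" "real n \<ge> D * D"
proof -
  show l: "l \<ge> 100" and "D \<ge> 1000000" "D \<le> d" "d > 0" and n0: "real n > 0"
    using ln_ge D_ge D_le d_ge n_ge by (auto simp: l_def D_def)
  show D0: "D > 0" using d_ge by (simp add: D_def)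
  have "d\<^sup>2 \<le> (real n powr (1/4))\<^sup>2" using d_le d_ge by (intro power_mono) auto
  also have "\<dots> = real n powr (1/2)" using n0 by (simp add: power2_eq_square flip: powr_add)
  finally show d2: "d\<^sup>2 \<le> real n powr (1/2)" .
  also have "\<dots> \<le> real n powr 1" using n_ge by (intro powr_mono) auto
  finally show d2n: "real n \<ge> d\<^sup>2" using n0 by simp
  have "D * D \<le> d * d" using \<open>D \<le> d\<close> D0 by (intro mult_mono) auto
  thus "real n \<ge> D * D" using d2n by (simp add: power2_eq_square)
  have "real n powr (3/4) * d \<le> real n powr (3/4) * real n powr (1/4)" using d_le by (intro mult_left_mono) auto
  also have "\<dots> = real n" using n0 by (simp flip: powr_add)
  finally show nd: "real n powr (3/4) \<le> real n / d" using d_ge by (simp add: pos_le_divide_eq)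
  have "2000 \<le> sqrt (real n)" using n_ge by (intro real_le_rsqrt) simp
  also have "\<dots> = real n powr (1/2)" by (simp add: powr_half_sqrt)
  also have "\<dots> \<le> real n powr (3/4)" using n_ge by (intro powr_mono) auto
  also have "\<dots> \<le> real n / d" by (rule nd)
  finally have "2000 * d \<le> real n" using d_ge by (simp add: pos_le_divide_eq)
  thus "p \<le> 1/2000" using n0 by (simp add: p_def divide_le_eq)
  thus "p < 1" by simp
  show "0 \<le> p" "p * real n = d" using d_ge n0 by (auto simp: p_def)
qed

lemma k_bounds: "10 * d / l \<le> real k" "real k \<le> 12 * d / l" "2 * (real k + 1) \<le> d" "k > 0"
proof -
  have pos: "0 \<le> 12 * d / l" using basic by simp
  have "real k = of_int \<lfloor>12 * d / l\<rfloor>" using pos by (simp add: k_def)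
  hence "12 * d / l - 1 \<le> real k" "real k \<le> 12 * d / l" by linarith+
  thus kl: "10 * d / l \<le> real k" and ku: "real k \<le> 12 * d / l" using k_ge unfolding l_def by linarith+
  have "2 * (real k + 1) \<le> 2 * (12 * d / l + 1)" using ku by (intro mult_left_mono add_right_mono) auto
  also have "\<dots> \<le> d" using k_le unfolding l_def .
  finally show "2 * (real k + 1) \<le> d" .
  have "0 < 10 * d / l" using basic by simp
  thus "k > 0" using kl by linarith
qed

text \<open>This is about \<open>k exp (- d / k)\<close>, the mean number of missing colours when
  all \<open>n\<close> vertices are coloured evenly. Rounding leaves \<open>d / k\<close> at most
  \<open>l / 10\<close>; the slack up to \<open>l / 9\<close> absorbs the difference between
  \<open>- ln (1 - p)\<close> and \<open>p\<close>.\<close>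

lemma mu_bound: "D \<le> real k * exp (ln (1 - p) * real n / real k)"
proof -
  have "- p - 2 * p\<^sup>2 \<le> ln (1 - p)" using basic by (intro ln_one_minus_pos_lower_bound) auto
  moreover have "2 * p\<^sup>2 \<le> 2 * (p * (1/2000))" unfolding power2_eq_square using basic by (intro mult_left_mono) auto
  ultimately have lp: "- (1001/1000 * p) \<le> ln (1 - p)" by linarith
  have "d / real k \<le> d / (10 * d / l)" using k_bounds basic by (intro divide_left_mono) auto
  also have "\<dots> = l / 10" using basic by simp
  finally have dk: "d / real k \<le> l / 10" .
  have "- (l / 9) \<le> - (1001/1000) * (d / real k)" using dk basic by linarith
  also have "\<dots> = - (1001/1000 * p) * (real n / real k)" 
  proof -
    have pk: "p * (real n / real k) = d / real k" by (simp only: times_divide_eq_right basic(9))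
    show ?thesis by (simp only: mult_minus_left mult.assoc pk)
  qed
  also have "\<dots> \<le> ln (1 - p) * (real n / real k)" using lp by (intro mult_right_mono) auto
  finally have "exp (- (l / 9)) \<le> exp (ln (1 - p) * real n / real k)" by simp
  moreover have "exp (- (l / 9)) = d powr (- (1/9))" using basic by (simp add: powr_def l_def)
  ultimately have "10 * d / l * d powr (- (1/9)) \<le> real k * exp (ln (1 - p) * real n / real k)"
    using k_bounds by (intro mult_mono) auto
  thus ?thesis using mu_ge unfolding D_def l_def by linarith
qed

lemma b_bounds: "real b1 \<le> D / 8" "D / 8 - 1 \<le> real b1" "real b2 \<le> D / 16" "D / 16 - 1 \<le> real b2"
  "real b \<le> D / 64" "D / 64 - 1 \<le> real b"
proof -
  have "real b1 = of_int \<lfloor>D / 8\<rfloor>" "real b2 = of_int \<lfloor>D / 16\<rfloor>" "real b = of_int \<lfloor>D / 64\<rfloor>"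
    using basic by (auto simp: b1_def b2_def b_def)
  thus "real b1 \<le> D / 8" "D / 8 - 1 \<le> real b1" "real b2 \<le> D / 16" "D / 16 - 1 \<le> real b2"
    "real b \<le> D / 64" "D / 64 - 1 \<le> real b" by linarith+
qed

definition "N = real n * l / D"

abbreviation "G \<equiv> 40000 * real n * l\<^sup>2 / D\<^sup>2"

lemma N_bounds: "N \<ge> 100" "real n \<ge> 40000 * N" "G \<le> N" "1 \<le> G"
proof -
  have "D * 100 \<le> real n * l" using basic by (intro mult_mono) (auto intro: order.trans[OF _ basic(14)])
  thus "N \<ge> 100" using basic by (simp add: N_def pos_le_divide_eq mult.commute)
  have D2': "40000 * l \<le> D" using D2 by (simp add: D_def l_def)
  hence "real n * (40000 * l) \<le> real n * D" by (intro mult_left_mono) auto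
  thus "real n \<ge> 40000 * N" using basic by (simp add: N_def divide_le_eq mult.assoc mult.left_commute)
  have "G = N * (40000 * l / D)" by (simp add: N_def power2_eq_square)
  also have "\<dots> \<le> N * 1" using D2' basic by (intro mult_left_mono) (auto simp: N_def)
  finally show "G \<le> N" by simp
  have "D\<^sup>2 * 1 \<le> 40000 * real n * l\<^sup>2"
  proof (rule mult_mono)
    show "D\<^sup>2 \<le> 40000 * real n" using basic(14) basic(6) by (simp add: power2_eq_square)
    show "1 \<le> l\<^sup>2" using basic by simp
  qed (use basic in auto)
  thus "1 \<le> G" using basic by (simp add: pos_le_divide_eq)
qed

lemma t_bounds: "8 * N \<le> real t" "real t \<le> 9 * N"
proof -
  have "real t = of_int \<lceil>8 * real n * l / D\<rceil>" using basic by (simp add: t_def)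
  hence "8 * real n * l / D \<le> real t" "real t \<le> 8 * real n * l / D + 1" by linarith+
  moreover have "8 * real n * l / D = 8 * N" by (simp add: N_def)
  ultimately show "8 * N \<le> real t" "real t \<le> 9 * N" using N_bounds by linarith+
qed

lemma g2_bounds: "G \<le> real g2" "real g2 \<le> 2 * G"
  "real g2 \<le> 2 * N" "real g2 \<ge> 1"
proof -
  define Q where "Q = G"
  have Q: "Q \<le> N" "1 \<le> Q" using N_bounds(3,4) by (simp_all only: Q_def)
  have "real g2 = of_int \<lceil>Q\<rceil>" using Q(2) by (simp add: g2_def Q_def[symmetric])
  hence "Q \<le> real g2" "real g2 \<le> Q + 1" by linarith+
  hence "Q \<le> real g2" "real g2 \<le> 2 * Q" "real g2 \<le> 2 * N" "real g2 \<ge> 1" using Q by linarith+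
  thus "G \<le> real g2" "real g2 \<le> 2 * G"
    "real g2 \<le> 2 * N" "real g2 \<ge> 1" unfolding Q_def by blast+
qed

lemma starved_small: "Gnp_prob n p (starved n k t (2 * b1)) \<le> exp (- real n)"
proof -
  define \<mu> where "\<mu> = real k * exp (ln (1 - p) * real n / real k)"
  have mu: "D \<le> \<mu>" using mu_bound by (simp add: \<mu>_def)
  have "Gnp_prob n p (starved n k t (2 * b1)) \<le> 2 ^ n * real (k + 1) ^ n * exp (- (real t * \<mu> / 4))"
  proof (rule starved_prob_le[OF basic(7,8) k_bounds(4) \<mu>_def])
    show "real (2 * b1) \<le> \<mu> / 4" using b_bounds mu by simp
  qed
  also have "2 ^ n * real (k + 1) ^ n = (2 * (real k + 1)) ^ n"
    by (simp only: power_mult_distrib of_nat_add of_nat_1)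
  also have "\<dots> \<le> d ^ n" using k_bounds by (intro power_mono) auto
  also have "d ^ n = exp (real n * l)" using basic by (simp add: exp_of_nat_mult l_def)
  also have "exp (- (real t * \<mu> / 4)) \<le> exp (- (2 * real n * l))"
  proof -
    have "(8 * N) * D \<le> real t * \<mu>" using t_bounds mu basic N_bounds by (intro mult_mono) auto
    moreover have "(8 * N) * D = 8 * real n * l" using basic by (simp add: N_def)
    ultimately show ?thesis by simp
  qed
  also have "exp (real n * l) * exp (- (2 * real n * l)) = exp (- (real n * l))" by (simp flip: exp_add)
  also have "\<dots> \<le> exp (- real n)" using mult_left_mono[of 1 l "real n"] basic by simp
  finally show ?thesis by simp
qed

text \<open>With \<open>s = g2 + 1\<close> the gain is \<open>s D / 64\<close>. Choosing
  \<open>S\<close> and the expected edges each cost at most \<open>s D / 256\<close>, together half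
  of it. The remaining \<open>s D / 128\<close> is at least \<open>312 N l\<close>, more than the
  \<open>144 N l\<close> for choosing \<open>M\<close>, and \<open>N l\<close> is at least
  \<open>n powr (3/4)\<close>.\<close>

lemma overattached_small: "Gnp_prob n p (overattached n (8 * t) (g2 + 1) (b1 - b2)) \<le> exp (- (real n powr (3/4)))"
proof -
  let ?m = "real (8 * t)" and ?s = "real (g2 + 1)" and ?xi = "real (b1 - b2)"
  have m: "64 * N \<le> ?m" "?m \<le> 72 * N" using t_bounds by auto
  have mpos: "0 < 8 * t" and mn: "8 * t \<le> n" and sn: "g2 + 1 \<le> n"
    using m N_bounds g2_bounds by linarith+
  have le: "b2 \<le> b1" using b_bounds basic by linarith
  have xi: "D / 32 \<le> ?xi" using le b_bounds basic by (simp add: of_nat_diff)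
  have lnm: "ln (real n / ?m) \<le> l"
  proof -
    have "real n / ?m \<le> real n / (64 * N)" using m N_bounds basic by (intro divide_left_mono) auto
    also have "\<dots> = D / (64 * l)" using basic by (simp add: N_def)
    also have "\<dots> \<le> D / 1" using basic by (intro divide_left_mono) auto
    also have "\<dots> \<le> d" using basic by simp
    finally have "real n / ?m \<le> d" .
    moreover have "0 < real n / ?m" using mpos basic by simp
    ultimately show ?thesis unfolding l_def by (subst ln_le_cancel_iff) (use basic in auto)
  qed
  have lns: "ln (real n / ?s) \<le> 2 * l"
  proof -
    have "real n / ?s \<le> real n / G"
      using g2_bounds basic by (intro divide_left_mono) auto
    also have "\<dots> = D\<^sup>2 / (40000 * l\<^sup>2)" using basic by simp
    also have "\<dots> \<le> D\<^sup>2 / 1"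
    proof (rule divide_left_mono)
      have "1 \<le> l\<^sup>2" using basic by simp
      thus "1 \<le> 40000 * l\<^sup>2" by simp
    qed (use basic in auto)
    also have "\<dots> \<le> d\<^sup>2" using basic by (simp add: power_mono)
    finally have "real n / ?s \<le> d\<^sup>2" .
    moreover have "0 < real n / ?s" using basic by simp
    ultimately have "ln (real n / ?s) \<le> ln (d\<^sup>2)" by (subst ln_le_cancel_iff) (use basic in auto)
    thus ?thesis using basic by (simp add: l_def ln_realpow)
  qed
  have A: "?m * (1 + ln (real n / ?m)) \<le> 144 * (N * l)"
  proof -
    have "?m * (1 + ln (real n / ?m)) \<le> (72 * N) * (2 * l)"
    proof (rule order.trans)
      show "?m * (1 + ln (real n / ?m)) \<le> ?m * (2 * l)" using lnm basic by (intro mult_left_mono) auto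
      show "?m * (2 * l) \<le> (72 * N) * (2 * l)" using m basic by (intro mult_right_mono) auto
    qed
    thus ?thesis by simp
  qed
  have B: "?s * (1 + ln (real n / ?s)) \<le> ?s * (D / 256)"
  proof (rule mult_left_mono)
    have "40000 * l \<le> D" using D2 by (simp add: D_def l_def)
    thus "1 + ln (real n / ?s) \<le> D / 256" using lns basic by linarith
  qed simp
  have C: "2 * p * ?m * ?s \<le> ?s * (D / 256)"
  proof -
    have "2 * p * ?m \<le> 2 * p * (72 * N)" using m basic by (intro mult_left_mono) auto
    also have "\<dots> = 144 * (p * real n) * l / D" by (simp add: N_def)
    also have "\<dots> = 144 * d * l / D" by (simp only: basic(9))
    also have "\<dots> \<le> D / 256"
      using D1 basic by (simp add: pos_divide_le_eq D_def[symmetric] l_def[symmetric] power2_eq_square)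
    finally have "2 * p * ?m \<le> D / 256" .
    from mult_right_mono[OF this, of ?s] show ?thesis by (simp add: mult.commute)
  qed
  have E: "?xi * ?s / 2 \<ge> ?s * (D / 64)"
    using mult_right_mono[OF xi, of ?s] by (simp add: mult.commute)
  have F: "?s * (D / 128) \<ge> 312 * (N * l)"
  proof -
    have "G \<le> ?s" using g2_bounds by simp
    hence "G * (D / 128) \<le> ?s * (D / 128)" using basic by (intro mult_right_mono) auto
    moreover have "G * (D / 128) = 40000 / 128 * (N * l)"
      using basic by (simp add: N_def power2_eq_square)
    moreover have "0 \<le> N * l" using N_bounds basic by simp
    ultimately show ?thesis by linarith
  qed
  have G: "real n powr (3/4) \<le> N * l"
  proof -
    have "real n / d \<le> real n / D" using basic by (intro divide_left_mono) auto
    also have "\<dots> * 1 \<le> real n / D * (l * l)"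
    proof (rule mult_left_mono)
      have "1 * 1 \<le> l * l" using basic by (intro mult_mono) auto
      thus "1 \<le> l * l" by simp
    qed (use basic in auto)
    hence "real n / D \<le> N * l" by (simp add: N_def)
    finally show ?thesis using basic(12) by linarith
  qed
  have "Gnp_prob n p (overattached n (8 * t) (g2 + 1) (b1 - b2)) \<le>
    exp (?m * (1 + ln (real n / ?m)) + ?s * (1 + ln (real n / ?s)) + 2 * p * ?m * ?s - ?xi * ?s / 2)"
    using basic mpos mn sn by (intro overattached_prob_le) auto
  also have "\<dots> \<le> exp (- (real n powr (3/4)))"
  proof -
    have "?s * (D / 256) + ?s * (D / 256) = ?s * (D / 128)" "?s * (D / 64) = ?s * (D / 128) + ?s * (D / 128)" by simp_all
    moreover have "a + bb + c - e \<le> - r"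
      if "h + h = s1" "s2 = s1 + s1" "a \<le> 144 * M" "bb \<le> h" "c \<le> h" "s2 \<le> e" "312 * M \<le> s1" "r \<le> M" "0 \<le> M"
      for a bb c e h s1 s2 M r :: real using that by linarith
    moreover have "0 \<le> N * l" using N_bounds basic by simp
    ultimately have "?m * (1 + ln (real n / ?m)) + ?s * (1 + ln (real n / ?s)) + 2 * p * ?m * ?s - ?xi * ?s / 2 \<le> - (real n powr (3/4))"
      using A B C E F G by blast
    thus ?thesis by simp
  qed
  finally show ?thesis .
qed

text \<open>The base \<open>x\<close> of the exponential moment satisfies \<open>x\<^sup>2 = b n / (z d\<^sup>2)\<close>, which brings both error
  terms of \<open>entangled_prob_le\<close> down to \<open>z b\<close>.\<close>

lemma entangled_small:
  assumes z: "0 < z" "z \<le> 2 * g2"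
  shows "Gnp_prob n p (entangled n z b) \<le> 1 / (real n)\<^sup>2"
proof -
  have b86: "real b \<ge> D / 128" "real b \<ge> 200" "real b \<le> d" using b_bounds basic by linarith+
  have zn: "z \<le> n" "real z \<le> 4 * N" using z g2_bounds N_bounds by linarith+
  define y where "y = real z * d\<^sup>2 / (real b * real n)"
  define \<Lambda> where "\<Lambda> = - ln y"
  define x where "x = exp (\<Lambda> / 2)"
  have y0: "y > 0" using z b86 basic by (simp add: y_def)
  have yle: "y \<le> exp (- (16 + l / 5))"
  proof -
    have z4: "real z \<le> 4 * G" using z g2_bounds by linarith
    have "y \<le> 4 * G * d\<^sup>2 / (D / 128 * real n)"
      unfolding y_def using z4 b86 basic by (intro frac_le mult_right_mono) auto
    \<comment> \<open>\<open>20480000 = 4 * 40000 * 128\<close>. Making this quotient small is what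
      requires an exponent of \<open>D\<close> above 2/3.\<close>
    also have "\<dots> = 20480000 * l\<^sup>2 * d\<^sup>2 / D ^ 3" using basic by (simp add: power2_eq_square power3_eq_cube)
    also have "\<dots> \<le> 1 / (exp 16 * d powr (1/5))"
      using D3 basic by (simp add: divide_le_eq pos_le_divide_eq D_def[symmetric] l_def[symmetric] mult_ac)
    also have "\<dots> = exp (- (16 + l / 5))" 
    proof -
      have "d powr (1/5) = exp (l / 5)" using basic by (simp add: powr_def l_def)
      thus ?thesis by (simp only: exp_minus exp_add inverse_eq_divide)
    qed
    finally show ?thesis .
  qed
  have L: "16 + l / 5 \<le> \<Lambda>"
  proof -
    have "ln y \<le> ln (exp (- (16 + l / 5)))" using yle y0 by (subst ln_le_cancel_iff) auto
    thus ?thesis by (simp add: \<Lambda>_def)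
  qed
  have x1: "1 \<le> x" using L basic by (simp add: x_def)
  have lnx: "ln x = \<Lambda> / 2" by (simp add: x_def)
  have x2: "x\<^sup>2 = real b * real n / (real z * d\<^sup>2)"
  proof -
    have "x\<^sup>2 = exp \<Lambda>" by (simp add: x_def power2_eq_square flip: exp_add)
    also have "\<dots> = 1 / y" using y0 by (simp add: \<Lambda>_def exp_minus inverse_eq_divide)
    finally show ?thesis by (simp add: y_def)
  qed
  have s1: "p * x\<^sup>2 * (real z)\<^sup>2 \<le> real z"
  proof -
    have "p * x\<^sup>2 * (real z)\<^sup>2 = real z * (real b / d)"
      unfolding x2 p_def using z basic by (simp add: power2_eq_square)
    also have "\<dots> \<le> real z * 1" using b86 basic by (intro mult_left_mono) auto
    finally show ?thesis by simp
  qed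
  have s2: "(real z * p * x)\<^sup>2 = real z * real b / real n"
    unfolding power_mult_distrib x2 p_def using z basic by (simp add: power2_eq_square)
  have small: "real z * p * x \<le> 1"
  proof -
    have z4: "real z \<le> 4 * G" using z g2_bounds by linarith
    have "real z * real b \<le> (4 * G) * (D / 64)"
      using z4 b_bounds by (intro mult_mono) auto
    also have "\<dots> = 2500 * real n * l\<^sup>2 / D" using basic by (simp add: power2_eq_square)
    also have "\<dots> \<le> real n"
    proof -
      have "2500 * l\<^sup>2 \<le> D" using D4 by (simp add: D_def l_def)
      hence "real n * (2500 * l\<^sup>2) \<le> real n * D" by (intro mult_left_mono) auto
      thus ?thesis using basic by (simp add: divide_le_eq mult_ac)
    qed
    finally have "(real z * p * x)\<^sup>2 \<le> 1" unfolding s2 using basic by (simp add: divide_le_eq)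
    thus ?thesis by (simp add: power_le_one_iff abs_square_le_1)
  qed
  have lnnz: "ln (real n / real z) \<le> 2 * l + \<Lambda>"
  proof -
    have "real n / real z \<le> d\<^sup>2 * (1 / y)"
    proof -
      have "d\<^sup>2 * (1 / y) = real b * (real n / real z)" unfolding y_def using basic z b86 by (simp add: field_simps)
      moreover have "1 * (real n / real z) \<le> real b * (real n / real z)" using b86 by (intro mult_right_mono) auto
      ultimately show ?thesis by simp
    qed
    hence "ln (real n / real z) \<le> ln (d\<^sup>2 * (1 / y))" using z basic y0 by (subst ln_le_cancel_iff) auto
    also have "\<dots> = 2 * l + \<Lambda>" using basic y0 by (simp add: ln_mult ln_div ln_realpow l_def \<Lambda>_def)
    finally show ?thesis .
  qed
  \<comment> \<open>For bounded \<open>z\<close> the decay in \<open>n\<close> comes from here: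
    \<open>d^2\<close> is at most the square root of \<open>n\<close>, so four copies of
    \<open>\<Lambda>\<close> yield a factor \<open>n^(-2)\<close>.\<close>
  have yn: "- 4 * \<Lambda> \<le> 4 * ln (real z) - 2 * ln (real n)"
  proof -
    have "y \<le> real z * real n powr (1/2) / (1 * real n)"
      unfolding y_def using basic b86 by (intro frac_le mult_left_mono mult_right_mono) auto
    also have "\<dots> = real z * real n powr (- (1/2))"
    proof -
      have "real n powr (1/2) / real n = real n powr (1/2 - 1)"
        using powr_diff[of "real n" "1/2" 1] basic by simp
      hence e: "real n powr (1/2) / real n = real n powr (- (1/2))" by simp
      show ?thesis by (simp only: mult_1 times_divide_eq_right[symmetric] e)
    qed
    finally have "ln y \<le> ln (real z * real n powr (- (1/2)))" using y0 z basic by (subst ln_le_cancel_iff) auto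
    also have "\<dots> = ln (real z) - ln (real n) / 2" using z basic by (simp add: ln_mult ln_powr)
    finally show ?thesis by (simp add: \<Lambda>_def)
  qed
  have "Gnp_prob n p (entangled n z b) \<le>
    exp (real z * (1 + ln (real n / real z)) + p * x\<^sup>2 * (real z)\<^sup>2 + real n * (real z * p * x)\<^sup>2 - real z * real b / 2 * ln x)"
    using basic z zn x1 small by (intro entangled_prob_le) auto
  also have "\<dots> \<le> exp (- 2 * ln (real n))"
  proof -
    have "real z * (1 + ln (real n / real z)) \<le> real z * (1 + (2 * l + \<Lambda>))" using lnnz by (intro mult_left_mono) auto
    moreover have "real n * (real z * p * x)\<^sup>2 = real z * real b" unfolding s2 using basic by simp
    moreover have "real z * real b / 2 * ln x = real z * (real b * \<Lambda> / 4)" unfolding lnx by simp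
    ultimately have "real z * (1 + ln (real n / real z)) + p * x\<^sup>2 * (real z)\<^sup>2 + real n * (real z * p * x)\<^sup>2 -
        real z * real b / 2 * ln x \<le> real z * (1 + (2 * l + \<Lambda>)) + real z + real z * real b - real z * (real b * \<Lambda> / 4)"
      using s1 by linarith
    also have "\<dots> = real z * (2 + 2 * l + \<Lambda> + real b - real b * \<Lambda> / 4)" by (simp add: algebra_simps)
    also have "\<dots> \<le> real z * (- 4 * \<Lambda>)"
    proof (rule mult_left_mono)
      \<comment> \<open>\<open>\<Lambda>\<close> being at least 16 lets
        \<open>b * \<Lambda> / 16\<close> pay for \<open>b\<close>. Since \<open>b\<close> is at
        least 200 and \<open>\<Lambda>\<close> at least \<open>l / 5\<close>, the rest covers
        \<open>2 * l\<close> and still leaves \<open>4 * \<Lambda>\<close>.\<close>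
      have "real b * 16 \<le> real b * \<Lambda>" using L basic by (intro mult_left_mono) auto
      moreover have "200 * \<Lambda> \<le> real b * \<Lambda>" using b86 L basic by (intro mult_right_mono) auto
      ultimately show "2 + 2 * l + \<Lambda> + real b - real b * \<Lambda> / 4 \<le> - 4 * \<Lambda>" using L basic(1) by argo
    qed simp
    also have "\<dots> = - 4 * \<Lambda> - 4 * ((real z - 1) * \<Lambda>)" by (simp add: algebra_simps)
    also have "\<dots> \<le> (4 * ln (real z) - 2 * ln (real n)) - 4 * ((real z - 1) * 1)"
    proof -
      have "(real z - 1) * 1 \<le> (real z - 1) * \<Lambda>" using z L basic by (intro mult_left_mono) auto
      thus ?thesis using yn by linarith
    qed
    also have "\<dots> \<le> - 2 * ln (real n)" using ln_le_minus_one[of "real z"] z by simp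
    finally show ?thesis by simp
  qed
  also have "\<dots> = 1 / (real n)\<^sup>2"
  proof -
    have "exp (- 2 * ln (real n)) = inverse (exp (2 * ln (real n)))" by (simp add: exp_minus)
    also have "exp (2 * ln (real n)) = (real n)\<^sup>2" using basic by (simp add: exp_double)
    finally show ?thesis by (simp add: inverse_eq_divide)
  qed
  finally show ?thesis .
qed

theorem A_wins_whp:
  "Gnp_prob n p (\<lambda>E. \<not> A_wins {1..n} E k True Map.empty) \<le>
     exp (- real n) + exp (- (real n powr (3/4))) + 1 / real n"
proof -
  have "Gnp_prob n p (\<lambda>E. \<not> A_wins {1..n} E k True Map.empty) \<le>
     Gnp_prob n p (\<lambda>E. (starved n k t (2 * b1) E \<or> overattached n (8 * t) (g2 + 1) (b1 - b2) E) \<or>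
       (\<exists>z\<in>{1..2 * g2}. entangled n z b E))"
  proof (rule Gnp_prob_mono)
    fix E assume E: "E \<subseteq> all_pairs n" and nw: "\<not> A_wins {1..n} E k True Map.empty"
    show "(starved n k t (2 * b1) E \<or> overattached n (8 * t) (g2 + 1) (b1 - b2) E) \<or>
       (\<exists>z\<in>{1..2 * g2}. entangled n z b E)"
    proof (rule ccontr)
      assume neg: "\<not> ?thesis"
      have "sparse_game {1..n} E k b1 b2 b (b1 - b2) (2 * t) g2 (8 * t)"
      proof (rule typical_sparse_game[OF E])
        show "b2 + (b1 - b2) \<le> b1" using b_bounds basic by linarith
        show "2 * b + 3 \<le> b2" "1 \<le> b" using b_bounds basic by linarith+
        have gt: "4 * real g2 + 3 \<le> 4 * real t" using g2_bounds(3) t_bounds(1) N_bounds(1) by linarith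
        show "g2 < t" using gt by linarith
        have "real (4 * g2 + 3) \<le> real (4 * t)" using gt by simp
        hence "4 * g2 + 3 \<le> 4 * t" by (simp only: of_nat_le_iff)
        thus "2 * (2 * t + 2 * g2) + 3 \<le> 8 * t" by presburger
        have "d powr (- (1/9)) \<le> 1" using d_ge by (simp add: powr_minus_divide ge_one_powr_ge_zero divide_le_eq_1)
        hence "10 * d / l * d powr (- (1/9)) \<le> 10 * d / l * 1" using basic by (intro mult_left_mono) auto
        hence "D \<le> 10 * d / l" using mu_ge unfolding D_def l_def by linarith
        thus "b1 \<le> k" using b_bounds k_bounds basic by linarith
      qed (use neg in auto)
      then interpret sparse_game "{1..n}" E k b1 b2 b "b1 - b2" "2 * t" g2 "8 * t" .
      show False using A_wins_start nw by simp
    qed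
  qed (use basic in auto)
  also have "\<dots> \<le> Gnp_prob n p (starved n k t (2 * b1)) + Gnp_prob n p (overattached n (8 * t) (g2 + 1) (b1 - b2)) +
      Gnp_prob n p (\<lambda>E. \<exists>z\<in>{1..2 * g2}. entangled n z b E)"
    using basic by (intro order.trans[OF Gnp_prob_disj_le] add_mono Gnp_prob_disj_le order.refl) auto
  also have "Gnp_prob n p (\<lambda>E. \<exists>z\<in>{1..2 * g2}. entangled n z b E) \<le> (\<Sum>z\<in>{1..2 * g2}. Gnp_prob n p (entangled n z b))"
    using basic by (intro Gnp_prob_Bex_le) auto
  also have "\<dots> \<le> (\<Sum>z\<in>{1..2 * g2}. 1 / (real n)\<^sup>2)" using entangled_small by (intro sum_mono) auto
  also have "\<dots> = real (2 * g2) * (1 / (real n)\<^sup>2)" by simp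
  also have "\<dots> \<le> real n * (1 / (real n)\<^sup>2)" using g2_bounds N_bounds by (intro mult_right_mono) auto
  also have "\<dots> = 1 / real n" using basic by (simp add: power2_eq_square)
  finally show ?thesis using starved_small overattached_small by linarith
qed

end

lemma chromatic_upper:
  "\<exists>d0::real. d0 \<ge> 3 \<and> (\<forall>d::nat \<Rightarrow> real. (\<forall>\<^sub>F n in sequentially. d0 \<le> d n \<and> d n \<le> real n powr (1/4)) \<longrightarrow>
      (\<lambda>n. Gnp_prob n (d n / real n)
         (\<lambda>E. real (game_chromatic {1..n} E) \<le> 12 * d n / ln (d n))) \<longlonglongrightarrow> 1)"
proof -
  have "\<forall>\<^sub>F d::real in at_top. d \<ge> 3 \<and> ln d \<ge> 100 \<and> d powr (4/5) \<ge> 1000000 \<and> d powr (4/5) \<le> d \<and>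
      2 * (12 * d / ln d + 1) \<le> d \<and> 12 * d / ln d - 1 \<ge> 10 * d / ln d \<and>
      10 * d / ln d * d powr (- (1/9)) \<ge> d powr (4/5) \<and> 36864 * d * ln d \<le> (d powr (4/5))\<^sup>2 \<and>
      40000 * ln d \<le> d powr (4/5) \<and> 2500 * (ln d)\<^sup>2 \<le> d powr (4/5) \<and>
      20480000 * (ln d)\<^sup>2 * (exp 16 * d powr (1/5)) * d\<^sup>2 \<le> (d powr (4/5)) ^ 3"
    by (intro eventually_conj) real_asymp+
  then obtain d0 where d0: "\<And>d::real. d \<ge> d0 \<Longrightarrow> d \<ge> 3 \<and> ln d \<ge> 100 \<and> d powr (4/5) \<ge> 1000000 \<and> d powr (4/5) \<le> d \<and>
      2 * (12 * d / ln d + 1) \<le> d \<and> 12 * d / ln d - 1 \<ge> 10 * d / ln d \<and>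
      10 * d / ln d * d powr (- (1/9)) \<ge> d powr (4/5) \<and> 36864 * d * ln d \<le> (d powr (4/5))\<^sup>2 \<and>
      40000 * ln d \<le> d powr (4/5) \<and> 2500 * (ln d)\<^sup>2 \<le> d powr (4/5) \<and>
      20480000 * (ln d)\<^sup>2 * (exp 16 * d powr (1/5)) * d\<^sup>2 \<le> (d powr (4/5)) ^ 3"
    unfolding eventually_at_top_linorder by blast
  show ?thesis
  proof (intro exI[of _ d0] conjI allI impI)
    show "d0 \<ge> 3" using d0[of d0] by auto
    fix d :: "nat \<Rightarrow> real"
    assume dn: "\<forall>\<^sub>F n in sequentially. d0 \<le> d n \<and> d n \<le> real n powr (1/4)"
    have big: "\<forall>\<^sub>F n in sequentially. real n \<ge> 100000000" by real_asymp
    have ev: "\<forall>\<^sub>F n in sequentially. upper_params n (d n)"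
      using dn big by eventually_elim (unfold upper_params_def, use d0 in blast)
    show "(\<lambda>n. Gnp_prob n (d n / real n)
         (\<lambda>E. real (game_chromatic {1..n} E) \<le> 12 * d n / ln (d n))) \<longlonglongrightarrow> 1"
    proof (rule Gnp_prob_tendsto_1[where
          Bad = "\<lambda>n E. \<not> A_wins {1..n} E (upper_params.k (d n)) True Map.empty"
          and eps = "\<lambda>n. exp (- real n) + exp (- (real n powr (3/4))) + 1 / real n"])
      show "\<forall>\<^sub>F n in sequentially. 0 \<le> d n / real n \<and> d n / real n \<le> 1"
        using ev
      proof eventually_elim
        case (elim n)
        then interpret upper_params n "d n" .
        show ?case using basic(7,8) unfolding p_def by simp
      qed
      show "\<forall>\<^sub>F n in sequentially. \<forall>E. E \<subseteq> all_pairs n \<longrightarrow>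
          \<not> real (game_chromatic {1..n} E) \<le> 12 * d n / ln (d n) \<longrightarrow>
          \<not> A_wins {1..n} E (upper_params.k (d n)) True Map.empty"
        using ev
      proof eventually_elim
        case (elim n)
        then interpret upper_params n "d n" .
        show ?case
        proof (intro allI impI notI)
          fix E assume big: "\<not> real (game_chromatic {1..n} E) \<le> 12 * d n / ln (d n)"
            and win: "A_wins {1..n} E k True Map.empty"
          have "game_chromatic {1..n} E \<le> k"
            unfolding game_chromatic_def using win k_bounds(4) by (intro Least_le) simp
          hence "real (game_chromatic {1..n} E) \<le> real k" by simp
          also have "\<dots> \<le> 12 * d n / ln (d n)" using k_bounds(2) by (simp add: l_def)
          finally show False using big by simp
        qed
      qed
      show "\<forall>\<^sub>F n in sequentially. Gnp_prob n (d n / real n)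
          (\<lambda>E. \<not> A_wins {1..n} E (upper_params.k (d n)) True Map.empty) \<le>
          exp (- real n) + exp (- (real n powr (3/4))) + 1 / real n"
        using ev
      proof eventually_elim
        case (elim n)
        then interpret upper_params n "d n" .
        show ?case using A_wins_whp unfolding p_def .
      qed
      show "(\<lambda>n. exp (- real n) + exp (- (real n powr (3/4))) + 1 / real n) \<longlonglongrightarrow> 0" by real_asymp
    qed
  qed
qed

section \<open>The theorem\<close>

text \<open>Reduces every \<open>\<alpha>\<close> to the extreme constants 4/7 and 12. The bound
  \<open>d0 >= 3\<close> keeps \<open>ln d\<close> positive, so that larger constants mean larger
  bounds.\<close>

lemma Gnp_prob_whp_mono:
  assumes whp: "\<exists>d0::real. d0 \<ge> 3 \<and> (\<forall>d::nat \<Rightarrow> real. (\<forall>\<^sub>F n in sequentially. d0 \<le> d n \<and> d n \<le> real n powr (1/4)) \<longrightarrow>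
      (\<lambda>n. Gnp_prob n (d n / real n) (P n (d n))) \<longlonglongrightarrow> 1)"
    and imp: "\<And>n x E. x \<ge> 3 \<Longrightarrow> P n x E \<Longrightarrow> P' n x E"
  shows "\<exists>d0::real. \<forall>d::nat \<Rightarrow> real. (\<forall>\<^sub>F n in sequentially. d0 \<le> d n \<and> d n \<le> real n powr (1/4)) \<longrightarrow>
      (\<lambda>n. Gnp_prob n (d n / real n) (P' n (d n))) \<longlonglongrightarrow> 1"
proof -
  obtain d0 :: real where d0: "d0 \<ge> 3"
    "\<And>d. (\<forall>\<^sub>F n in sequentially. d0 \<le> d n \<and> d n \<le> real n powr (1/4)) \<Longrightarrow>
      (\<lambda>n. Gnp_prob n (d n / real n) (P n (d n))) \<longlonglongrightarrow> 1"
    using whp by blast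
  show ?thesis
  proof (intro exI[of _ d0] allI impI)
    fix d :: "nat \<Rightarrow> real"
    assume d: "\<forall>\<^sub>F n in sequentially. d0 \<le> d n \<and> d n \<le> real n powr (1/4)"
    have ev: "\<forall>\<^sub>F n in sequentially. d n \<ge> 3 \<and> 0 \<le> d n / real n \<and> d n / real n \<le> 1"
      using d eventually_gt_at_top[of 0]
    proof eventually_elim
      case (elim n)
      have "real n powr (1/4) \<le> real n powr 1" using elim by (intro powr_mono) auto
      thus ?case using elim d0 by (auto simp: divide_le_eq)
    qed
    show "(\<lambda>n. Gnp_prob n (d n / real n) (P' n (d n))) \<longlonglongrightarrow> 1"
    proof (rule Gnp_prob_tendsto_1[where Bad = "\<lambda>n E. \<not> P n (d n) E"])
      show "\<forall>\<^sub>F n in sequentially. 0 \<le> d n / real n \<and> d n / real n \<le> 1"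
        using ev by eventually_elim blast
      show "\<forall>\<^sub>F n in sequentially. \<forall>E. E \<subseteq> all_pairs n \<longrightarrow> \<not> P' n (d n) E \<longrightarrow> \<not> P n (d n) E"
        using ev by eventually_elim (use imp in blast)
      show "\<forall>\<^sub>F n in sequentially. Gnp_prob n (d n / real n) (\<lambda>E. \<not> P n (d n) E) \<le>
          1 - Gnp_prob n (d n / real n) (P n (d n))"
        by (simp add: Gnp_prob_not)
      show "(\<lambda>n. 1 - Gnp_prob n (d n / real n) (P n (d n))) \<longlonglongrightarrow> 0"
        using tendsto_diff[OF tendsto_const d0(2)[OF d], of 1] by simp
    qed
  qed
qed

theorem theorem2:
  shows "(\<forall>\<alpha>::real. \<alpha> < 4/7 \<longrightarrow> (\<exists>d0::real. \<forall>d::nat \<Rightarrow> real.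
            (\<forall>\<^sub>F n in sequentially. d0 \<le> d n \<and> d n \<le> real n powr (1/4)) \<longrightarrow>
            (\<lambda>n. Gnp_prob n (d n / real n)
                   (\<lambda>E. real (game_chromatic {1..n} E) \<ge> \<alpha> * d n / ln (d n))) \<longlonglongrightarrow> 1))
       \<and> (\<forall>\<alpha>::real. \<alpha> > 12 \<longrightarrow> (\<exists>d0::real. \<forall>d::nat \<Rightarrow> real.
            (\<forall>\<^sub>F n in sequentially. d0 \<le> d n \<and> d n \<le> real n powr (1/4)) \<longrightarrow>
            (\<lambda>n. Gnp_prob n (d n / real n)
                   (\<lambda>E. real (game_chromatic {1..n} E) \<le> \<alpha> * d n / ln (d n))) \<longlonglongrightarrow> 1))"
proof (rule conjI; intro allI impI)
  fix \<alpha> :: real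
  assume \<alpha>: "\<alpha> < 4/7"
  have le: "\<alpha> * x / ln x \<le> (4/7) * x / ln x" if "x \<ge> 3" for x :: real
    using \<alpha> that by (intro divide_right_mono mult_right_mono) auto
  show "\<exists>d0::real. \<forall>d::nat \<Rightarrow> real.
            (\<forall>\<^sub>F n in sequentially. d0 \<le> d n \<and> d n \<le> real n powr (1/4)) \<longrightarrow>
            (\<lambda>n. Gnp_prob n (d n / real n)
                   (\<lambda>E. real (game_chromatic {1..n} E) \<ge> \<alpha> * d n / ln (d n))) \<longlonglongrightarrow> 1"
    by (rule Gnp_prob_whp_mono[where P' = "\<lambda>n x E. real (game_chromatic {1..n} E) \<ge> \<alpha> * x / ln x"
          and P = "\<lambda>n x E. real (game_chromatic {1..n} E) \<ge> (4/7) * x / ln x", OF chromatic_lower])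
       (rule order.trans[OF le])
next
  fix \<alpha> :: real
  assume \<alpha>: "\<alpha> > 12"
  have le: "12 * x / ln x \<le> \<alpha> * x / ln x" if "x \<ge> 3" for x :: real
    using \<alpha> that by (intro divide_right_mono mult_right_mono) auto
  show "\<exists>d0::real. \<forall>d::nat \<Rightarrow> real.
            (\<forall>\<^sub>F n in sequentially. d0 \<le> d n \<and> d n \<le> real n powr (1/4)) \<longrightarrow>
            (\<lambda>n. Gnp_prob n (d n / real n)
                   (\<lambda>E. real (game_chromatic {1..n} E) \<le> \<alpha> * d n / ln (d n))) \<longlonglongrightarrow> 1"
    by (rule Gnp_prob_whp_mono[where P' = "\<lambda>n x E. real (game_chromatic {1..n} E) \<le> \<alpha> * x / ln x"
          and P = "\<lambda>n x E. real (game_chromatic {1..n} E) \<le> 12 * x / ln x", OF chromatic_upper])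
       (rule order.trans[OF _ le])
qed

end
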